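(* Let $g\in H$ be a time-independent force, let $\mathcal{A}_g$ be the global attractor of $\frac{du}{dt}+\nu Au+B(u,u)=g$, let $b>0$ and $\delta>0$ be the constants associated with $g$ fixed as in the context, and let $\delta_0=4\delta/\pi$. Then $0\in\mathcal{A}_g$ if and only if the Taylor series $\sum_{n=0}^\infty U_nT^n$ converges in $|\cdot|_b$ for all $T\in\Delta=\{T\in\mathbb{C}:|T|<1\}$ and the sum $U(T)=\sum_{n=0}^\infty U_nT^n$, $|T|<1$, satisfies an estimate $|U(T)|_b\le M$ for some $M>0$, where the $U_n$ are computed recursively according to $$U_0=0,\qquad U_1=\delta_0g,\qquad U_2=-\frac{\nu\delta_0^2}{2}Ag,$$ and, for $n\ge2$, $$U_{n+1}=\frac{n-1}{n+1}U_{n-1}-\frac{\nu\delta_0}{n+1}AU_n-\frac{\delta_0}{n+1}\sum_{h+k=n,\ h,k\ge1}B(U_k,U_h).$$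
   Context: Fix $L>0$, $\nu>0$, $\Omega=[0,L]^2$, $\kappa_0=2\pi/L$. $H$ is the closure in $[L^2(\Omega)]^2$ of the $\Omega$-periodic $\mathbb{R}^2$-valued trigonometric polynomials $v$ with $\nabla\cdot v=0$ and $\int_\Omega v\,dx=0$; $|\cdot|$ denotes the $L^2$ norm. Elements of $H$ are written $u(x)=\sum_{k\in\mathbb{Z}^2\setminus\{0\}}\hat u(k)e^{i\kappa_0k\cdot x}$, with $|u|^2=L^2\sum_k|\hat u(k)|^2$. $\mathcal{P}$ is the orthogonal (Helmholtz-Leray) projection of $[L^2(\Omega)]^2$ onto $H$; $A=-\mathcal{P}\Delta$ $(=-\Delta)$ is the Stokes operator; $B(u,v)=\mathcal{P}((u\cdot\nabla)v)$. $H_{\mathbb{C}}=\{u+iv:u,v\in H\}$ is the complexification of $H$, to which $A$ and $B$ are extended (bi)linearly. The global attractor $\mathcal{A}_g$ is the set of all $u_0\in H$ for which there exists a solution $u(t)$ of $\frac{du}{dt}+\nu Au+B(u,u)=g$ defined for all $t\in\mathbb{R}$ with $u(0)=u_0$ and $\sup_{t\in\mathbb{R}}|u(t)|<\infty$. For $b>0$ and $u\in H_{\mathbb{C}}$, $|u|_b:=|E^bu|$ where $\widehat{E^bu}(k)=e^{b[\ln(|k|+e)]^2}\hat u(k)$, and $E_b$ is the (complexified) space of $u$ with $|u|_b<\infty$. Choice of $b$ and $\delta$: they are fixed in advance, depending only on $g$, so that if $0\in\mathcal{A}_g$, then every solution $u(t)$, $t\in\mathbb{R}$, in $\mathcal{A}_g$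 extends to a holomorphic $E_b$-valued function on the strip $\{\zeta\in\mathbb{C}:|\Im\zeta|<\delta\}$ that is bounded there in $|\cdot|_b$ by a constant independent of the solution (such a choice is provided by a previously established estimate). The $U_n$ are the Taylor coefficients at $T=0$ of $U(T)=u(t)$, where $u$ is the solution with $u(0)=0$ and $T=\frac{\exp(\pi t/2\delta)-1}{\exp(\pi t/2\delta)+1}$ maps the strip conformally onto $\Delta$. It is understood in the criterion that the recursion for the $U_n$ can be carried out. *)

theory Defs
  imports "HOL-Analysis.Analysis"
begin

text \<open>
  Vector fields on the periodic box are functions \<open>real^2 \<Rightarrow> complex^2\<close>; only their values on the
  box matter, and elements of \<open>[L\<^sup>2]\<^sup>2\<close> are represented by functions, with equality in \<open>L\<^sup>2\<close>
  being almost-everywhere equality (\<open>eq_ae\<close>).  Real vector fields are those with real values.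
  The unbounded operators are given by their graphs, so that each occurrence of an operator
  includes the claim that its argument lies in the domain.
\<close>

type_synonym vfield = "real^2 \<Rightarrow> complex^2"

definition Omega :: "real \<Rightarrow> (real^2) set" where
  "Omega L = cbox 0 (\<chi> i. L)"

definition kappa0 :: "real \<Rightarrow> real" where
  "kappa0 L = 2 * pi / L"

abbreviation leb :: "real \<Rightarrow> (real^2) measure" where
  "leb L \<equiv> lebesgue_on (Omega L)"

definition eq_ae :: "real \<Rightarrow> vfield \<Rightarrow> vfield \<Rightarrow> bool" where
  "eq_ae L u v \<longleftrightarrow> (AE x in leb L. u x = v x)"

definition l2_space :: "real \<Rightarrow> vfield set" where
  "l2_space L = {u. u \<in> borel_measurable (leb L) \<and> integrable (leb L) (\<lambda>x. (norm (u x))\<^sup>2)}"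

definition l2_norm :: "real \<Rightarrow> vfield \<Rightarrow> real" where
  "l2_norm L u = sqrt (\<integral>x. (norm (u x))\<^sup>2 \<partial>leb L)"

definition l2_inner :: "real \<Rightarrow> vfield \<Rightarrow> vfield \<Rightarrow> complex" where
  "l2_inner L u v = (\<integral>x. (\<Sum>i\<in>UNIV. u x $ i * cnj (v x $ i)) \<partial>leb L)"

definition fmode :: "real \<Rightarrow> int^2 \<Rightarrow> real^2 \<Rightarrow> complex" where
  "fmode L k x = exp (\<i> * of_real (kappa0 L * (\<Sum>i\<in>UNIV. of_int (k $ i) * x $ i)))"

definition trig_poly :: "real \<Rightarrow> vfield \<Rightarrow> bool" where
  "trig_poly L p \<longleftrightarrow> (\<exists>K c. finite K \<and> p = (\<lambda>x. \<Sum>k\<in>K. fmode L k x *s c k))"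

definition pd :: "2 \<Rightarrow> vfield \<Rightarrow> vfield" where
  "pd j u x = vector_derivative (\<lambda>s. u (x + s *\<^sub>R axis j 1)) (at 0)"

definition divergence :: "vfield \<Rightarrow> real^2 \<Rightarrow> complex" where
  "divergence u x = (\<Sum>j\<in>UNIV. pd j u x $ j)"

definition laplacian :: "vfield \<Rightarrow> vfield" where
  "laplacian u x = (\<Sum>j\<in>UNIV. pd j (pd j u) x)"

definition sol_trig_polys :: "real \<Rightarrow> vfield set" where
  "sol_trig_polys L = {v. trig_poly L v \<and> (\<forall>x i. v x $ i \<in> \<real>) \<and>
     (\<forall>x. divergence v x = 0) \<and> (\<integral>x. v x \<partial>leb L) = 0}"

definition H_space :: "real \<Rightarrow> vfield set" where
  "H_space L = {u \<in> l2_space L. \<forall>\<epsilon>>0. \<exists>v\<in>sol_trig_polys L. l2_norm L (\<lambda>x. u x - v x) < \<epsilon>}"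

definition HC_space :: "real \<Rightarrow> vfield set" where
  "HC_space L = {w. \<exists>u\<in>H_space L. \<exists>v\<in>H_space L. w = (\<lambda>x. u x + \<i> *s v x)}"

text \<open>
  \<open>leray L f h\<close> means \<open>h = \<P> f\<close>.  The complex-linear extension of the orthogonal projection onto
  \<open>H\<close> is the orthogonal projection onto the complexification of \<open>H\<close> for the Hermitian inner
  product.
\<close>

definition leray :: "real \<Rightarrow> vfield \<Rightarrow> vfield \<Rightarrow> bool" where
  "leray L f h \<longleftrightarrow> f \<in> l2_space L \<and> h \<in> HC_space L \<and>
     (\<forall>w\<in>HC_space L. l2_inner L (\<lambda>x. f x - h x) w = 0)"

text \<open>
  \<open>per_closure L D u w\<close> means \<open>D u = w\<close> for the \<open>L\<^sup>2\<close>-closure of a differential operator \<open>D\<close>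
  defined classically on trigonometric polynomials.  For \<open>D = pd j\<close> and \<open>D = laplacian\<close> this is
  the weak derivative and the weak Laplacian of periodic functions, the latter having the
  periodic Sobolev space of order 2 as its domain.
\<close>

definition per_closure :: "real \<Rightarrow> (vfield \<Rightarrow> vfield) \<Rightarrow> vfield \<Rightarrow> vfield \<Rightarrow> bool" where
  "per_closure L D u w \<longleftrightarrow> u \<in> l2_space L \<and> w \<in> l2_space L \<and>
     (\<exists>p. (\<forall>n. trig_poly L (p n)) \<and>
        (\<lambda>n. l2_norm L (\<lambda>x. p n x - u x)) \<longlonglongrightarrow> 0 \<and>
        (\<lambda>n. l2_norm L (\<lambda>x. D (p n) x - w x)) \<longlonglongrightarrow> 0)"

text \<open>\<open>stokes L u w\<close> means \<open>u \<in> D(A)\<close> and \<open>w = A u = - \<P> \<Delta> u\<close>.\<close>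

definition stokes :: "real \<Rightarrow> vfield \<Rightarrow> vfield \<Rightarrow> bool" where
  "stokes L u w \<longleftrightarrow> u \<in> HC_space L \<and>
     (\<exists>f. per_closure L laplacian u f \<and> leray L (\<lambda>x. - f x) w)"

text \<open>\<open>bilin L u v w\<close> means that \<open>(u \<cdot> \<nabla>) v\<close> is in \<open>[L\<^sup>2]\<^sup>2\<close> and \<open>w = B(u,v) = \<P> ((u \<cdot> \<nabla>) v)\<close>.\<close>

definition bilin :: "real \<Rightarrow> vfield \<Rightarrow> vfield \<Rightarrow> vfield \<Rightarrow> bool" where
  "bilin L u v w \<longleftrightarrow> u \<in> HC_space L \<and> v \<in> HC_space L \<and>
     (\<exists>d. (\<forall>j. per_closure L (pd j) v (d j)) \<and>
        leray L (\<lambda>x. \<Sum>j\<in>UNIV. (u x $ j) *s d j x) w)"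

definition ns_solution :: "real \<Rightarrow> real \<Rightarrow> vfield \<Rightarrow> (real \<Rightarrow> vfield) \<Rightarrow> bool" where
  "ns_solution L \<nu> g u \<longleftrightarrow>
     (\<forall>t. u t \<in> H_space L \<and>
        (\<exists>u'\<in>H_space L. \<exists>a c.
           ((\<lambda>h. l2_norm L (\<lambda>x. (1 / h) *\<^sub>R (u (t + h) x - u t x) - u' x)) \<longlongrightarrow> 0) (at 0) \<and>
           stokes L (u t) a \<and> bilin L (u t) (u t) c \<and>
           eq_ae L (\<lambda>x. u' x + \<nu> *\<^sub>R a x + c x) g))"

definition attractor :: "real \<Rightarrow> real \<Rightarrow> vfield \<Rightarrow> vfield set" where
  "attractor L \<nu> g = {u0 \<in> H_space L. \<exists>u. ns_solution L \<nu> g u \<and> eq_ae L (u 0) u0 \<and>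
     bdd_above (range (\<lambda>t. l2_norm L (u t)))}"

definition fcoeff :: "real \<Rightarrow> vfield \<Rightarrow> int^2 \<Rightarrow> complex^2" where
  "fcoeff L u k = (1 / L\<^sup>2) *\<^sub>R (\<integral>x. cnj (fmode L k x) *s u x \<partial>leb L)"

definition kabs :: "int^2 \<Rightarrow> real" where
  "kabs k = sqrt (\<Sum>i\<in>UNIV. (of_int (k $ i))\<^sup>2)"

definition Eb_weight :: "real \<Rightarrow> int^2 \<Rightarrow> real" where
  "Eb_weight b k = exp (b * (ln (kabs k + exp 1))\<^sup>2)"

text \<open>
  The norm of \<open>E\<^sup>b u\<close> is computed from its Fourier coefficients by
  \<open>|v|\<^sup>2 = L\<^sup>2 \<Sum>\<^sub>k |v\<^sub>k|\<^sup>2\<close>; the term \<open>k = 0\<close> vanishes on \<open>HC_space L\<close>.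
\<close>

definition Eb_space :: "real \<Rightarrow> real \<Rightarrow> vfield set" where
  "Eb_space L b = {u \<in> HC_space L.
     (\<lambda>k. (norm (Eb_weight b k *\<^sub>R fcoeff L u k))\<^sup>2) summable_on UNIV}"

definition Eb_norm :: "real \<Rightarrow> real \<Rightarrow> vfield \<Rightarrow> real" where
  "Eb_norm L b u = sqrt (L\<^sup>2 * (\<Sum>\<^sub>\<infinity>k\<in>UNIV. (norm (Eb_weight b k *\<^sub>R fcoeff L u k))\<^sup>2))"

definition Eb_holomorphic_on :: "real \<Rightarrow> real \<Rightarrow> (complex \<Rightarrow> vfield) \<Rightarrow> complex set \<Rightarrow> bool" where
  "Eb_holomorphic_on L b f S \<longleftrightarrow> open S \<and> (\<forall>\<zeta>\<in>S. f \<zeta> \<in> Eb_space L b) \<and>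
     (\<forall>\<zeta>\<in>S. \<exists>w\<in>Eb_space L b.
        ((\<lambda>h. Eb_norm L b (\<lambda>x. (1 / h) *s (f (\<zeta> + h) x - f \<zeta> x) - w x)) \<longlongrightarrow> 0) (at 0))"

definition Eb_sums :: "real \<Rightarrow> real \<Rightarrow> (nat \<Rightarrow> vfield) \<Rightarrow> vfield \<Rightarrow> bool" where
  "Eb_sums L b f s \<longleftrightarrow> (\<forall>n. f n \<in> Eb_space L b) \<and> s \<in> Eb_space L b \<and>
     (\<lambda>N. Eb_norm L b (\<lambda>x. (\<Sum>n<N. f n x) - s x)) \<longlonglongrightarrow> 0"

definition strip :: "real \<Rightarrow> complex set" where
  "strip \<delta> = {\<zeta>. \<bar>Im \<zeta>\<bar> < \<delta>}"

text \<open>The property by which the constants \<open>b\<close> and \<open>\<delta>\<close> are chosen for a given force \<open>g\<close>.\<close>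

definition admissible_constants :: "real \<Rightarrow> real \<Rightarrow> vfield \<Rightarrow> real \<Rightarrow> real \<Rightarrow> bool" where
  "admissible_constants L \<nu> g b \<delta> \<longleftrightarrow> b > 0 \<and> \<delta> > 0 \<and>
     ((\<lambda>x. 0) \<in> attractor L \<nu> g \<longrightarrow>
       (\<exists>C. \<forall>u. ns_solution L \<nu> g u \<and> (\<forall>t. u t \<in> attractor L \<nu> g) \<longrightarrow>
          (\<exists>f. Eb_holomorphic_on L b f (strip \<delta>) \<and>
             (\<forall>t::real. eq_ae L (f (of_real t)) (u t)) \<and>
             (\<forall>\<zeta>\<in>strip \<delta>. Eb_norm L b (f \<zeta>) \<le> C))))"

text \<open>
  \<open>taylor_recursion\<close> states that the recursion can be carried out (all the values of \<open>A\<close> and \<open>B\<close>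
  in it exist) and produces the sequence \<open>U\<close>, which is then unique up to null sets.
\<close>

definition taylor_recursion ::
  "real \<Rightarrow> real \<Rightarrow> real \<Rightarrow> vfield \<Rightarrow> (nat \<Rightarrow> vfield) \<Rightarrow> bool" where
  "taylor_recursion L \<nu> \<delta>0 g U \<longleftrightarrow>
     eq_ae L (U 0) (\<lambda>x. 0) \<and>
     eq_ae L (U 1) (\<lambda>x. \<delta>0 *\<^sub>R g x) \<and>
     (\<exists>a. stokes L g a \<and> eq_ae L (U 2) (\<lambda>x. (- (\<nu> * \<delta>0\<^sup>2 / 2)) *\<^sub>R a x)) \<and>
     (\<forall>n\<ge>2. \<exists>a c. stokes L (U n) a \<and>
        (\<forall>h k. h + k = n \<and> h \<ge> 1 \<and> k \<ge> 1 \<longrightarrow> bilin L (U k) (U h) (c h k)) \<and>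
        eq_ae L (U (n + 1)) (\<lambda>x.
          ((real n - 1) / (real n + 1)) *\<^sub>R U (n - 1) x
          - (\<nu> * \<delta>0 / (real n + 1)) *\<^sub>R a x
          - (\<delta>0 / (real n + 1)) *\<^sub>R
              (\<Sum>(h, k) \<in> {(h, k). h + k = n \<and> h \<ge> 1 \<and> k \<ge> 1}. c h k x)))"

end

theory Submission
  imports Defs "HOL-Complex_Analysis.Cauchy_Integral_Formula"
begin

text \<open>
  Everything is read off Fourier coefficients: an element of \<open>E\<^sub>b\<close> has coefficients decaying faster
  than any power of \<open>|k|\<close>, so it is an absolutely convergent Fourier series, on which \<open>A\<close> acts
  as the multiplier \<open>(\<kappa>\<^sub>0|k|)\<^sup>2\<close> and \<open>B\<close> as a projected convolution.  Under
  \<open>T = tanh (\<pi>t/4\<delta>)\<close> the equation becomes \<open>(1 - T\<^sup>2) U' = \<delta>\<^sub>0 (g - \<nu> A U - B(U,U))\<close>, and the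
  recursion is this equation written for the Taylor coefficients.  If \<open>0\<close> is in the attractor, the
  solution through it is bounded and holomorphic on the strip, hence on the disc, and Cauchy's
  inequalities, applied to finitely many modes tested against a vector, give convergence in \<open>E\<^sub>b\<close>.
  Conversely, a bounded sum of the series yields for each mode a holomorphic function on the strip
  bounded by a multiple of the inverse weight; the Cauchy estimates on discs of radius \<open>\<delta>\<close> are
  summable over the modes, which makes the resulting \<open>u(t)\<close> a bounded global solution.
\<close>

section \<open>Square-integrable fields and Fourier modes\<close>

text \<open>Uniqueness of Fourier coefficients rests on the definition of \<open>H_space\<close>:
  its members are L2 limits of trigonometric polynomials, so vanishing coefficients force a field to
  vanish almost everywhere. As \<open>Eb_norm\<close> is itself a weighted sum over coefficients,
  bounds mode by mode pass into and out of it. The obstacle is that B couples all modes and, in the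
  recursion, all earlier Taylor coefficients, so sums over modes and over powers of T must be
  interchanged. A bound uniform in n makes this legitimate: boundedness on the whole open disc lets
  the Cauchy radius tend to 1, so the weighted coefficients of U_n obey one bound for all n. The
  convolutions then have a summable majorant, at the price of a factor n + 1 from the Cauchy
  product. The differential equation is available for real times only. Real t corresponds to real T,
  and the identity theorem on a real diameter suffices to equate Taylor coefficients. In the
  converse g is merely in H; the regularity of g comes from U_1 being a multiple of g. Reality of
  the solution follows because the recursion preserves Hermitian symmetry.\<close>

lemma norm_smult: "norm (c *s (v::complex^'n)) = cmod c * norm v"
  by (simp add: norm_vec_def norm_mult L2_set_right_distrib)

lemma norm_vec_le_sum: "norm (v::complex^'n) \<le> (\<Sum>i\<in>UNIV. cmod (v $ i))"
  by (simp add: norm_vec_def L2_set_le_sum)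

lemma bounded_linear_smult: "bounded_linear (\<lambda>v::complex^'n. c *s v)"
  by (rule bounded_linear_intro[where K = "cmod c"])
     (auto simp: norm_smult vec_eq_iff algebra_simps)

lemma bounded_linear_smult_left: "bounded_linear (\<lambda>c. c *s (v::complex^'n))"
  by (rule bounded_linear_intro[where K = "norm v"])
     (auto simp: norm_smult vec_eq_iff algebra_simps)

lemma norm_fmode [simp]: "cmod (fmode L k x) = 1"
  by (simp add: fmode_def)

lemma fmode_0 [simp]: "fmode L 0 x = 1"
  by (simp add: fmode_def)

lemma fmode_add: "fmode L (k + l) x = fmode L k x * fmode L l x"
  by (simp add: fmode_def exp_add[symmetric] algebra_simps sum.distrib)

lemma cnj_fmode: "cnj (fmode L k x) = fmode L (- k) x"
  by (simp add: fmode_def exp_cnj sum_negf)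

lemma continuous_on_fmode: "continuous_on S (fmode L k)"
  unfolding fmode_def by (intro continuous_intros)

lemma borel_measurable_fmode [measurable]: "fmode L k \<in> borel_measurable (leb L)"
proof -
  have "fmode L k \<in> borel_measurable borel"
    by (intro borel_measurable_continuous_onI continuous_on_fmode)
  hence "fmode L k \<in> borel_measurable lebesgue"
    by (simp add: measurable_completion)
  thus ?thesis by (rule measurable_restrict_space1)
qed

lemma fmode_shift:
  assumes "L \<noteq> 0"
  shows "fmode L k (x + s *\<^sub>R axis j 1) = exp (\<i> * of_real (kappa0 L * of_int (k $ j) * s)) * fmode L k x"
proof -
  have "(\<Sum>i\<in>UNIV. of_int (k $ i) * (x + s *\<^sub>R axis j 1) $ i)
      = (\<Sum>i\<in>UNIV. of_int (k $ i) * x $ i) + of_int (k $ j) * s"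
    by (simp add: algebra_simps sum.distrib axis_def if_distrib[of "\<lambda>y. _ * y"] cong: if_cong)
  thus ?thesis by (simp add: fmode_def exp_add[symmetric] algebra_simps)
qed

lemma Omega_measurable [simp]: "Omega L \<in> sets lebesgue" "Omega L \<in> sets borel"
  by (auto simp: Omega_def)

lemma measure_Omega:
  assumes "L > 0"
  shows "measure lebesgue (Omega L) = L\<^sup>2"
proof -
  have "(0::real^2) \<le> (\<chi> i. L)" using assms by (simp add: less_eq_vec_def)
  thus ?thesis using assms unfolding Omega_def
    by (simp add: content_cbox_if_cart interval_eq_empty_cart prod_constant UNIV_2 power2_eq_square)
qed

lemma finite_measure_leb: "finite_measure (leb L)"
  by (simp add: Omega_def finite_measure_lebesgue_on)

lemma integral_exp_periods:
  assumes "L > 0" "n \<noteq> 0"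
  shows "(\<integral>t. indicator {0..L} t *\<^sub>R exp (\<i> * of_real (kappa0 L * of_int n * t)) \<partial>lborel) = 0"
proof -
  define c where "c = \<i> * of_real (kappa0 L * of_int n)"
  have c: "c \<noteq> 0" using assms by (simp add: c_def kappa0_def)
  have "has_bochner_integral lborel (\<lambda>t. indicator {0..L} t *\<^sub>R exp (c * of_real t))
      (exp (c * of_real L) / c - exp (c * of_real 0) / c)"
  proof (rule has_bochner_integral_FTC_Icc[where F="\<lambda>t. exp (c * of_real t) / c"])
    fix x :: real
    show "((\<lambda>t. exp (c * of_real t) / c) has_vector_derivative exp (c * of_real x)) (at x within {0..L})"
      unfolding has_vector_derivative_def[symmetric]
      by (rule has_vector_derivative_eq_rhs, rule has_vector_derivative_real_field)
         (auto intro!: derivative_eq_intros simp: c)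
  qed (use assms in \<open>auto intro!: continuous_intros\<close>)
  moreover have "c * of_real L = 2 * of_int n * of_real pi * \<i>"
    using assms by (simp add: c_def kappa0_def)
  hence "exp (c * of_real L) = 1" by (auto simp: exp_eq_1)
  ultimately show ?thesis
    by (auto dest: has_bochner_integral_integral_eq simp: c_def algebra_simps)
qed

text \<open>Lebesgue measure on the plane is the image of a product of one-dimensional measures
  indexed by \<open>Basis\<close>, and a mode restricted to the box is a product of functions of
  single coordinates. A nonzero component of \<open>k\<close> makes one factor an integral over
  whole periods.\<close>

lemma integral_fmode:
  assumes "L > 0"
  shows "(\<integral>x. fmode L k x \<partial>leb L) = (if k = 0 then of_real (L\<^sup>2) else 0)"
proof (cases "k = 0")
  case True
  have "(\<lambda>x. fmode L 0 x) = (\<lambda>x. 1)" by auto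
  thus ?thesis using True measure_Omega[OF assms]
    by (simp add: measure_restrict_space scaleR_conv_of_real)
next
  case False
  then obtain i where i: "k $ i \<noteq> 0" by (auto simp: vec_eq_iff)
  \<comment> \<open>Indexed by basis vectors because the product measure is; for
    \<open>b = axis i 1\<close> the inner sum is just \<open>k $ i\<close>.\<close>
  define \<phi> :: "real^2 \<Rightarrow> real \<Rightarrow> complex" where
    "\<phi> b t = indicator {0..L} t *\<^sub>R exp (\<i> * of_real (kappa0 L * (\<Sum>i\<in>UNIV. of_int (k $ i) * b $ i) * t))" for b t
  interpret product_sigma_finite "\<lambda>_::real^2. lborel :: real measure" ..
  have m: "\<phi> b \<in> borel_measurable borel" for b
    unfolding \<phi>_def by measurable
  have int: "integrable lborel (\<phi> b)" for b
    unfolding \<phi>_def by (rule borel_integrable_compact) (auto intro!: continuous_intros)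
  have eq: "indicator (Omega L) (\<Sum>b\<in>Basis. f b *\<^sub>R b) *\<^sub>R fmode L k (\<Sum>b\<in>Basis. f b *\<^sub>R b)
      = (\<Prod>b\<in>Basis. \<phi> b (f b))" for f :: "real^2 \<Rightarrow> real"
  proof -
    have inj: "inj (\<lambda>i::2. axis i (1::real))" by (auto simp: inj_on_def axis_eq_axis)
    have B: "(Basis :: (real^2) set) = range (\<lambda>i. axis i 1)" by (auto simp: Basis_vec_def)
    have comp: "(\<Sum>b\<in>Basis. f b *\<^sub>R b) $ i = f (axis i 1)" for i
      unfolding B by (subst sum.reindex[OF inj])
        (simp add: axis_def if_distrib[of "\<lambda>y. _ * y"] cong: if_cong)
    have 1: "(\<Sum>j\<in>UNIV. of_int (k $ j) * axis i (1::real) $ j) = of_int (k $ i)" for i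
      by (simp add: axis_def if_distrib[of "\<lambda>y. _ * y"] cong: if_cong)
    have "(\<Prod>b\<in>Basis. \<phi> b (f b)) = (\<Prod>i\<in>UNIV. \<phi> (axis i 1) (f (axis i 1)))"
      unfolding B by (subst prod.reindex[OF inj]) simp
    also have "\<dots> = (\<Prod>i\<in>UNIV. of_real (indicator {0..L} (f (axis i 1))) *
        exp (\<i> * of_real (kappa0 L * of_int (k $ i) * f (axis i 1))))"
      by (simp add: \<phi>_def 1 scaleR_conv_of_real)
    also have "\<dots> = indicator (Omega L) (\<Sum>b\<in>Basis. f b *\<^sub>R b) *\<^sub>R fmode L k (\<Sum>b\<in>Basis. f b *\<^sub>R b)"
      unfolding Omega_def fmode_def comp
      by (auto simp: UNIV_2 mem_box_cart comp indicator_def exp_add[symmetric] algebra_simps forall_2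
          simp del: sum_component)
    finally show ?thesis by simp
  qed
  have mb: "(\<lambda>x. indicator (Omega L) x *\<^sub>R fmode L k x) \<in> borel_measurable borel"
    by (intro borel_measurable_scaleR borel_measurable_indicator
        borel_measurable_continuous_onI continuous_on_fmode) auto
  have "(\<integral>x. fmode L k x \<partial>leb L) = (\<integral>x. indicator (Omega L) x *\<^sub>R fmode L k x \<partial>lebesgue)"
    by (subst integral_restrict_space) auto
  also have "\<dots> = (\<integral>x. indicator (Omega L) x *\<^sub>R fmode L k x \<partial>lborel)"
    by (rule integral_completion) (use mb in simp)
  also have "\<dots> = (\<integral>f. (\<Prod>b\<in>Basis. \<phi> b (f b)) \<partial>(\<Pi>\<^sub>M b\<in>(Basis::(real^2) set). lborel))"
    by (subst lborel_eq, subst integral_distr) (use mb in \<open>auto simp: eq\<close>)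
  also have "\<dots> = (\<Prod>b\<in>Basis. \<integral>t. \<phi> b t \<partial>lborel)"
    by (rule product_integral_prod) (auto simp: int)
  also have "\<dots> = 0"
  proof (rule prod_zero)
    show "\<exists>b\<in>(Basis::(real^2) set). (\<integral>t. \<phi> b t \<partial>lborel) = 0"
    proof (rule bexI[of _ "axis i 1"])
      have 1: "(\<Sum>j\<in>UNIV. of_int (k $ j) * axis i (1::real) $ j) = of_int (k $ i)"
        by (simp add: axis_def if_distrib[of "\<lambda>y. _ * y"] cong: if_cong)
      show "(\<integral>t. \<phi> (axis i 1) t \<partial>lborel) = 0"
        unfolding \<phi>_def 1 by (rule integral_exp_periods) (use assms i in auto)
    qed (auto simp: Basis_vec_def)
  qed auto
  finally show ?thesis using False by simp
qed


lemma continuous_on_smult: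
  fixes f :: "'a::topological_space \<Rightarrow> complex" and g :: "'a \<Rightarrow> complex^'n"
  assumes "continuous_on S f" "continuous_on S g"
  shows "continuous_on S (\<lambda>x. f x *s g x)"
  unfolding vector_scalar_mult_def
  by (intro continuous_intros continuous_on_vec_lambda continuous_on_component assms)

lemma borel_measurable_smult [measurable (raw)]:
  fixes f :: "'a \<Rightarrow> complex" and g :: "'a \<Rightarrow> complex^'n"
  assumes [measurable]: "f \<in> borel_measurable M" "g \<in> borel_measurable M"
  shows "(\<lambda>x. f x *s g x) \<in> borel_measurable M"
  using assms by (rule borel_measurable_continuous_Pair)
    (intro continuous_on_smult continuous_intros)

lemma borel_measurable_vec_nth' [measurable (raw)]:
  fixes g :: "'a \<Rightarrow> complex^'n"
  assumes [measurable]: "g \<in> borel_measurable M"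
  shows "(\<lambda>x. g x $ i) \<in> borel_measurable M"
  by (rule borel_measurable_continuous_on[where f = "\<lambda>v::complex^'n. v $ i"])
     (use assms in \<open>auto intro!: continuous_on_component continuous_intros\<close>)

section \<open>L2 on the box: Cauchy-Schwarz, triangle inequality and null sets\<close>

lemma l2_measurable: "u \<in> l2_space L \<Longrightarrow> u \<in> borel_measurable (leb L)"
  and l2_integrable_sq: "u \<in> l2_space L \<Longrightarrow> integrable (leb L) (\<lambda>x. (norm (u x))\<^sup>2)"
  by (auto simp: l2_space_def)

lemma integrable_const_leb [simp]: "integrable (leb L) (\<lambda>x. c :: 'a::{banach,second_countable_topology})"
  by (rule finite_measure.integrable_const[OF finite_measure_leb])

lemma l2_integrable_mult:
  assumes "u \<in> l2_space L" "v \<in> l2_space L"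
  shows "integrable (leb L) (\<lambda>x. norm (u x) * norm (v x))"
proof (rule Bochner_Integration.integrable_bound)
  show "integrable (leb L) (\<lambda>x. (norm (u x))\<^sup>2 + (norm (v x))\<^sup>2)"
    using assms by (auto intro: l2_integrable_sq)
  show "(\<lambda>x. norm (u x) * norm (v x)) \<in> borel_measurable (leb L)"
    using assms[THEN l2_measurable] by measurable
  have "a * b \<le> a\<^sup>2 + b\<^sup>2" if "a \<ge> 0" "b \<ge> 0" for a b :: real
    using sum_squares_bound[of a b] mult_nonneg_nonneg[OF that] by linarith
  thus "AE x in leb L. norm (norm (u x) * norm (v x)) \<le> norm ((norm (u x))\<^sup>2 + (norm (v x))\<^sup>2)"
    by simp
qed

lemma l2_norm_nonneg [simp]: "l2_norm L u \<ge> 0"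
  by (simp add: l2_norm_def)

lemma l2_norm_sq: "(l2_norm L u)\<^sup>2 = (\<integral>x. (norm (u x))\<^sup>2 \<partial>leb L)"
  by (simp add: l2_norm_def)

text \<open>The integral of the square of \<open>s * norm (u x) - norm (v x)\<close> is a
  nonnegative quadratic in \<open>s\<close>; its value at the minimiser \<open>s = I / A\<close>
  gives the inequality.\<close>

lemma l2_Cauchy_Schwarz:
  assumes u: "u \<in> l2_space L" and v: "v \<in> l2_space L"
  shows "(\<integral>x. norm (u x) * norm (v x) \<partial>leb L) \<le> l2_norm L u * l2_norm L v"
proof -
  define I where "I = (\<integral>x. norm (u x) * norm (v x) \<partial>leb L)"
  define A where "A = (l2_norm L u)\<^sup>2"
  define B where "B = (l2_norm L v)\<^sup>2"
  have AB: "A \<ge> 0" "B \<ge> 0" by (auto simp: A_def B_def)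
  have q: "0 \<le> s\<^sup>2 * A - 2 * s * I + B" for s
  proof -
    have "0 \<le> (\<integral>x. (s * norm (u x) - norm (v x))\<^sup>2 \<partial>leb L)" by simp
    also have "\<dots> = (\<integral>x. s\<^sup>2 * (norm (u x))\<^sup>2 - 2 * s * (norm (u x) * norm (v x)) + (norm (v x))\<^sup>2 \<partial>leb L)"
      by (simp add: power2_diff power_mult_distrib algebra_simps)
    also have "\<dots> = s\<^sup>2 * A - 2 * s * I + B"
      unfolding A_def B_def I_def l2_norm_sq
      using l2_integrable_sq[OF u] l2_integrable_sq[OF v] l2_integrable_mult[OF u v] by simp
    finally show ?thesis .
  qed
  have "I\<^sup>2 \<le> A * B"
  proof (cases "A = 0")
    case True
    have "I = 0"
    proof (rule ccontr)
      assume "I \<noteq> 0"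
      \<comment> \<open>With \<open>A = 0\<close> the quadratic is affine in \<open>s\<close>, and
        this choice gives it the value -1.\<close>
      thus False using q[of "(B + 1) / (2 * I)"] True by simp
    qed
    thus ?thesis using AB by simp
  next
    case False
    hence "A > 0" using AB by simp
    thus ?thesis using q[of "I / A"] by (simp add: field_simps power2_eq_square)
  qed
  also have "A * B = (l2_norm L u * l2_norm L v)\<^sup>2" by (simp add: A_def B_def power_mult_distrib)
  finally show ?thesis unfolding I_def[symmetric]
    by (rule power2_le_imp_le) simp
qed

lemma l2_add:
  assumes u: "u \<in> l2_space L" and v: "v \<in> l2_space L"
  shows "(\<lambda>x. u x + v x) \<in> l2_space L"
proof -
  have [measurable]: "u \<in> borel_measurable (leb L)" "v \<in> borel_measurable (leb L)"
    using u v by (auto intro: l2_measurable)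
  have "integrable (leb L) (\<lambda>x. (norm (u x + v x))\<^sup>2)"
  proof (rule Bochner_Integration.integrable_bound)
    show "integrable (leb L) (\<lambda>x. (norm (u x))\<^sup>2 + 2 * (norm (u x) * norm (v x)) + (norm (v x))\<^sup>2)"
      using u v by (intro Bochner_Integration.integrable_add integrable_mult_right l2_integrable_sq l2_integrable_mult)
    have "(norm (u x + v x))\<^sup>2 \<le> (norm (u x) + norm (v x))\<^sup>2" for x
      by (intro power_mono norm_triangle_ineq) auto
    thus "AE x in leb L. norm ((norm (u x + v x))\<^sup>2) \<le>
        norm ((norm (u x))\<^sup>2 + 2 * (norm (u x) * norm (v x)) + (norm (v x))\<^sup>2)"
      by (auto simp: power2_sum algebra_simps)
  qed auto
  thus ?thesis by (simp add: l2_space_def)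
qed

lemma l2_norm_triangle:
  assumes u: "u \<in> l2_space L" and v: "v \<in> l2_space L"
  shows "l2_norm L (\<lambda>x. u x + v x) \<le> l2_norm L u + l2_norm L v"
proof (rule power2_le_imp_le)
  have "(l2_norm L (\<lambda>x. u x + v x))\<^sup>2 = (\<integral>x. (norm (u x + v x))\<^sup>2 \<partial>leb L)" by (rule l2_norm_sq)
  also have "\<dots> \<le> (\<integral>x. (norm (u x))\<^sup>2 + 2 * (norm (u x) * norm (v x)) + (norm (v x))\<^sup>2 \<partial>leb L)"
  proof (rule integral_mono)
    have "(norm (u x + v x))\<^sup>2 \<le> (norm (u x) + norm (v x))\<^sup>2" for x
      by (intro power_mono norm_triangle_ineq) auto
    thus "(norm (u x + v x))\<^sup>2 \<le> (norm (u x))\<^sup>2 + 2 * (norm (u x) * norm (v x)) + (norm (v x))\<^sup>2" for x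
      by (simp add: power2_sum algebra_simps)
    show "integrable (leb L) (\<lambda>x. (norm (u x + v x))\<^sup>2)"
      by (rule l2_integrable_sq[OF l2_add[OF u v]])
  qed (use u v in \<open>intro Bochner_Integration.integrable_add integrable_mult_right l2_integrable_sq
      l2_integrable_mult\<close>)
  also have "\<dots> = (l2_norm L u)\<^sup>2 + 2 * (\<integral>x. norm (u x) * norm (v x) \<partial>leb L) + (l2_norm L v)\<^sup>2"
    unfolding l2_norm_sq
    using l2_integrable_sq[OF u] l2_integrable_sq[OF v] l2_integrable_mult[OF u v] by simp
  also have "\<dots> \<le> (l2_norm L u + l2_norm L v)\<^sup>2"
    using l2_Cauchy_Schwarz[OF u v] by (simp add: power2_sum algebra_simps)
  finally show "(l2_norm L (\<lambda>x. u x + v x))\<^sup>2 \<le> (l2_norm L u + l2_norm L v)\<^sup>2" .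
qed simp

lemma l2_smult: "u \<in> l2_space L \<Longrightarrow> (\<lambda>x. c *s u x) \<in> l2_space L"
  by (auto simp: l2_space_def norm_smult power_mult_distrib)

lemma l2_norm_smult: "l2_norm L (\<lambda>x. c *s u x) = cmod c * l2_norm L u"
  by (simp add: l2_norm_def norm_smult power_mult_distrib real_sqrt_mult)

lemma l2_uminus: "u \<in> l2_space L \<Longrightarrow> (\<lambda>x. - u x) \<in> l2_space L"
  by (auto simp: l2_space_def)

lemma l2_diff: "u \<in> l2_space L \<Longrightarrow> v \<in> l2_space L \<Longrightarrow> (\<lambda>x. u x - v x) \<in> l2_space L"
  using l2_add[OF _ l2_uminus, of u L v] by simp

lemma l2_norm_uminus: "l2_norm L (\<lambda>x. - u x) = l2_norm L u"
  by (simp add: l2_norm_def)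

lemma l2_norm_minus_commute: "l2_norm L (\<lambda>x. u x - v x) = l2_norm L (\<lambda>x. v x - u x)"
  by (simp add: l2_norm_def norm_minus_commute)

lemma l2_bounded:
  assumes L: "L > 0" and [measurable]: "u \<in> borel_measurable (leb L)" and M: "\<And>x. norm (u x) \<le> M"
  shows "u \<in> l2_space L" "l2_norm L u \<le> L * M"
proof -
  have M0: "M \<ge> 0" using M[of 0] norm_ge_zero[of "u 0"] by linarith
  have le: "(norm (u x))\<^sup>2 \<le> M\<^sup>2" for x by (intro power_mono M) auto
  have i: "integrable (leb L) (\<lambda>x. (norm (u x))\<^sup>2)"
    by (rule Bochner_Integration.integrable_bound[where f = "\<lambda>x. M\<^sup>2"])
       (measurable, use le in \<open>auto simp del: power2_le_iff_abs_le abs_le_square_iff power_mono_iff\<close>)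
  thus "u \<in> l2_space L" by (simp add: l2_space_def)
  have "(l2_norm L u)\<^sup>2 \<le> (\<integral>x. M\<^sup>2 \<partial>leb L)"
    unfolding l2_norm_sq by (intro integral_mono i le) auto
  also have "\<dots> = (L * M)\<^sup>2"
    using measure_Omega[OF L] by (simp add: measure_restrict_space power_mult_distrib)
  finally show "l2_norm L u \<le> L * M" by (rule power2_le_imp_le) (use M0 L in simp)
qed

text \<open>Completeness of Lebesgue measure makes any function equal almost everywhere to a
  measurable one measurable. Hence hypotheses of the form \<open>eq_ae\<close> can be used without
  separate measurability assumptions.\<close>

lemma l2_eq_ae:
  assumes "u \<in> l2_space L" "eq_ae L v u"
  shows "v \<in> l2_space L"
proof -
  have [measurable]: "u \<in> borel_measurable (leb L)" using assms(1) by (rule l2_measurable)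
  have AE: "AE x in lebesgue. x \<in> Omega L \<longrightarrow> v x = u x"
    using assms(2) unfolding eq_ae_def by (subst (asm) AE_restrict_space_iff) auto
  have [measurable]: "v \<in> borel_measurable (leb L)"
  proof (rule measurableI)
    fix B :: "(complex^2) set" assume B: "B \<in> sets borel"
    have uB: "u -` B \<inter> Omega L \<in> sets lebesgue"
      using measurable_sets[of u "leb L" borel B] B by (auto simp: sets_restrict_space_iff)
    have "v -` B \<inter> Omega L \<in> sets lebesgue"
      by (rule completion.in_sets_AE[OF _ uB]) (use AE in auto)
    thus "v -` B \<inter> space (leb L) \<in> sets (leb L)"
      by (auto simp: sets_restrict_space_iff)
  qed auto
  have "integrable (leb L) (\<lambda>x. (norm (v x))\<^sup>2)"
    by (rule Bochner_Integration.integrable_cong_AE_imp[OF l2_integrable_sq[OF assms(1)]])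
       (use assms(2) in \<open>auto simp: eq_ae_def\<close>)
  thus ?thesis by (simp add: l2_space_def)
qed

lemma l2_norm_cong_ae:
  assumes "u \<in> l2_space L" "eq_ae L v u"
  shows "l2_norm L v = l2_norm L u"
proof -
  have "v \<in> l2_space L" using assms by (rule l2_eq_ae)
  thus ?thesis using assms l2_measurable[of u L] l2_measurable[of v L] unfolding l2_norm_def eq_ae_def
    by (intro arg_cong[where f = sqrt] integral_cong_AE) auto
qed

lemma l2_norm_eq_0:
  assumes "u \<in> l2_space L" "l2_norm L u = 0"
  shows "eq_ae L u (\<lambda>x. 0)"
proof -
  have "(\<integral>x. (norm (u x))\<^sup>2 \<partial>leb L) = 0" using assms(2) by (simp add: l2_norm_def)
  hence "AE x in leb L. (norm (u x))\<^sup>2 = 0"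
    using l2_integrable_sq[OF assms(1)] by (subst (asm) integral_nonneg_eq_0_iff_AE) auto
  thus ?thesis by (simp add: eq_ae_def)
qed

lemma l2_integrable:
  assumes "u \<in> l2_space L"
  shows "integrable (leb L) u"
proof (rule Bochner_Integration.integrable_bound)
  show "integrable (leb L) (\<lambda>x. 1 + (norm (u x))\<^sup>2)"
    using assms by (auto intro: l2_integrable_sq)
  have "a \<le> 1 + a\<^sup>2" for a :: real
  proof -
    have "0 \<le> (a - 1 / 2)\<^sup>2" by simp
    thus ?thesis by (simp add: power2_diff field_simps)
  qed
  thus "AE x in leb L. norm (u x) \<le> norm (1 + (norm (u x))\<^sup>2)"
    by (simp add: add_nonneg_nonneg)
qed (rule l2_measurable[OF assms])

lemma integrable_bounded_smult:
  fixes u :: vfield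
  assumes "integrable (leb L) u" and [measurable]: "c \<in> borel_measurable (leb L)"
    and M: "\<And>x. cmod (c x) \<le> M"
  shows "integrable (leb L) (\<lambda>x. c x *s u x)"
proof (rule Bochner_Integration.integrable_bound)
  show "integrable (leb L) (\<lambda>x. M * norm (u x))" using assms(1) by auto
  show "AE x in leb L. norm (c x *s u x) \<le> norm (M * norm (u x))"
  proof (rule AE_I2)
    fix x
    have "norm (c x *s u x) \<le> M * norm (u x)"
      by (simp add: norm_smult mult_right_mono M)
    thus "norm (c x *s u x) \<le> norm (M * norm (u x))" by (simp add: order_trans[OF _ abs_ge_self])
  qed
qed (use assms(1) in \<open>auto intro!: borel_measurable_smult borel_measurable_integrable\<close>)

lemma integrable_cnj_fmode_smult:
  "integrable (leb L) (u::vfield) \<Longrightarrow> integrable (leb L) (\<lambda>x. cnj (fmode L k x) *s u x)"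
  unfolding cnj_fmode by (rule integrable_bounded_smult[where M = 1]) auto

section \<open>Fourier coefficients of L2 fields\<close>

lemma fcoeff_add:
  "u \<in> l2_space L \<Longrightarrow> v \<in> l2_space L \<Longrightarrow> fcoeff L (\<lambda>x. u x + v x) k = fcoeff L u k + fcoeff L v k"
  unfolding fcoeff_def
  by (simp add: vector_add_ldistrib integrable_cnj_fmode_smult l2_integrable scaleR_add_right)

lemma fcoeff_uminus: "fcoeff L (\<lambda>x. - u x) k = - fcoeff L u k"
proof -
  have "(\<lambda>x. cnj (fmode L k x) *s - u x) = (\<lambda>x. - (cnj (fmode L k x) *s u x))"
    by (auto simp: vec_eq_iff)
  thus ?thesis by (simp add: fcoeff_def)
qed

lemma fcoeff_diff:
  "u \<in> l2_space L \<Longrightarrow> v \<in> l2_space L \<Longrightarrow> fcoeff L (\<lambda>x. u x - v x) k = fcoeff L u k - fcoeff L v k"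
  using fcoeff_add[OF _ l2_uminus, of u L v k] by (simp add: fcoeff_uminus)

lemma fcoeff_smult:
  assumes "u \<in> l2_space L"
  shows "fcoeff L (\<lambda>x. c *s u x) k = c *s fcoeff L u k"
proof -
  have "(\<integral>x. c *s (cnj (fmode L k x) *s u x) \<partial>leb L) = c *s (\<integral>x. cnj (fmode L k x) *s u x \<partial>leb L)"
    by (rule integral_bounded_linear[OF bounded_linear_smult])
       (intro integrable_cnj_fmode_smult l2_integrable assms)
  moreover have "c *s (cnj (fmode L k x) *s u x) = cnj (fmode L k x) *s (c *s u x)" for x
    by (simp add: vec_eq_iff)
  moreover have "r *\<^sub>R (c *s w) = c *s (r *\<^sub>R w)" for r and w :: "complex^2"
    by (simp add: vec_eq_iff)
  ultimately show ?thesis unfolding fcoeff_def by (simp add: mult.commute)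
qed

lemma fcoeff_cong_ae:
  assumes "u \<in> l2_space L" "eq_ae L v u"
  shows "fcoeff L v k = fcoeff L u k"
proof -
  have "v \<in> l2_space L" using assms by (rule l2_eq_ae)
  note [measurable] = l2_measurable[OF this] l2_measurable[OF assms(1)]
  have "(\<integral>x. cnj (fmode L k x) *s v x \<partial>leb L) = (\<integral>x. cnj (fmode L k x) *s u x \<partial>leb L)"
    by (rule integral_cong_AE) (use assms(2) in \<open>auto simp: eq_ae_def cnj_fmode\<close>)
  thus ?thesis by (simp add: fcoeff_def)
qed

text \<open>Cauchy-Schwarz against a constant unit field, whose L2 norm is at most \<open>L\<close>.
  Each coefficient is thus continuous in L2, which is how facts about coefficients survive the
  limits in \<open>H_space\<close> and \<open>per_closure\<close>.\<close>

lemma norm_fcoeff_le: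
  assumes L: "L > 0" and u: "u \<in> l2_space L"
  shows "norm (fcoeff L u k) \<le> l2_norm L u / L"
proof -
  define e :: vfield where "e = (\<lambda>x. axis 1 1)"
  have n1: "norm (axis 1 1 :: complex^2) = 1" by simp
  have e: "e \<in> l2_space L" "l2_norm L e \<le> L * 1"
    by (rule l2_bounded[OF L, where M = 1]; simp add: e_def n1)+
  have "norm (\<integral>x. cnj (fmode L k x) *s u x \<partial>leb L) \<le> (\<integral>x. norm (cnj (fmode L k x) *s u x) \<partial>leb L)"
    by (rule integral_norm_bound)
  also have "\<dots> = (\<integral>x. norm (u x) * norm (e x) \<partial>leb L)"
    by (simp add: norm_smult e_def n1)
  also have "\<dots> \<le> l2_norm L u * l2_norm L e" by (rule l2_Cauchy_Schwarz[OF u e(1)])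
  also have "\<dots> \<le> l2_norm L u * L" using e(2) by (intro mult_left_mono) auto
  finally show ?thesis using L by (simp add: fcoeff_def field_simps power2_eq_square)
qed

section \<open>Absolutely convergent Fourier series\<close>

lemma borel_measurable_cnj [measurable (raw)]:
  "f \<in> borel_measurable M \<Longrightarrow> (\<lambda>x. cnj (f x)) \<in> borel_measurable M"
  by (rule borel_measurable_continuous_on[where f = cnj]) (auto intro!: continuous_intros)

lemma has_sum_sum:
  fixes f :: "'i \<Rightarrow> 'a \<Rightarrow> 'b::topological_comm_monoid_add"
  assumes "\<And>i. i \<in> I \<Longrightarrow> (f i has_sum s i) A"
  shows "((\<lambda>x. \<Sum>i\<in>I. f i x) has_sum (\<Sum>i\<in>I. s i)) A"
  using assms by (induction I rule: infinite_finite_induct) (auto intro!: has_sum_add)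

lemma scaleR_eq_smult: "r *\<^sub>R v = complex_of_real r *s v" for v :: "complex^'n"
  by (simp add: vec_eq_iff scaleR_conv_of_real[where 'a = complex])

lemma norm_sum_mult_cnj_le:
  "cmod (\<Sum>i\<in>UNIV. u $ i * cnj (v $ i)) \<le> norm u * norm (v::complex^'n)"
proof -
  have "cmod (\<Sum>i\<in>UNIV. u $ i * cnj (v $ i)) \<le> (\<Sum>i\<in>UNIV. cmod (u $ i * cnj (v $ i)))"
    by (rule norm_sum)
  also have "\<dots> = (\<Sum>i\<in>UNIV. \<bar>cmod (u $ i)\<bar> * \<bar>cmod (v $ i)\<bar>)"
    by (simp add: norm_mult)
  also have "\<dots> \<le> norm u * norm v"
    unfolding norm_vec_def by (rule L2_set_mult_ineq)
  finally show ?thesis .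
qed

lemma l2_inner_integrable:
  assumes u: "u \<in> l2_space L" and v: "v \<in> l2_space L"
  shows "integrable (leb L) (\<lambda>x. \<Sum>i\<in>UNIV. u x $ i * cnj (v x $ i))"
proof (rule Bochner_Integration.integrable_bound[OF l2_integrable_mult[OF u v]])
  note [measurable] = u[THEN l2_measurable] v[THEN l2_measurable]
  show "(\<lambda>x. \<Sum>i\<in>UNIV. u x $ i * cnj (v x $ i)) \<in> borel_measurable (leb L)"
    by measurable
qed (simp add: norm_sum_mult_cnj_le)

lemma l2_inner_bound:
  assumes u: "u \<in> l2_space L" and v: "v \<in> l2_space L"
  shows "cmod (l2_inner L u v) \<le> l2_norm L u * l2_norm L v"
proof -
  have "cmod (l2_inner L u v) \<le> (\<integral>x. norm (u x) * norm (v x) \<partial>leb L)"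
    unfolding l2_inner_def
    by (rule Bochner_Integration.integral_norm_bound_integral[OF l2_inner_integrable[OF u v] l2_integrable_mult[OF u v]])
       (rule norm_sum_mult_cnj_le)
  thus ?thesis using l2_Cauchy_Schwarz[OF u v] by linarith
qed

lemma l2_inner_commute: "l2_inner L u v = cnj (l2_inner L v u)"
  unfolding l2_inner_def by (subst Bochner_Integration.integral_cnj[symmetric]) (simp add: mult.commute)

lemma l2_inner_self: "l2_inner L u u = of_real ((l2_norm L u)\<^sup>2)"
proof -
  have "(\<Sum>i\<in>UNIV. u x $ i * cnj (u x $ i)) = complex_of_real ((norm (u x))\<^sup>2)" for x
    by (simp add: norm_vec_def L2_set_def complex_norm_square sum_nonneg del: of_real_power)
  thus ?thesis unfolding l2_inner_def l2_norm_sq by (simp del: of_real_power)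
qed

lemma l2_inner_diff_left:
  assumes "u \<in> l2_space L" "v \<in> l2_space L" "w \<in> l2_space L"
  shows "l2_inner L (\<lambda>x. u x - v x) w = l2_inner L u w - l2_inner L v w"
proof -
  have "(\<Sum>i\<in>UNIV. (u x - v x) $ i * cnj (w x $ i)) =
      (\<Sum>i\<in>UNIV. u x $ i * cnj (w x $ i)) - (\<Sum>i\<in>UNIV. v x $ i * cnj (w x $ i))" for x
    by (simp add: sum_subtractf left_diff_distrib)
  thus ?thesis unfolding l2_inner_def
    using assms by (simp add: l2_inner_integrable)
qed

lemma fcoeff_nth:
  assumes "integrable (leb L) u"
  shows "fcoeff L u k $ i = (\<integral>x. cnj (fmode L k x) * u x $ i \<partial>leb L) / of_real (L\<^sup>2)"
proof -
  have "(\<integral>x. (cnj (fmode L k x) *s u x) $ i \<partial>leb L) = (\<integral>x. cnj (fmode L k x) *s u x \<partial>leb L) $ i"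
    by (rule integral_bounded_linear[OF bounded_linear_vec_nth])
       (rule integrable_cnj_fmode_smult[OF assms])
  thus ?thesis by (simp add: fcoeff_def scaleR_eq_smult)
qed

abbreviation asum :: "(int^2 \<Rightarrow> complex^2) \<Rightarrow> bool" where
  "asum a \<equiv> (\<lambda>k. norm (a k)) summable_on UNIV"

text \<open>An unordered sum, meaningful under \<open>asum\<close>. Fields with such coefficients
  form the Wiener algebra of the torus, where products turn into absolutely convergent
  convolutions.\<close>

definition fser :: "real \<Rightarrow> (int^2 \<Rightarrow> complex^2) \<Rightarrow> vfield" where
  "fser L a x = (\<Sum>\<^sub>\<infinity>k. fmode L k x *s a k)"

text \<open>Exhausts the lattice by finite sets indexed by \<open>nat\<close>, so that unordered
  sums become sequential limits, as dominated convergence requires. Symmetry under negation lets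
  truncation preserve real fields.\<close>

definition sqbox :: "nat \<Rightarrow> (int^2) set" where
  "sqbox n = {k. \<forall>i. \<bar>k $ i\<bar> \<le> int n}"

lemma finite_sqbox: "finite (sqbox n)"
proof (rule finite_subset)
  show "sqbox n \<subseteq> (\<lambda>(a, b). vector [a, b]) ` ({- int n..int n} \<times> {- int n..int n})"
  proof
    fix k assume k: "k \<in> sqbox n"
    have "\<bar>k $ 1\<bar> \<le> int n" "\<bar>k $ 2\<bar> \<le> int n" using k by (auto simp: sqbox_def)
    moreover have "k = vector [k $ 1, k $ 2]" by (simp add: vec_eq_iff forall_2)
    ultimately show "k \<in> (\<lambda>(a, b). vector [a, b]) ` ({- int n..int n} \<times> {- int n..int n})"
      by (intro image_eqI[of _ _ "(k $ 1, k $ 2)"]) auto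
  qed
qed auto

lemma uminus_sqbox: "k \<in> sqbox n \<Longrightarrow> - k \<in> sqbox n"
  by (auto simp: sqbox_def)

lemma filterlim_sqbox: "filterlim sqbox (finite_subsets_at_top UNIV) sequentially"
  unfolding filterlim_finite_subsets_at_top
proof safe
  fix K :: "(int^2) set" assume K: "finite K"
  define N where "N = (\<Sum>k\<in>K. \<Sum>i\<in>UNIV. nat \<bar>k $ i\<bar>)"
  have "K \<subseteq> sqbox n" if "n \<ge> N" for n
  proof
    fix k assume k: "k \<in> K"
    have "nat \<bar>k $ i\<bar> \<le> n" for i
    proof -
      have "nat \<bar>k $ i\<bar> \<le> (\<Sum>i\<in>UNIV. nat \<bar>k $ i\<bar>)" by (rule member_le_sum) auto
      also have "\<dots> \<le> N" unfolding N_def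
        using k K by (intro member_le_sum[where f = "\<lambda>k. \<Sum>i\<in>UNIV. nat \<bar>k $ i\<bar>"]) auto
      finally show ?thesis using that by simp
    qed
    thus "k \<in> sqbox n" unfolding sqbox_def by (auto simp: nat_le_iff)
  qed
  thus "\<forall>\<^sub>F y in sequentially. finite (sqbox y) \<and> K \<subseteq> sqbox y \<and> sqbox y \<subseteq> UNIV"
    by (auto simp: finite_sqbox eventually_sequentially)
qed

lemma has_sum_imp_sqbox_tendsto:
  "(f has_sum s) UNIV \<Longrightarrow> (\<lambda>n. \<Sum>k\<in>sqbox n. f k) \<longlonglongrightarrow> s"
  unfolding has_sum_def using filterlim_compose[OF _ filterlim_sqbox] by blast

lemma asum_nth: "asum a \<Longrightarrow> (\<lambda>k. cmod (a k $ i)) summable_on UNIV"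
  by (rule summable_on_comparison_test) (auto simp: Finite_Cartesian_Product.norm_nth_le)

lemma asum_comparison:
  assumes "asum a" "\<And>k. norm (c k) \<le> C * norm (a k)"
  shows "asum c"
  by (rule summable_on_comparison_test[OF summable_on_cmult_right[OF assms(1), of C]]) (auto simp: assms(2))

lemma asum_add: "asum a \<Longrightarrow> asum c \<Longrightarrow> asum (\<lambda>k. a k + c k)"
  by (rule summable_on_comparison_test[OF summable_on_add[of "\<lambda>k. norm (a k)" _ "\<lambda>k. norm (c k)"]])
     (auto simp: norm_triangle_ineq)

lemma asum_uminus: "asum a \<Longrightarrow> asum (\<lambda>k. - a k)"
  by simp

lemma asum_diff: "asum a \<Longrightarrow> asum c \<Longrightarrow> asum (\<lambda>k. a k - c k)"
  using asum_add[OF _ asum_uminus, of a c] by simp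

lemma asum_smult: "asum a \<Longrightarrow> asum (\<lambda>k. c *s a k)"
  by (rule asum_comparison[where C = "cmod c"]) (auto simp: norm_smult)

lemma asum_finite:
  assumes "finite {k. a k \<noteq> 0}"
  shows "asum a"
proof -
  have "(\<lambda>k. norm (a k)) summable_on {k. a k \<noteq> 0}" using assms by simp
  thus ?thesis by (subst summable_on_cong_neutral[where T = "{k. a k \<noteq> 0}" and g = "\<lambda>k. norm (a k)"]) auto
qed

lemma fser_has_sum:
  assumes "asum a"
  shows "((\<lambda>k. fmode L k x *s a k) has_sum fser L a x) UNIV"
proof -
  have "(\<lambda>k. norm (fmode L k x *s a k)) summable_on UNIV"
    using assms by (simp add: norm_smult)
  hence "(\<lambda>k. fmode L k x *s a k) summable_on UNIV" by (rule abs_summable_summable)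
  thus ?thesis by (simp add: fser_def)
qed

lemma fser_eqI: "asum a \<Longrightarrow> ((\<lambda>k. fmode L k x *s a k) has_sum s) UNIV \<Longrightarrow> fser L a x = s"
  using fser_has_sum infsumI by (metis fser_def)

lemma norm_fser_le:
  assumes "asum a"
  shows "norm (fser L a x) \<le> (\<Sum>\<^sub>\<infinity>k. norm (a k))"
proof -
  have "norm (\<Sum>\<^sub>\<infinity>k. fmode L k x *s a k) \<le> (\<Sum>\<^sub>\<infinity>k. norm (fmode L k x *s a k))"
    by (rule norm_infsum_bound) (use assms in \<open>simp add: norm_smult\<close>)
  thus ?thesis by (simp add: fser_def norm_smult)
qed

lemma fser_partial_tendsto:
  "asum a \<Longrightarrow> (\<lambda>n. \<Sum>k\<in>sqbox n. fmode L k x *s a k) \<longlonglongrightarrow> fser L a x"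
  by (rule has_sum_imp_sqbox_tendsto[OF fser_has_sum])

lemma borel_measurable_fser [measurable (raw)]:
  assumes "asum a"
  shows "fser L a \<in> borel_measurable (leb L)"
  by (rule borel_measurable_LIMSEQ_metric[OF _ fser_partial_tendsto[OF assms]]) measurable

lemma fser_l2:
  assumes "L > 0" "asum a"
  shows "fser L a \<in> l2_space L" "l2_norm L (fser L a) \<le> L * (\<Sum>\<^sub>\<infinity>k. norm (a k))"
  using l2_bounded[OF assms(1) borel_measurable_fser[OF assms(2)] norm_fser_le[OF assms(2)]] by auto

lemma fser_add: "asum a \<Longrightarrow> asum c \<Longrightarrow> fser L (\<lambda>k. a k + c k) x = fser L a x + fser L c x"
  by (rule fser_eqI[OF asum_add]) (auto simp: vector_add_ldistrib intro!: has_sum_add fser_has_sum)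

lemma fser_smult:
  assumes "asum a"
  shows "fser L (\<lambda>k. c *s a k) x = c *s fser L a x"
proof (rule fser_eqI[OF asum_smult[OF assms]])
  have "((\<lambda>k. c *s (fmode L k x *s a k)) has_sum c *s fser L a x) UNIV"
    by (rule has_sum_bounded_linear[OF bounded_linear_smult fser_has_sum[OF assms]])
  thus "((\<lambda>k. fmode L k x *s (c *s a k)) has_sum c *s fser L a x) UNIV"
    by (simp add: mult.commute)
qed

lemma fser_uminus: "asum a \<Longrightarrow> fser L (\<lambda>k. - a k) x = - fser L a x"
  using fser_smult[of a L "-1" x] by simp

lemma fser_diff: "asum a \<Longrightarrow> asum c \<Longrightarrow> fser L (\<lambda>k. a k - c k) x = fser L a x - fser L c x"
  using fser_add[OF _ asum_uminus, of a c L x] by (simp add: fser_uminus)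

lemma fser_scaleR: "asum a \<Longrightarrow> fser L (\<lambda>k. r *\<^sub>R a k) x = r *\<^sub>R fser L a x"
  unfolding scaleR_eq_smult by (rule fser_smult)

lemma fser_finite:
  assumes "finite K" "\<And>k. k \<notin> K \<Longrightarrow> a k = 0"
  shows "fser L a x = (\<Sum>k\<in>K. fmode L k x *s a k)"
proof -
  have "(\<Sum>\<^sub>\<infinity>k. fmode L k x *s a k) = (\<Sum>\<^sub>\<infinity>k\<in>K. fmode L k x *s a k)"
    by (rule infsum_cong_neutral) (auto simp: assms(2))
  thus ?thesis using assms(1) by (simp add: fser_def)
qed

text \<open>Dominated convergence along \<open>sqbox\<close>, with the total mass of
  \<open>a\<close> times \<open>cmod (w x)\<close> as majorant. The weight \<open>w\<close> is only
  integrable, which later allows weak derivatives in its place.\<close>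

lemma fser_integral:
  assumes a: "asum a" and w: "integrable (leb L) w"
  shows "((\<lambda>k. a k $ i * (\<integral>x. fmode L k x * w x \<partial>leb L)) has_sum (\<integral>x. fser L a x $ i * w x \<partial>leb L)) UNIV"
proof -
  define I where "I k = (\<integral>x. fmode L k x * w x \<partial>leb L)" for k
  note [measurable] = borel_measurable_integrable[OF w]
  have int: "integrable (leb L) (\<lambda>x. fmode L k x * w x)" for k
    by (rule Bochner_Integration.integrable_bound[OF w]) (auto simp: norm_mult)
  have "cmod (I k) \<le> (\<integral>x. cmod (w x) \<partial>leb L)" for k
    unfolding I_def by (rule Bochner_Integration.integral_norm_bound_integral) (auto simp: norm_mult int w)
  hence "(\<lambda>k. norm (a k $ i * I k)) summable_on UNIV"
    by (intro summable_on_comparison_test[OF summable_on_cmult_left[OF asum_nth[OF a, of i],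
        of "\<integral>x. cmod (w x) \<partial>leb L"]]) (auto simp: norm_mult mult_left_mono)
  hence sI: "(\<lambda>k. a k $ i * I k) summable_on UNIV" by (rule abs_summable_summable)
  have "(\<lambda>n. \<integral>x. (\<Sum>k\<in>sqbox n. fmode L k x *s a k) $ i * w x \<partial>leb L) \<longlonglongrightarrow> (\<integral>x. fser L a x $ i * w x \<partial>leb L)"
  proof (rule integral_dominated_convergence)
    show "integrable (leb L) (\<lambda>x. (\<Sum>\<^sub>\<infinity>k. norm (a k)) * cmod (w x))" using w by auto
    show "AE x in leb L. (\<lambda>n. (\<Sum>k\<in>sqbox n. fmode L k x *s a k) $ i * w x) \<longlonglongrightarrow> fser L a x $ i * w x"
      by (intro AE_I2 tendsto_mult tendsto_vec_nth fser_partial_tendsto a tendsto_const)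
    show "AE x in leb L. norm ((\<Sum>k\<in>sqbox n. fmode L k x *s a k) $ i * w x) \<le> (\<Sum>\<^sub>\<infinity>k. norm (a k)) * cmod (w x)" for n
    proof (rule AE_I2)
      fix x
      have "norm (\<Sum>k\<in>sqbox n. fmode L k x *s a k) \<le> (\<Sum>k\<in>sqbox n. norm (a k))"
        by (rule order_trans[OF norm_sum]) (simp add: norm_smult)
      also have "\<dots> \<le> (\<Sum>\<^sub>\<infinity>k. norm (a k))"
        using a finite_sqbox by (intro finite_sum_le_infsum) auto
      finally have "cmod ((\<Sum>k\<in>sqbox n. fmode L k x *s a k) $ i) \<le> (\<Sum>\<^sub>\<infinity>k. norm (a k))"
        using Finite_Cartesian_Product.norm_nth_le order_trans by blast
      thus "norm ((\<Sum>k\<in>sqbox n. fmode L k x *s a k) $ i * w x) \<le> (\<Sum>\<^sub>\<infinity>k. norm (a k)) * cmod (w x)"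
        unfolding norm_mult by (intro mult_right_mono) auto
    qed
  qed (use borel_measurable_fser[OF a, of L] in measurable)
  moreover have "(\<integral>x. (\<Sum>k\<in>sqbox n. fmode L k x *s a k) $ i * w x \<partial>leb L) = (\<Sum>k\<in>sqbox n. a k $ i * I k)" for n
  proof -
    have "(\<integral>x. (\<Sum>k\<in>sqbox n. fmode L k x *s a k) $ i * w x \<partial>leb L)
        = (\<integral>x. (\<Sum>k\<in>sqbox n. a k $ i * (fmode L k x * w x)) \<partial>leb L)"
      by (simp add: sum_distrib_right sum_distrib_left algebra_simps)
    also have "\<dots> = (\<Sum>k\<in>sqbox n. a k $ i * I k)"
      unfolding I_def by (subst Bochner_Integration.integral_sum) (auto intro!: int)
    finally show ?thesis .
  qed
  ultimately have "(\<lambda>n. \<Sum>k\<in>sqbox n. a k $ i * I k) \<longlonglongrightarrow> (\<integral>x. fser L a x $ i * w x \<partial>leb L)" by simp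
  moreover have "(\<lambda>n. \<Sum>k\<in>sqbox n. a k $ i * I k) \<longlonglongrightarrow> (\<Sum>\<^sub>\<infinity>k. a k $ i * I k)"
    by (rule has_sum_imp_sqbox_tendsto) (use sI in auto)
  ultimately have "(\<integral>x. fser L a x $ i * w x \<partial>leb L) = (\<Sum>\<^sub>\<infinity>k. a k $ i * I k)"
    using LIMSEQ_unique by blast
  thus ?thesis using sI unfolding I_def by simp
qed

text \<open>Termwise integration against a conjugate mode; orthogonality of the modes leaves a
  single term.\<close>

lemma fcoeff_fser:
  assumes L: "L > 0" and a: "asum a"
  shows "fcoeff L (fser L a) k = a k"
proof -
  have "fcoeff L (fser L a) k $ i = a k $ i" for i
  proof -
    have 1: "((\<lambda>l. a l $ i * (\<integral>x. fmode L l x * cnj (fmode L k x) \<partial>leb L)) has_sum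
        (\<integral>x. fser L a x $ i * cnj (fmode L k x) \<partial>leb L)) UNIV"
    proof (rule fser_integral[OF a])
      show "integrable (leb L) (\<lambda>x. cnj (fmode L k x))"
        by (rule Bochner_Integration.integrable_bound[where f = "\<lambda>x. 1::real"]) (auto simp: cnj_fmode)
    qed
    have 2: "(\<integral>x. fmode L l x * cnj (fmode L k x) \<partial>leb L) = (if l = k then of_real (L\<^sup>2) else 0)" for l
      using integral_fmode[OF L, of "l - k"] by (simp add: cnj_fmode fmode_add[symmetric])
    have 3: "((\<lambda>l. a l $ i * (if l = k then of_real (L\<^sup>2) else 0)) has_sum a k $ i * of_real (L\<^sup>2)) UNIV"
      by (rule has_sum_finite_neutralI[where B = "{k}"]) auto
    have "(\<integral>x. fser L a x $ i * cnj (fmode L k x) \<partial>leb L) = a k $ i * of_real (L\<^sup>2)"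
      using has_sum_unique[OF 1[unfolded 2] 3] .
    thus ?thesis using L
      by (subst fcoeff_nth) (auto intro!: l2_integrable fser_l2 a simp: mult.commute)
  qed
  thus ?thesis by (simp add: vec_eq_iff)
qed

text \<open>Parseval's identity with one factor absolutely summable and the other merely in L2. It
  supports both uniqueness of coefficients and the computation of the Leray projection.\<close>

lemma l2_inner_fser:
  assumes L: "L > 0" and a: "asum a" and u: "u \<in> l2_space L"
  shows "((\<lambda>k. of_real (L\<^sup>2) * (\<Sum>i\<in>UNIV. a k $ i * cnj (fcoeff L u k $ i))) has_sum l2_inner L (fser L a) u) UNIV"
proof -
  note iu = l2_integrable[OF u]
  have inth: "integrable (leb L) (\<lambda>x. u x $ i)" for i
    by (rule integrable_bounded_linear[OF bounded_linear_vec_nth iu])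
  hence icnj: "integrable (leb L) (\<lambda>x. cnj (u x $ i))" for i by simp
  have 1: "((\<lambda>k. \<Sum>i\<in>UNIV. a k $ i * (\<integral>x. fmode L k x * cnj (u x $ i) \<partial>leb L)) has_sum
      (\<Sum>i\<in>UNIV. \<integral>x. fser L a x $ i * cnj (u x $ i) \<partial>leb L)) UNIV"
    by (intro has_sum_sum fser_integral a icnj)
  have "(\<Sum>i\<in>UNIV. \<integral>x. fser L a x $ i * cnj (u x $ i) \<partial>leb L) = l2_inner L (fser L a) u"
    unfolding l2_inner_def
  proof (rule Bochner_Integration.integral_sum[symmetric])
    fix i
    show "integrable (leb L) (\<lambda>x. fser L a x $ i * cnj (u x $ i))"
    proof (rule Bochner_Integration.integrable_bound)
      show "integrable (leb L) (\<lambda>x. (\<Sum>\<^sub>\<infinity>k. norm (a k)) * cmod (u x $ i))" using inth by auto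
      show "(\<lambda>x. fser L a x $ i * cnj (u x $ i)) \<in> borel_measurable (leb L)"
        using borel_measurable_fser[OF a, of L] l2_measurable[OF u] by measurable
      have "cmod (fser L a x $ i) \<le> (\<Sum>\<^sub>\<infinity>k. norm (a k))" for x
        using norm_fser_le[OF a] Finite_Cartesian_Product.norm_nth_le order_trans by blast
      thus "AE x in leb L. norm (fser L a x $ i * cnj (u x $ i)) \<le> norm ((\<Sum>\<^sub>\<infinity>k. norm (a k)) * cmod (u x $ i))"
        by (intro AE_I2) (simp add: norm_mult abs_mult mult_right_mono infsum_nonneg)
    qed
  qed
  moreover have "(\<integral>x. fmode L k x * cnj (u x $ i) \<partial>leb L) = of_real (L\<^sup>2) * cnj (fcoeff L u k $ i)" for k i
  proof -
    have "(\<integral>x. fmode L k x * cnj (u x $ i) \<partial>leb L) = cnj (\<integral>x. cnj (fmode L k x) * u x $ i \<partial>leb L)"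
      by (subst Bochner_Integration.integral_cnj[symmetric]) simp
    thus ?thesis using L by (subst fcoeff_nth[OF iu]) simp
  qed
  ultimately show ?thesis using 1 by (simp add: sum_distrib_left algebra_simps)
qed

lemma trig_poly_fser:
  assumes "trig_poly L p"
  obtains a where "finite {k. a k \<noteq> 0}" "p = fser L a"
proof -
  obtain K c where K: "finite K" and p: "p = (\<lambda>x. \<Sum>k\<in>K. fmode L k x *s c k)"
    using assms by (auto simp: trig_poly_def)
  have "p = fser L (\<lambda>k. if k \<in> K then c k else 0)"
    unfolding p by (rule ext, subst fser_finite[OF K]) auto
  moreover have "finite {k. (if k \<in> K then c k else 0) \<noteq> 0}"
    by (rule finite_subset[OF _ K]) auto
  ultimately show ?thesis by (intro that)
qed

lemma fser_trig_poly:
  assumes "finite {k. a k \<noteq> 0}"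
  shows "trig_poly L (fser L a)"
  unfolding trig_poly_def using assms by (intro exI[of _ "{k. a k \<noteq> 0}"] exI[of _ a] conjI ext fser_finite) auto

text \<open>The Fourier multiplier of the partial derivative in direction \<open>j\<close>.\<close>

definition dcoef :: "real \<Rightarrow> int^2 \<Rightarrow> 2 \<Rightarrow> complex" where
  "dcoef L k j = \<i> * of_real (kappa0 L * of_int (k $ j))"

lemma pd_fser:
  assumes "L \<noteq> 0" and fin: "finite {k. a k \<noteq> 0}"
  shows "pd j (fser L a) = fser L (\<lambda>k. dcoef L k j *s a k)"
proof
  fix x
  define K where "K = {k. a k \<noteq> 0}"
  have K: "finite K" "\<And>k. k \<notin> K \<Longrightarrow> a k = 0" using fin by (auto simp: K_def)
  have d: "((\<lambda>s. fmode L k (x + s *\<^sub>R axis j 1) *s a k) has_vector_derivative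
      fmode L k x *s (dcoef L k j *s a k)) (at 0)" for k
  proof -
    have "((\<lambda>s. exp (\<i> * of_real (kappa0 L * of_int (k $ j)) * of_real s) * fmode L k x)
        has_vector_derivative dcoef L k j * fmode L k x) (at 0)"
      by (rule has_vector_derivative_eq_rhs, rule has_vector_derivative_real_field)
         (auto intro!: derivative_eq_intros simp: dcoef_def)
    from bounded_linear.has_vector_derivative[OF bounded_linear_smult_left this, of "a k"]
    show ?thesis unfolding fmode_shift[OF assms(1)] by (simp add: algebra_simps)
  qed
  have "((\<lambda>s. \<Sum>k\<in>K. fmode L k (x + s *\<^sub>R axis j 1) *s a k) has_vector_derivative
      (\<Sum>k\<in>K. fmode L k x *s (dcoef L k j *s a k))) (at 0)"
    by (intro has_vector_derivative_sum d)
  hence "pd j (fser L a) x = (\<Sum>k\<in>K. fmode L k x *s (dcoef L k j *s a k))"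
    unfolding pd_def using fser_finite[OF K] by (simp add: vector_derivative_at)
  also have "\<dots> = fser L (\<lambda>k. dcoef L k j *s a k) x"
    by (rule fser_finite[OF K(1), symmetric]) (simp add: K(2))
  finally show "pd j (fser L a) x = fser L (\<lambda>k. dcoef L k j *s a k) x" .
qed

lemma laplacian_fser:
  assumes "L \<noteq> 0" and fin: "finite {k. a k \<noteq> 0}"
  shows "laplacian (fser L a) = fser L (\<lambda>k. - of_real ((kappa0 L * kabs k)\<^sup>2) *s a k)"
proof
  fix x
  have fin': "finite {k. dcoef L k j *s a k \<noteq> 0}" for j
    by (rule finite_subset[OF _ fin]) auto
  have fin'': "finite {k. dcoef L k j *s (dcoef L k j *s a k) \<noteq> 0}" for j
    by (rule finite_subset[OF _ fin]) auto
  have "laplacian (fser L a) x = (\<Sum>j\<in>UNIV. fser L (\<lambda>k. dcoef L k j *s (dcoef L k j *s a k)) x)"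
    unfolding laplacian_def pd_fser[OF assms] pd_fser[OF assms(1) fin'] ..
  also have "\<dots> = fser L (\<lambda>k. dcoef L k 1 *s (dcoef L k 1 *s a k) + dcoef L k 2 *s (dcoef L k 2 *s a k)) x"
    by (subst fser_add) (use fin'' in \<open>auto intro!: asum_finite simp: UNIV_2\<close>)
  also have "(\<lambda>k. dcoef L k 1 *s (dcoef L k 1 *s a k) + dcoef L k 2 *s (dcoef L k 2 *s a k))
      = (\<lambda>k. - of_real ((kappa0 L * kabs k)\<^sup>2) *s a k)"
  proof
    fix k
    have "complex_of_real ((kappa0 L * kabs k)\<^sup>2) = of_real ((kappa0 L)\<^sup>2 * ((of_int (k $ 1))\<^sup>2 + (of_int (k $ 2))\<^sup>2))"
      by (simp add: kabs_def power_mult_distrib UNIV_2)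
    also have "- \<dots> = dcoef L k 1 * dcoef L k 1 + dcoef L k 2 * dcoef L k 2"
      by (simp add: dcoef_def power2_eq_square algebra_simps)
    finally show "dcoef L k 1 *s (dcoef L k 1 *s a k) + dcoef L k 2 *s (dcoef L k 2 *s a k) = - of_real ((kappa0 L * kabs k)\<^sup>2) *s a k"
      by (simp add: vec_eq_iff algebra_simps)
  qed
  finally show "laplacian (fser L a) x = fser L (\<lambda>k. - of_real ((kappa0 L * kabs k)\<^sup>2) *s a k) x" .
qed

section \<open>Solenoidal fields in Fourier coefficients\<close>

definition kdot :: "int^2 \<Rightarrow> complex^2 \<Rightarrow> complex" where
  "kdot k v = of_int (k $ 1) * v $ 1 + of_int (k $ 2) * v $ 2"

definition kcross :: "int^2 \<Rightarrow> complex^2 \<Rightarrow> complex" where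
  "kcross k v = of_int (k $ 1) * v $ 2 - of_int (k $ 2) * v $ 1"

text \<open>The vector \<open>k\<close> turned by a right angle. In two dimensions it spans the
  complex orthogonal complement of \<open>k\<close> when \<open>k\<close> is nonzero, so every
  divergence-free coefficient there is a multiple of it; \<open>kcross k\<close> is the inner
  product with it.\<close>

definition kperp :: "int^2 \<Rightarrow> complex^2" where
  "kperp k = vector [- of_int (k $ 2), of_int (k $ 1)]"

definition divfree :: "(int^2 \<Rightarrow> complex^2) \<Rightarrow> bool" where
  "divfree a \<longleftrightarrow> a 0 = 0 \<and> (\<forall>k. kdot k (a k) = 0)"

text \<open>The symmetry that conjugation-invariance of a field imposes on its coefficients: it
  marks the real fields, and so separates H from its complexification.\<close>

definition herm :: "(int^2 \<Rightarrow> complex^2) \<Rightarrow> bool" where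
  "herm a \<longleftrightarrow> (\<forall>k i. a (- k) $ i = cnj (a k $ i))"

text \<open>At \<open>k = 0\<close> the division by zero gives \<open>0\<close>, as it should: fields in \<open>H\<close> have mean zero.\<close>

definition leray_symbol :: "int^2 \<Rightarrow> complex^2 \<Rightarrow> complex^2" where
  "leray_symbol k v = (kcross k v / of_real ((kabs k)\<^sup>2)) *s kperp k"

lemma kdot_add: "kdot k (u + v) = kdot k u + kdot k v"
  and kdot_smult: "kdot k (c *s v) = c * kdot k v"
  and kdot_0: "kdot k 0 = 0"
  by (simp_all add: kdot_def algebra_simps)

lemma fser_nth_has_sum:
  "asum a \<Longrightarrow> ((\<lambda>k. fmode L k x * a k $ i) has_sum fser L a x $ i) UNIV"
  using has_sum_bounded_linear[OF bounded_linear_vec_nth[of i] fser_has_sum[of a L x]] by simp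

lemma fser_real:
  assumes "asum a" "herm a"
  shows "fser L a x $ i \<in> \<real>"
proof -
  have 1: "((\<lambda>k. fmode L k x * a k $ i) has_sum fser L a x $ i) UNIV"
    by (rule fser_nth_has_sum[OF assms(1)])
  hence "((\<lambda>k. cnj (fmode L k x * a k $ i)) has_sum cnj (fser L a x $ i)) UNIV"
    by (rule has_sum_bounded_linear[OF bounded_linear_cnj])
  hence "((\<lambda>k. fmode L (- k) x * a (- k) $ i) has_sum cnj (fser L a x $ i)) UNIV"
    using assms(2) by (simp add: cnj_fmode herm_def)
  hence "((\<lambda>k. fmode L k x * a k $ i) has_sum cnj (fser L a x $ i)) UNIV"
    by (subst (asm) has_sum_reindex_bij_betw[OF bij_uminus, of "\<lambda>k. fmode L k x * a k $ i"])
  hence "cnj (fser L a x $ i) = fser L a x $ i" using 1 has_sum_unique by blast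
  thus ?thesis by (simp add: Reals_cnj_iff)
qed

lemma fcoeff_0: "fcoeff L u 0 = (1 / L\<^sup>2) *\<^sub>R (\<integral>x. u x \<partial>leb L)"
  by (simp add: fcoeff_def)

lemma fcoeff_zero: "fcoeff L (\<lambda>x. 0) k = 0"
  by (simp add: fcoeff_def)

text \<open>The divergence is scalar while \<open>fser\<close> is vector-valued; multiplying by the
  all-ones vector makes every component \<open>i\<close> of the series equal to the divergence, so
  the facts about \<open>fser\<close> apply.\<close>

lemma divergence_fser:
  assumes L: "L > 0" and fin: "finite {k. a k \<noteq> 0}"
  shows "divergence (fser L a) x = fser L (\<lambda>k. (\<i> * of_real (kappa0 L) * kdot k (a k)) *s 1) x $ i"
proof -
  have fin': "asum (\<lambda>k. dcoef L k j *s a k)" for j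
    by (rule asum_finite, rule finite_subset[OF _ fin]) auto
  have "((\<lambda>k. fmode L k x * (dcoef L k 1 *s a k) $ 1 + fmode L k x * (dcoef L k 2 *s a k) $ 2) has_sum
     (fser L (\<lambda>k. dcoef L k 1 *s a k) x $ 1 + fser L (\<lambda>k. dcoef L k 2 *s a k) x $ 2)) UNIV"
    by (intro has_sum_add fser_nth_has_sum fin')
  moreover have "divergence (fser L a) x = fser L (\<lambda>k. dcoef L k 1 *s a k) x $ 1 + fser L (\<lambda>k. dcoef L k 2 *s a k) x $ 2"
    using L by (simp add: divergence_def pd_fser[OF _ fin] UNIV_2)
  moreover have "fmode L k x * (dcoef L k 1 *s a k) $ 1 + fmode L k x * (dcoef L k 2 *s a k) $ 2 =
      fmode L k x * ((\<i> * of_real (kappa0 L) * kdot k (a k)) *s 1) $ i" for k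
    by (simp add: dcoef_def kdot_def algebra_simps)
  ultimately have 1: "((\<lambda>k. fmode L k x * ((\<i> * of_real (kappa0 L) * kdot k (a k)) *s 1) $ i) has_sum divergence (fser L a) x) UNIV"
    by simp
  have "asum (\<lambda>k. (\<i> * of_real (kappa0 L) * kdot k (a k)) *s 1)"
    by (rule asum_finite, rule finite_subset[OF _ fin]) (auto simp: kdot_def)
  thus ?thesis using has_sum_unique[OF 1 fser_nth_has_sum] by blast
qed

lemma sol_trig_polys_fser:
  assumes L: "L > 0" and v: "v \<in> sol_trig_polys L"
  shows "trig_poly L v" "v \<in> l2_space L" "divfree (fcoeff L v)" "herm (fcoeff L v)"
proof -
  show tp: "trig_poly L v" using v by (simp add: sol_trig_polys_def)
  then obtain a where fin: "finite {k. a k \<noteq> 0}" and va: "v = fser L a" by (rule trig_poly_fser)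
  have a: "asum a" by (rule asum_finite[OF fin])
  show l2: "v \<in> l2_space L" unfolding va by (rule fser_l2[OF L a])
  have fv: "fcoeff L v = a" unfolding va by (rule ext) (rule fcoeff_fser[OF L a])
  define c :: "int^2 \<Rightarrow> complex^2" where "c k = (\<i> * of_real (kappa0 L) * kdot k (a k)) *s 1" for k
  have c: "asum c" unfolding c_def
    by (rule asum_finite, rule finite_subset[OF _ fin]) (auto simp: kdot_def)
  have "fser L c x $ i = 0" for x i
    using v divergence_fser[OF L fin, of x i] by (simp add: sol_trig_polys_def va c_def[abs_def])
  hence "fser L c = (\<lambda>x. 0)" by (auto simp: vec_eq_iff)
  hence c0: "c k = 0" for k using fcoeff_fser[OF L c, of k] by (simp add: fcoeff_zero)
  have "kdot k (a k) = 0" for k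
  proof -
    have "c k $ 1 = 0" using c0 by simp
    thus ?thesis using L by (simp add: c_def kappa0_def)
  qed
  moreover have "a 0 = 0" using v unfolding fv[symmetric] fcoeff_0 by (simp add: sol_trig_polys_def)
  ultimately show "divfree (fcoeff L v)" by (simp add: fv divfree_def)
  have "fcoeff L v (- k) $ i = cnj (fcoeff L v k $ i)" for k i
  proof -
    have "cnj (v x $ i) = v x $ i" for x using v by (simp add: sol_trig_polys_def Reals_cnj_iff)
    hence "(\<integral>x. cnj (fmode L (- k) x) * v x $ i \<partial>leb L) = (\<integral>x. cnj (cnj (fmode L k x) * v x $ i) \<partial>leb L)"
      by (simp add: cnj_fmode)
    also have "\<dots> = cnj (\<integral>x. cnj (fmode L k x) * v x $ i \<partial>leb L)"
      by (rule Bochner_Integration.integral_cnj)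
    finally show ?thesis by (simp add: fcoeff_nth[OF l2_integrable[OF l2]])
  qed
  thus "herm (fcoeff L v)" by (simp add: herm_def)
qed

lemma fser_sol_trig_polys:
  assumes L: "L > 0" and fin: "finite {k. a k \<noteq> 0}" and "divfree a" "herm a"
  shows "fser L a \<in> sol_trig_polys L"
proof -
  have a: "asum a" by (rule asum_finite[OF fin])
  have "(\<integral>x. fser L a x \<partial>leb L) = L\<^sup>2 *\<^sub>R fcoeff L (fser L a) 0" using L by (simp add: fcoeff_0)
  also have "\<dots> = 0" using \<open>divfree a\<close> by (simp add: fcoeff_fser[OF L a] divfree_def)
  finally have "(\<integral>x. fser L a x \<partial>leb L) = 0" .
  moreover have "divergence (fser L a) x = 0" for x
    using \<open>divfree a\<close> divergence_fser[OF L fin, of x 1] by (simp add: divfree_def fser_def)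
  ultimately show ?thesis using fser_real[OF a \<open>herm a\<close>] fser_trig_poly[OF fin]
    by (simp add: sol_trig_polys_def)
qed

definition trunc :: "nat \<Rightarrow> (int^2 \<Rightarrow> complex^2) \<Rightarrow> int^2 \<Rightarrow> complex^2" where
  "trunc n a k = (if k \<in> sqbox n then a k else 0)"

lemma finite_trunc: "finite {k. trunc n a k \<noteq> 0}"
  by (rule finite_subset[OF _ finite_sqbox[of n]]) (auto simp: trunc_def)

lemma trunc_divfree: "divfree a \<Longrightarrow> divfree (trunc n a)"
  by (auto simp: divfree_def trunc_def kdot_def)

lemma trunc_herm:
  assumes "herm a" shows "herm (trunc n a)"
proof -
  have "- k \<in> sqbox n \<longleftrightarrow> k \<in> sqbox n" for k using uminus_sqbox[of k n] uminus_sqbox[of "-k" n] by auto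
  thus ?thesis using assms by (simp add: herm_def trunc_def)
qed

lemma has_sum_diff_real:
  fixes f g :: "'a \<Rightarrow> real"
  assumes "(f has_sum s) A" "(g has_sum t) A"
  shows "((\<lambda>x. f x - g x) has_sum (s - t)) A"
  using has_sum_add[OF assms(1) has_sum_uminusI[OF assms(2)]] by simp

lemma trunc_tendsto:
  assumes L: "L > 0" and a: "asum a"
  shows "(\<lambda>n. l2_norm L (\<lambda>x. fser L (trunc n a) x - fser L a x)) \<longlonglongrightarrow> 0"
proof (rule Lim_null_comparison)
  define s where "s n = L * ((\<Sum>\<^sub>\<infinity>k. norm (a k)) - (\<Sum>k\<in>sqbox n. norm (a k)))" for n
  have "(\<lambda>n. \<Sum>k\<in>sqbox n. norm (a k)) \<longlonglongrightarrow> (\<Sum>\<^sub>\<infinity>k. norm (a k))"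
    by (rule has_sum_imp_sqbox_tendsto) (use a in simp)
  hence "s \<longlonglongrightarrow> L * ((\<Sum>\<^sub>\<infinity>k. norm (a k)) - (\<Sum>\<^sub>\<infinity>k. norm (a k)))"
    unfolding s_def by (intro tendsto_intros)
  thus "s \<longlonglongrightarrow> 0" by simp
  have "norm (l2_norm L (\<lambda>x. fser L (trunc n a) x - fser L a x)) \<le> s n" for n
  proof -
    have t: "asum (trunc n a)" by (rule asum_finite[OF finite_trunc])
    have "(\<lambda>x. fser L (trunc n a) x - fser L a x) = fser L (\<lambda>k. trunc n a k - a k)"
      by (rule ext) (rule fser_diff[OF t a, symmetric])
    hence "l2_norm L (\<lambda>x. fser L (trunc n a) x - fser L a x) \<le> L * (\<Sum>\<^sub>\<infinity>k. norm (trunc n a k - a k))"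
      using fser_l2(2)[OF L asum_diff[OF t a]] by simp
    \<comment> \<open>At each mode \<open>trunc\<close> either keeps the coefficient or replaces it
      by zero, so the norm of the difference is the difference of the norms and the error is a
      tail.\<close>
    also have "(\<Sum>\<^sub>\<infinity>k. norm (trunc n a k - a k)) = (\<Sum>\<^sub>\<infinity>k. norm (a k) - norm (trunc n a k))"
      by (rule infsum_cong) (simp add: trunc_def)
    also have "\<dots> = (\<Sum>\<^sub>\<infinity>k. norm (a k)) - (\<Sum>\<^sub>\<infinity>k. norm (trunc n a k))"
      by (rule infsumI, rule has_sum_diff_real) (use a t in auto)
    also have "(\<Sum>\<^sub>\<infinity>k. norm (trunc n a k)) = (\<Sum>\<^sub>\<infinity>k\<in>sqbox n. norm (a k))"
      by (rule infsum_cong_neutral) (auto simp: trunc_def)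
    also have "\<dots> = (\<Sum>k\<in>sqbox n. norm (a k))" by (simp add: finite_sqbox)
    finally show ?thesis by (simp add: s_def)
  qed
  thus "\<forall>\<^sub>F n in sequentially. norm (l2_norm L (\<lambda>x. fser L (trunc n a) x - fser L a x)) \<le> s n" by simp
qed

lemma fcoeff_tendsto:
  assumes L: "L > 0" and u: "u \<in> l2_space L" and v: "\<And>n. v n \<in> l2_space L"
    and lim: "(\<lambda>n. l2_norm L (\<lambda>x. v n x - u x)) \<longlonglongrightarrow> 0"
  shows "(\<lambda>n. fcoeff L (v n) k) \<longlonglongrightarrow> fcoeff L u k"
proof -
  have "(\<lambda>n. fcoeff L (v n) k - fcoeff L u k) \<longlonglongrightarrow> 0"
  proof (rule Lim_null_comparison)
    show "\<forall>\<^sub>F n in sequentially. norm (fcoeff L (v n) k - fcoeff L u k) \<le> l2_norm L (\<lambda>x. v n x - u x) / L"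
      using norm_fcoeff_le[OF L l2_diff[OF v u]] by (simp add: fcoeff_diff[OF v u])
    show "(\<lambda>n. l2_norm L (\<lambda>x. v n x - u x) / L) \<longlonglongrightarrow> 0"
      using tendsto_divide[OF lim tendsto_const[of L]] L by simp
  qed
  thus ?thesis by (rule LIM_zero_cancel)
qed

text \<open>The L2 closure of the trigonometric polynomials, without constraint on divergence or
  reality. Members of \<open>H_space\<close> lie in it by definition, and it is stable under complex
  combinations, which brings in \<open>HC_space\<close>.\<close>

definition trig_approx :: "real \<Rightarrow> vfield \<Rightarrow> bool" where
  "trig_approx L u \<longleftrightarrow> u \<in> l2_space L \<and> (\<forall>\<epsilon>>0. \<exists>p. trig_poly L p \<and> l2_norm L (\<lambda>x. u x - p x) < \<epsilon>)"

lemma trig_poly_l2: "L > 0 \<Longrightarrow> trig_poly L p \<Longrightarrow> p \<in> l2_space L"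
  by (elim trig_poly_fser) (auto intro!: fser_l2 asum_finite)

text \<open>All constraints are closed conditions on single coefficients, and each coefficient is
  continuous in L2, so they pass from the approximating polynomials to the limit.\<close>

lemma H_space_props:
  assumes L: "L > 0" and u: "u \<in> H_space L"
  shows "trig_approx L u" "divfree (fcoeff L u)" "herm (fcoeff L u)"
proof -
  have l2: "u \<in> l2_space L" using u by (simp add: H_space_def)
  have "\<exists>v\<in>sol_trig_polys L. l2_norm L (\<lambda>x. u x - v x) < \<epsilon>" if "\<epsilon> > 0" for \<epsilon>
    using u that by (simp add: H_space_def)
  thus "trig_approx L u" using l2 sol_trig_polys_fser(1)[OF L] unfolding trig_approx_def by blast
  have "\<forall>n. \<exists>v\<in>sol_trig_polys L. l2_norm L (\<lambda>x. u x - v x) < 1 / real (Suc n)"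
    using u by (simp add: H_space_def)
  then obtain v where v: "\<And>n. v n \<in> sol_trig_polys L"
    and vu: "\<And>n. l2_norm L (\<lambda>x. u x - v n x) < 1 / real (Suc n)" by metis
  have "(\<lambda>n. l2_norm L (\<lambda>x. v n x - u x)) \<longlonglongrightarrow> 0"
  proof (rule Lim_null_comparison)
    show "(\<lambda>n. 1 / real (Suc n)) \<longlonglongrightarrow> 0" by (rule LIMSEQ_Suc[OF lim_1_over_n])
    show "\<forall>\<^sub>F n in sequentially. norm (l2_norm L (\<lambda>x. v n x - u x)) \<le> 1 / real (Suc n)"
      using less_imp_le[OF vu] by (simp add: l2_norm_minus_commute[of L "v _"])
  qed
  hence lim: "(\<lambda>n. fcoeff L (v n) k) \<longlonglongrightarrow> fcoeff L u k" for k
    by (intro fcoeff_tendsto L l2 sol_trig_polys_fser(2) v)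
  have df: "divfree (fcoeff L (v n))" "herm (fcoeff L (v n))" for n
    using sol_trig_polys_fser[OF L v] by auto
  have "fcoeff L u 0 = 0" using lim[of 0] df(1) by (simp add: divfree_def LIMSEQ_const_iff)
  moreover have "kdot k (fcoeff L u k) = 0" for k
  proof -
    have "(\<lambda>n. kdot k (fcoeff L (v n) k)) \<longlonglongrightarrow> kdot k (fcoeff L u k)"
      unfolding kdot_def by (intro tendsto_intros lim)
    thus ?thesis using df(1) by (simp add: divfree_def LIMSEQ_const_iff)
  qed
  ultimately show "divfree (fcoeff L u)" by (simp add: divfree_def)
  have "fcoeff L u (- k) $ i = cnj (fcoeff L u k $ i)" for k i
  proof -
    have "(\<lambda>n. fcoeff L (v n) (- k) $ i) \<longlonglongrightarrow> fcoeff L u (- k) $ i" by (intro tendsto_intros lim)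
    moreover have "(\<lambda>n. cnj (fcoeff L (v n) k $ i)) \<longlonglongrightarrow> cnj (fcoeff L u k $ i)" by (intro tendsto_intros lim)
    moreover have "fcoeff L (v n) (- k) $ i = cnj (fcoeff L (v n) k $ i)" for n
      using df(2) by (simp add: herm_def)
    ultimately show ?thesis using LIMSEQ_unique by simp
  qed
  thus "herm (fcoeff L u)" by (simp add: herm_def)
qed

text \<open>The truncations to \<open>sqbox\<close> are solenoidal real polynomials and converge in
  L2.\<close>

lemma H_spaceI:
  assumes L: "L > 0" and a: "asum a" "divfree a" "herm a" and u: "eq_ae L u (fser L a)"
  shows "u \<in> H_space L"
proof -
  have l2: "u \<in> l2_space L" by (rule l2_eq_ae[OF fser_l2(1)[OF L a(1)] u])
  have "\<exists>v\<in>sol_trig_polys L. l2_norm L (\<lambda>x. u x - v x) < \<epsilon>" if \<epsilon>: "\<epsilon> > 0" for \<epsilon>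
  proof -
    obtain n where n: "l2_norm L (\<lambda>x. fser L (trunc n a) x - fser L a x) < \<epsilon>"
      using order_tendstoD(2)[OF trunc_tendsto[OF L a(1)] \<epsilon>] by (auto simp: eventually_sequentially)
    have t: "fser L (trunc n a) \<in> l2_space L" by (intro fser_l2(1)[OF L] asum_finite finite_trunc)
    have "l2_norm L (\<lambda>x. u x - fser L (trunc n a) x) = l2_norm L (\<lambda>x. fser L a x - fser L (trunc n a) x)"
      by (rule l2_norm_cong_ae[OF l2_diff[OF fser_l2(1)[OF L a(1)] t]])
         (use u in \<open>auto simp: eq_ae_def\<close>)
    also have "\<dots> = l2_norm L (\<lambda>x. fser L (trunc n a) x - fser L a x)" by (rule l2_norm_minus_commute)
    finally have "l2_norm L (\<lambda>x. u x - fser L (trunc n a) x) < \<epsilon>" using n by simp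
    thus ?thesis using fser_sol_trig_polys[OF L finite_trunc trunc_divfree[OF a(2)] trunc_herm[OF a(3)]] by blast
  qed
  thus ?thesis using l2 by (simp add: H_space_def)
qed

lemma trig_poly_add: "trig_poly L p \<Longrightarrow> trig_poly L q \<Longrightarrow> trig_poly L (\<lambda>x. p x + q x)"
proof (elim trig_poly_fser)
  fix a c assume *: "finite {k. a k \<noteq> 0}" "p = fser L a" "finite {k. c k \<noteq> 0}" "q = fser L c"
  have "(\<lambda>x. p x + q x) = fser L (\<lambda>k. a k + c k)"
    using * by (auto simp: fser_add asum_finite)
  moreover have "finite {k. a k + c k \<noteq> 0}"
    by (rule finite_subset[of _ "{k. a k \<noteq> 0} \<union> {k. c k \<noteq> 0}"]) (use * in auto)
  ultimately show ?thesis using fser_trig_poly by metis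
qed

lemma trig_poly_smult: "trig_poly L p \<Longrightarrow> trig_poly L (\<lambda>x. z *s p x)"
proof (elim trig_poly_fser)
  fix a assume *: "finite {k. a k \<noteq> 0}" "p = fser L a"
  have "(\<lambda>x. z *s p x) = fser L (\<lambda>k. z *s a k)"
    using * by (auto simp: fser_smult asum_finite)
  moreover have "finite {k. z *s a k \<noteq> 0}"
    by (rule finite_subset[of _ "{k. a k \<noteq> 0}"]) (use * in auto)
  ultimately show ?thesis using fser_trig_poly by metis
qed

lemma trig_approx_add:
  assumes "L > 0" "trig_approx L u" "trig_approx L v"
  shows "trig_approx L (\<lambda>x. u x + v x)"
  unfolding trig_approx_def
proof (intro conjI allI impI)
  show "(\<lambda>x. u x + v x) \<in> l2_space L" using assms by (auto simp: trig_approx_def intro: l2_add)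
  fix \<epsilon> :: real assume "\<epsilon> > 0"
  then obtain p q where p: "trig_poly L p" "l2_norm L (\<lambda>x. u x - p x) < \<epsilon> / 2"
    and q: "trig_poly L q" "l2_norm L (\<lambda>x. v x - q x) < \<epsilon> / 2"
    using assms unfolding trig_approx_def by (meson half_gt_zero)
  have "l2_norm L (\<lambda>x. (u x - p x) + (v x - q x)) \<le> l2_norm L (\<lambda>x. u x - p x) + l2_norm L (\<lambda>x. v x - q x)"
    using assms by (intro l2_norm_triangle l2_diff trig_poly_l2[OF assms(1) p(1)] trig_poly_l2[OF assms(1) q(1)])
      (auto simp: trig_approx_def)
  hence "l2_norm L (\<lambda>x. (u x + v x) - (p x + q x)) < \<epsilon>" using p q by (simp add: algebra_simps)
  thus "\<exists>p. trig_poly L p \<and> l2_norm L (\<lambda>x. u x + v x - p x) < \<epsilon>"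
    using trig_poly_add[OF p(1) q(1)] by blast
qed

lemma trig_approx_smult:
  assumes "trig_approx L u"
  shows "trig_approx L (\<lambda>x. z *s u x)"
  unfolding trig_approx_def
proof (intro conjI allI impI)
  show "(\<lambda>x. z *s u x) \<in> l2_space L" using assms by (auto simp: trig_approx_def intro: l2_smult)
  fix \<epsilon> :: real assume \<epsilon>: "\<epsilon> > 0"
  have pos: "0 < cmod z + 1" using norm_ge_zero[of z] by linarith
  obtain p where p: "trig_poly L p" "l2_norm L (\<lambda>x. u x - p x) < \<epsilon> / (cmod z + 1)"
    using assms \<epsilon> pos unfolding trig_approx_def by (meson divide_pos_pos)
  have "l2_norm L (\<lambda>x. z *s (u x - p x)) \<le> (cmod z + 1) * l2_norm L (\<lambda>x. u x - p x)"
    unfolding l2_norm_smult by (intro mult_right_mono) auto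
  also have "\<dots> < \<epsilon>" using p(2) pos by (simp add: field_simps)
  finally have "l2_norm L (\<lambda>x. z *s u x - z *s p x) < \<epsilon>"
    by (simp add: vector_ssub_ldistrib)
  thus "\<exists>p. trig_poly L p \<and> l2_norm L (\<lambda>x. z *s u x - p x) < \<epsilon>"
    using trig_poly_smult[OF p(1)] by blast
qed

lemma trig_approx_fser:
  assumes "L > 0" "asum a"
  shows "trig_approx L (fser L a)"
  unfolding trig_approx_def
proof (intro conjI allI impI)
  fix \<epsilon> :: real assume \<epsilon>: "\<epsilon> > 0"
  obtain n where n: "l2_norm L (\<lambda>x. fser L (trunc n a) x - fser L a x) < \<epsilon>"
    using order_tendstoD(2)[OF trunc_tendsto[OF assms] \<epsilon>] by (auto simp: eventually_sequentially)
  thus "\<exists>p. trig_poly L p \<and> l2_norm L (\<lambda>x. fser L a x - p x) < \<epsilon>"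
    using fser_trig_poly[OF finite_trunc, of L n a] by (subst (asm) l2_norm_minus_commute) blast
qed (rule fser_l2(1)[OF assms])

text \<open>A field with vanishing coefficients is orthogonal to every trigonometric polynomial p,
  so its squared norm equals the inner product of u - p with u, which is arbitrarily small compared
  with the norm of u.\<close>

lemma trig_approx_eq_0:
  assumes L: "L > 0" and u: "trig_approx L u" and 0: "\<And>k. fcoeff L u k = 0"
  shows "eq_ae L u (\<lambda>x. 0)"
proof -
  have l2: "u \<in> l2_space L" using u by (simp add: trig_approx_def)
  have *: "(l2_norm L u)\<^sup>2 \<le> l2_norm L u * \<epsilon>" if \<epsilon>: "\<epsilon> > 0" for \<epsilon>
  proof -
    obtain p where p: "trig_poly L p" and up: "l2_norm L (\<lambda>x. u x - p x) < \<epsilon>"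
      using u \<epsilon> by (auto simp: trig_approx_def)
    obtain a where fin: "finite {k. a k \<noteq> 0}" and pa: "p = fser L a" using p by (rule trig_poly_fser)
    note pl2 = trig_poly_l2[OF L p]
    have "l2_inner L p u = 0"
      using infsumI[OF l2_inner_fser[OF L asum_finite[OF fin] l2]] by (simp add: pa 0)
    hence "of_real ((l2_norm L u)\<^sup>2) = l2_inner L (\<lambda>x. u x - p x) u"
      by (simp add: l2_inner_diff_left[OF l2 pl2 l2] l2_inner_self)
    hence "cmod (of_real ((l2_norm L u)\<^sup>2)) \<le> l2_norm L (\<lambda>x. u x - p x) * l2_norm L u"
      using l2_inner_bound[OF l2_diff[OF l2 pl2] l2] by simp
    also have "\<dots> \<le> \<epsilon> * l2_norm L u" using up by (intro mult_right_mono) auto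
    finally show ?thesis by (simp add: norm_power mult.commute)
  qed
  have "l2_norm L u = 0"
  proof (rule ccontr)
    assume "l2_norm L u \<noteq> 0"
    hence "l2_norm L u > 0" using l2_norm_nonneg[of L u] by linarith
    thus False using *[of "l2_norm L u / 2"] by (simp add: power2_eq_square)
  qed
  thus ?thesis by (rule l2_norm_eq_0[OF l2])
qed

text \<open>The gateway from coefficients back to fields: a field known only through summable
  coefficients may be replaced by its series off a null set.\<close>

lemma trig_approx_eq_fser:
  assumes L: "L > 0" and u: "trig_approx L u" and a: "asum a" and eq: "\<And>k. fcoeff L u k = a k"
  shows "eq_ae L u (fser L a)"
proof -
  have "trig_approx L (\<lambda>x. u x + (- 1) *s fser L a x)"
    by (intro trig_approx_add trig_approx_smult trig_approx_fser L u a)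
  hence ta: "trig_approx L (\<lambda>x. u x - fser L a x)" by simp
  have "eq_ae L (\<lambda>x. u x - fser L a x) (\<lambda>x. 0)"
  proof (rule trig_approx_eq_0[OF L ta])
    have "u \<in> l2_space L" using u by (simp add: trig_approx_def)
    thus "fcoeff L (\<lambda>x. u x - fser L a x) k = 0" for k
      by (subst fcoeff_diff) (simp_all add: fser_l2 L a fcoeff_fser eq)
  qed
  thus ?thesis by (simp add: eq_ae_def)
qed

lemma HC_space_props:
  assumes L: "L > 0" and w: "w \<in> HC_space L"
  shows "trig_approx L w" "divfree (fcoeff L w)" "w \<in> l2_space L"
proof -
  obtain u v where u: "u \<in> H_space L" and v: "v \<in> H_space L" and w: "w = (\<lambda>x. u x + \<i> *s v x)"
    using w by (auto simp: HC_space_def)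
  note pu = H_space_props[OF L u] and pv = H_space_props[OF L v]
  show ta: "trig_approx L w" unfolding w by (intro trig_approx_add trig_approx_smult L pu pv)
  thus "w \<in> l2_space L" by (simp add: trig_approx_def)
  have "fcoeff L w k = fcoeff L u k + \<i> *s fcoeff L v k" for k
    unfolding w using pu(1) pv(1) by (subst fcoeff_add) (auto simp: trig_approx_def fcoeff_smult l2_smult)
  thus "divfree (fcoeff L w)" using pu(2) pv(2)
    by (simp add: divfree_def kdot_add kdot_smult)
qed

text \<open>The field is split into real and imaginary parts on the level of coefficients, and each
  part is placed in \<open>H_space\<close>.\<close>

lemma HC_spaceI:
  assumes L: "L > 0" and a: "asum a" "divfree a" and w: "eq_ae L w (fser L a)"
  shows "w \<in> HC_space L"
proof -
  \<comment> \<open>These are the coefficients of the conjugate field, so \<open>p\<close> and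
    \<open>q\<close> below belong to its real and imaginary parts.\<close>
  define c :: "int^2 \<Rightarrow> complex^2" where "c k = (\<chi> i. cnj (a (- k) $ i))" for k
  have nc: "norm (c k) = norm (a (- k))" for k by (simp add: c_def norm_vec_def)
  have c: "asum c"
    unfolding nc by (subst summable_on_reindex_bij_betw[OF bij_uminus, of "\<lambda>k. norm (a k)"]) (rule a)
  define p where "p k = (1 / 2) *s (a k + c k)" for k
  define q where "q k = (- \<i> / 2) *s (a k - c k)" for k
  have asp: "asum p" and asq: "asum q" unfolding p_def q_def by (intro asum_smult asum_add asum_diff a c)+
  have dc: "divfree c"
  proof -
    have "kdot k (c k) = - cnj (kdot (- k) (a (- k)))" for k
      by (simp add: kdot_def c_def)
    thus ?thesis using a(2) by (auto simp: divfree_def c_def vec_eq_iff)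
  qed
  have kd: "kdot k (a k) = 0" "kdot k (c k) = 0" for k using a(2) dc by (auto simp: divfree_def)
  have "kdot k (p k) = (1/2) * (kdot k (a k) + kdot k (c k))" "kdot k (q k) = (- \<i> / 2) * (kdot k (a k) - kdot k (c k))" for k
    by (simp_all add: p_def q_def kdot_def algebra_simps)
  hence "kdot k (p k) = 0" "kdot k (q k) = 0" for k by (simp_all add: kd)
  hence dp: "divfree p" and dq: "divfree q"
    using a(2) dc by (auto simp: divfree_def p_def q_def)
  have hp: "herm p" by (simp add: herm_def p_def c_def add.commute)
  have hq: "herm q" by (simp add: herm_def q_def c_def algebra_simps)
  have apq: "a k = p k + \<i> *s q k" for k
    by (simp add: p_def q_def vec_eq_iff algebra_simps)
  have fa: "fser L a x = fser L p x + \<i> *s fser L q x" for x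
    unfolding fser_smult[OF asq, symmetric] fser_add[OF asp asum_smult[OF asq], symmetric] apq[symmetric] ..
  \<comment> \<open>\<open>HC_space\<close> demands a pointwise decomposition, while
    \<open>w\<close> agrees with its series only almost everywhere; the discrepancy on the null set
    is absorbed in the first summand.\<close>
  have "(\<lambda>x. fser L p x + (w x - fser L a x)) \<in> H_space L"
    by (rule H_spaceI[OF L asp dp hp]) (use w in \<open>auto simp: eq_ae_def\<close>)
  moreover have "fser L q \<in> H_space L"
    by (rule H_spaceI[OF L asq dq hq]) (simp add: eq_ae_def)
  moreover have "w = (\<lambda>x. (fser L p x + (w x - fser L a x)) + \<i> *s fser L q x)"
    by (simp add: fa)
  ultimately show ?thesis unfolding HC_space_def by (intro CollectI bexI)
qed

lemma eq_ae_fser_fcoeff: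
  assumes "L > 0" "w \<in> HC_space L" "asum (fcoeff L w)"
  shows "eq_ae L w (fser L (fcoeff L w))"
  using trig_approx_eq_fser[OF assms(1) HC_space_props(1)[OF assms(1,2)] assms(3)] by simp

section \<open>The Leray projection, the Stokes operator and the bilinear form\<close>

lemma kabs_sq: "(kabs k)\<^sup>2 = (real_of_int (k $ 1))\<^sup>2 + (real_of_int (k $ 2))\<^sup>2"
  by (simp add: kabs_def UNIV_2)

lemma kabs_nonneg [simp]: "kabs k \<ge> 0"
  by (simp add: kabs_def sum_nonneg)

lemma kabs_sq_eq_0_iff: "(kabs k)\<^sup>2 = 0 \<longleftrightarrow> k = 0"
  unfolding kabs_sq by (simp add: sum_power2_eq_zero_iff vec_eq_iff forall_2)

lemma abs_nth_le_kabs: "\<bar>real_of_int (k $ j)\<bar> \<le> kabs k"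
proof -
  have "(real_of_int (k $ j))\<^sup>2 \<le> (kabs k)\<^sup>2"
    using exhaust_2[of j] by (auto simp: kabs_sq)
  thus ?thesis by (metis kabs_nonneg power2_le_iff_abs_le)
qed

lemma kcross_eq: "kcross k v = (\<Sum>i\<in>UNIV. v $ i * cnj (kperp k $ i))"
  by (simp add: kcross_def kperp_def UNIV_2)

lemma norm_kperp: "norm (kperp k) = kabs k"
  by (simp add: norm_vec_def L2_set_def kperp_def kabs_def UNIV_2)

lemma kdot_kperp: "kdot k (kperp k) = 0"
  by (simp add: kdot_def kperp_def)

lemma kcross_smult: "kcross k (c *s v) = c * kcross k v"
  and kcross_diff: "kcross k (u - v) = kcross k u - kcross k v"
  by (simp_all add: kcross_def algebra_simps)

lemma kcross_kperp: "kcross k (kperp k) = of_real ((kabs k)\<^sup>2)"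
  unfolding kabs_sq by (simp add: kcross_def kperp_def power2_eq_square)

lemma leray_symbol_0 [simp]: "leray_symbol 0 v = 0"
  by (simp add: leray_symbol_def kcross_def)

lemma kdot_leray_symbol: "kdot k (leray_symbol k v) = 0"
  by (simp add: leray_symbol_def kdot_smult kdot_kperp)

lemma kcross_leray_symbol: "kcross k (leray_symbol k v) = kcross k v"
proof (cases "k = 0")
  case False
  hence "(kabs k)\<^sup>2 \<noteq> 0" by (simp only: kabs_sq_eq_0_iff not_False_eq_True)
  thus ?thesis by (simp add: leray_symbol_def kcross_smult kcross_kperp)
qed (simp add: kcross_def)

lemma norm_leray_symbol_le: "norm (leray_symbol k v) \<le> norm v"
proof (cases "k = 0")
  case False
  hence "(kabs k)\<^sup>2 \<noteq> 0" by (simp only: kabs_sq_eq_0_iff not_False_eq_True)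
  hence k: "kabs k > 0" using kabs_nonneg[of k] by (simp add: order_less_le)
  have "cmod (kcross k v) \<le> norm v * kabs k"
    unfolding kcross_eq norm_kperp[symmetric] by (rule norm_sum_mult_cnj_le)
  hence "cmod (kcross k v) / (kabs k)\<^sup>2 * kabs k \<le> norm v"
    using k by (simp add: field_simps power2_eq_square)
  thus ?thesis by (simp add: leray_symbol_def norm_smult norm_divide norm_power norm_kperp)
qed simp

text \<open>Multiplying \<open>kcross k v\<close> by \<open>kperp k\<close> gives \<open>v\<close>
  times the square of \<open>kabs k\<close>, minus \<open>k\<close> times \<open>kdot k v\<close>;
  the second term vanishes.\<close>

lemma leray_symbol_divfree:
  assumes "kdot k v = 0" "k \<noteq> 0"
  shows "leray_symbol k v = v"
proof -
  have nz: "complex_of_real ((kabs k)\<^sup>2) \<noteq> 0" using assms(2) by (simp only: of_real_eq_0_iff kabs_sq_eq_0_iff not_False_eq_True)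
  have e: "complex_of_real ((kabs k)\<^sup>2) = of_int (k $ 1) * of_int (k $ 1) + of_int (k $ 2) * of_int (k $ 2)"
    unfolding kabs_sq by (simp add: power2_eq_square)
  have d: "of_int (k $ 1) * v $ 1 + of_int (k $ 2) * v $ 2 = 0" using assms(1) by (simp add: kdot_def)
  have "kcross k v * kperp k $ 1 = complex_of_real ((kabs k)\<^sup>2) * v $ 1"
    unfolding e kcross_def kperp_def using d by simp algebra
  moreover have "kcross k v * kperp k $ 2 = complex_of_real ((kabs k)\<^sup>2) * v $ 2"
    unfolding e kcross_def kperp_def using d by simp algebra
  ultimately show ?thesis using nz
    by (simp add: leray_symbol_def vec_eq_iff forall_2 field_simps del: of_real_power)
qed

text \<open>For nonzero \<open>k\<close> a vector is determined by its parts along \<open>k\<close>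
  and along \<open>kperp k\<close>; the first is zero and the second is shared with
  \<open>f\<close>.\<close>

lemma leray_symbol_eqI:
  assumes "kdot k h = 0" "k = 0 \<Longrightarrow> h = 0" "k \<noteq> 0 \<Longrightarrow> kcross k h = kcross k f"
  shows "h = leray_symbol k f"
proof (cases "k = 0")
  case False
  hence "leray_symbol k f = leray_symbol k h" using assms(3) by (simp add: leray_symbol_def)
  thus ?thesis using leray_symbol_divfree[OF assms(1) False] by simp
qed (use assms in simp)

lemma divfree_leray_symbol: "divfree (\<lambda>k. leray_symbol k (a k))"
  by (simp add: divfree_def kdot_leray_symbol)

lemma asum_leray_symbol: "asum a \<Longrightarrow> asum (\<lambda>k. leray_symbol k (a k))"
  by (rule asum_comparison[where C = 1]) (auto simp: norm_leray_symbol_le)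

text \<open>Orthogonality to the complexified H is tested on the solenoidal field carried by the
  single mode \<open>k\<close>, which isolates the component of the coefficient along
  \<open>kperp k\<close>.\<close>

lemma leray_fcoeff:
  assumes L: "L > 0" and le: "leray L f h"
  shows "fcoeff L h k = leray_symbol k (fcoeff L f k)"
proof (rule leray_symbol_eqI)
  have f: "f \<in> l2_space L" and h: "h \<in> HC_space L"
    and orth: "\<And>w. w \<in> HC_space L \<Longrightarrow> l2_inner L (\<lambda>x. f x - h x) w = 0"
    using le by (auto simp: leray_def)
  note hp = HC_space_props[OF L h]
  show "kdot k (fcoeff L h k) = 0" "k = 0 \<Longrightarrow> fcoeff L h k = 0" using hp(2) by (auto simp: divfree_def)
  assume k: "k \<noteq> 0"
  define a where "a l = (if l = k then kperp k else 0)" for l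
  have fin: "finite {l. a l \<noteq> 0}" by (rule finite_subset[of _ "{k}"]) (auto simp: a_def)
  note aa = asum_finite[OF fin]
  have "divfree a" using k by (auto simp: divfree_def a_def kdot_kperp kdot_0)
  hence "fser L a \<in> HC_space L" by (intro HC_spaceI[OF L aa]) (auto simp: eq_ae_def)
  hence "l2_inner L (\<lambda>x. f x - h x) (fser L a) = 0" by (rule orth)
  hence 0: "l2_inner L (fser L a) (\<lambda>x. f x - h x) = 0" by (subst l2_inner_commute) simp
  define F where "F = fcoeff L (\<lambda>x. f x - h x)"
  have "((\<lambda>l. of_real (L\<^sup>2) * (\<Sum>i\<in>UNIV. a l $ i * cnj (F l $ i))) has_sum 0) UNIV"
    using l2_inner_fser[OF L aa l2_diff[OF f hp(3)]] unfolding 0 F_def .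
  moreover have "((\<lambda>l. of_real (L\<^sup>2) * (\<Sum>i\<in>UNIV. a l $ i * cnj (F l $ i))) has_sum
      of_real (L\<^sup>2) * (\<Sum>i\<in>UNIV. a k $ i * cnj (F k $ i))) UNIV"
    by (rule has_sum_finite_neutralI[where B = "{k}"]) (auto simp: a_def)
  ultimately have "of_real (L\<^sup>2) * (\<Sum>i\<in>UNIV. a k $ i * cnj (F k $ i)) = 0" using has_sum_unique by blast
  hence "(\<Sum>i\<in>UNIV. kperp k $ i * cnj (F k $ i)) = 0" using L by (simp add: a_def)
  hence "cnj (\<Sum>i\<in>UNIV. kperp k $ i * cnj (F k $ i)) = 0" by simp
  hence "kcross k (F k) = 0" by (simp add: kcross_eq mult.commute)
  thus "kcross k (fcoeff L h k) = kcross k (fcoeff L f k)"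
    by (simp add: F_def fcoeff_diff[OF f hp(3)] kcross_diff)
qed

lemma l2_inner_cong_ae:
  assumes "u \<in> l2_space L" "eq_ae L v u" "w \<in> l2_space L"
  shows "l2_inner L v w = l2_inner L u w"
  unfolding l2_inner_def
  by (rule integral_cong_AE)
     (use assms l2_eq_ae[OF assms(1,2)] in \<open>auto simp: eq_ae_def intro!: borel_measurable_integrable l2_inner_integrable\<close>)

text \<open>Mode by mode, the residual \<open>a k - p k\<close> has no component along
  \<open>kperp k\<close>, whereas the coefficients of solenoidal test fields are multiples of
  \<open>kperp k\<close>; every term of the Parseval sum vanishes.\<close>

lemma leray_fser:
  assumes L: "L > 0" and a: "asum a" and f: "eq_ae L f (fser L a)"
  shows "leray L f (fser L (\<lambda>k. leray_symbol k (a k)))"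
proof -
  define p where "p k = leray_symbol k (a k)" for k
  have p: "asum p" unfolding p_def by (rule asum_leray_symbol[OF a])
  have fl2: "f \<in> l2_space L" by (rule l2_eq_ae[OF fser_l2(1)[OF L a] f])
  have h: "fser L p \<in> HC_space L"
    by (rule HC_spaceI[OF L p]) (auto simp: p_def[abs_def] divfree_leray_symbol eq_ae_def)
  have ap: "asum (\<lambda>k. a k - p k)" by (rule asum_diff[OF a p])
  have "l2_inner L (\<lambda>x. f x - fser L p x) w = 0" if w: "w \<in> HC_space L" for w
  proof -
    note wp = HC_space_props[OF L w]
    have "l2_inner L (\<lambda>x. f x - fser L p x) w = l2_inner L (fser L (\<lambda>k. a k - p k)) w"
      by (rule l2_inner_cong_ae[OF fser_l2(1)[OF L ap] _ wp(3)])
         (use f in \<open>auto simp: eq_ae_def fser_diff[OF a p]\<close>)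
    also have "\<dots> = (\<Sum>\<^sub>\<infinity>k. of_real (L\<^sup>2) * (\<Sum>i\<in>UNIV. (a k - p k) $ i * cnj (fcoeff L w k $ i)))"
      by (rule infsumI[OF l2_inner_fser[OF L ap wp(3)], symmetric])
    also have "\<dots> = 0"
    proof (rule infsum_0)
      fix k
      have "(\<Sum>i\<in>UNIV. (a k - p k) $ i * cnj (fcoeff L w k $ i)) = 0"
      proof (cases "k = 0")
        case True
        thus ?thesis using wp(2) by (simp add: divfree_def)
      next
        case False
        define z where "z = kcross k (fcoeff L w k) / of_real ((kabs k)\<^sup>2)"
        have "fcoeff L w k = z *s kperp k"
          using leray_symbol_divfree[of k "fcoeff L w k"] wp(2) False by (simp add: divfree_def leray_symbol_def z_def)
        hence "(\<Sum>i\<in>UNIV. (a k - p k) $ i * cnj (fcoeff L w k $ i)) = cnj z * kcross k (a k - p k)"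
          by (simp add: kcross_eq sum_distrib_left algebra_simps)
        also have "\<dots> = 0" by (simp add: kcross_diff p_def kcross_leray_symbol)
        finally show ?thesis .
      qed
      thus "complex_of_real (L\<^sup>2) * (\<Sum>i\<in>UNIV. (a k - p k) $ i * cnj (fcoeff L w k $ i)) = 0" by simp
    qed
    finally show ?thesis .
  qed
  thus ?thesis using fl2 h unfolding p_def by (auto simp: leray_def)
qed

text \<open>An operator acting on polynomials as the multiplier \<open>m\<close> acts so on its
  whole closed domain: coefficients on both sides converge along the approximating polynomials. No
  summability of coefficients enters, so this applies to arbitrary elements of the domain.\<close>

lemma per_closure_fcoeff:
  assumes L: "L > 0"
    and D: "\<And>a. finite {k. a k \<noteq> 0} \<Longrightarrow> D (fser L a) = fser L (\<lambda>k. m k *s a k)"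
    and pc: "per_closure L D u w"
  shows "fcoeff L w k = m k *s fcoeff L u k"
proof -
  obtain p where u: "u \<in> l2_space L" and w: "w \<in> l2_space L" and tp: "\<And>n. trig_poly L (p n)"
    and l1: "(\<lambda>n. l2_norm L (\<lambda>x. p n x - u x)) \<longlonglongrightarrow> 0"
    and l2: "(\<lambda>n. l2_norm L (\<lambda>x. D (p n) x - w x)) \<longlonglongrightarrow> 0"
    using pc by (auto simp: per_closure_def)
  have *: "D (p n) \<in> l2_space L \<and> fcoeff L (D (p n)) k = m k *s fcoeff L (p n) k" for n
  proof -
    obtain a where fin: "finite {k. a k \<noteq> 0}" and pa: "p n = fser L a" using tp by (rule trig_poly_fser)
    have fin': "finite {k. m k *s a k \<noteq> 0}" by (rule finite_subset[OF _ fin]) auto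
    show ?thesis unfolding pa D[OF fin]
      by (simp add: fcoeff_fser[OF L asum_finite[OF fin]] fcoeff_fser[OF L asum_finite[OF fin']]
          fser_l2[OF L asum_finite[OF fin']])
  qed
  have "(\<lambda>n. fcoeff L (D (p n)) k) \<longlonglongrightarrow> fcoeff L w k"
    using * by (intro fcoeff_tendsto L w l2) auto
  moreover have "(\<lambda>n. m k *s fcoeff L (p n) k) \<longlonglongrightarrow> m k *s fcoeff L u k"
    by (intro bounded_linear.tendsto[OF bounded_linear_smult] fcoeff_tendsto L u l1 trig_poly_l2 tp)
  ultimately show ?thesis using * LIMSEQ_unique by auto
qed

text \<open>Truncation commutes with the multiplier, so the truncated series approximate both
  \<open>u\<close> and the image.\<close>

lemma per_closure_fser:
  assumes L: "L > 0"
    and D: "\<And>a. finite {k. a k \<noteq> 0} \<Longrightarrow> D (fser L a) = fser L (\<lambda>k. m k *s a k)"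
    and a: "asum a" and ma: "asum (\<lambda>k. m k *s a k)" and u: "eq_ae L u (fser L a)"
  shows "per_closure L D u (fser L (\<lambda>k. m k *s a k))"
proof -
  have ul2: "u \<in> l2_space L" by (rule l2_eq_ae[OF fser_l2(1)[OF L a] u])
  have "l2_norm L (\<lambda>x. fser L (trunc n a) x - u x) = l2_norm L (\<lambda>x. fser L (trunc n a) x - fser L a x)" for n
    by (rule l2_norm_cong_ae)
       (use u in \<open>auto simp: eq_ae_def intro!: l2_diff fser_l2 L a asum_finite finite_trunc\<close>)
  hence 1: "(\<lambda>n. l2_norm L (\<lambda>x. fser L (trunc n a) x - u x)) \<longlonglongrightarrow> 0"
    using trunc_tendsto[OF L a] by simp
  have "D (fser L (trunc n a)) = fser L (trunc n (\<lambda>k. m k *s a k))" for n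
    unfolding D[OF finite_trunc] by (rule arg_cong[where f = "fser L"]) (auto simp: trunc_def)
  hence 2: "(\<lambda>n. l2_norm L (\<lambda>x. D (fser L (trunc n a)) x - fser L (\<lambda>k. m k *s a k) x)) \<longlonglongrightarrow> 0"
    using trunc_tendsto[OF L ma] by simp
  show ?thesis unfolding per_closure_def
    using ul2 fser_l2(1)[OF L ma] 1 2 fser_trig_poly[OF finite_trunc]
    by (intro conjI exI[of _ "\<lambda>n. fser L (trunc n a)"]) auto
qed

definition lam :: "real \<Rightarrow> int^2 \<Rightarrow> real" where
  "lam L k = (kappa0 L * kabs k)\<^sup>2"

text \<open>A scalar multiplier preserves the divergence condition, so the Leray symbol leaves the
  coefficients of the Laplacian unchanged.\<close>

lemma stokes_fcoeff:
  assumes L: "L > 0" and s: "stokes L u w"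
  shows "fcoeff L w k = of_real (lam L k) *s fcoeff L u k"
proof -
  obtain f where u: "u \<in> HC_space L" and f: "per_closure L laplacian u f" and le: "leray L (\<lambda>x. - f x) w"
    using s by (auto simp: stokes_def)
  have "fcoeff L f k = - of_real (lam L k) *s fcoeff L u k"
    unfolding lam_def by (rule per_closure_fcoeff[OF L laplacian_fser f]) (use L in auto)
  moreover have "fcoeff L w k = leray_symbol k (fcoeff L (\<lambda>x. - f x) k)" by (rule leray_fcoeff[OF L le])
  ultimately have w: "fcoeff L w k = leray_symbol k (of_real (lam L k) *s fcoeff L u k)"
    by (simp add: fcoeff_uminus)
  have d: "divfree (fcoeff L u)" by (rule HC_space_props[OF L u])
  show ?thesis
  proof (cases "k = 0")
    case True
    thus ?thesis using d w by (simp add: divfree_def)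
  next
    case False
    thus ?thesis unfolding w using d by (intro leray_symbol_divfree) (auto simp: divfree_def kdot_smult)
  qed
qed

lemma stokes_fser:
  assumes L: "L > 0" and a: "asum a" "divfree a" and la: "asum (\<lambda>k. of_real (lam L k) *s a k)"
    and u: "eq_ae L u (fser L a)"
  shows "stokes L u (fser L (\<lambda>k. of_real (lam L k) *s a k))"
proof -
  have eq: "- of_real (lam L k) *s a k = - (of_real (lam L k) *s a k)" for k by simp
  have la': "asum (\<lambda>k. - of_real (lam L k) *s a k)" unfolding eq by (rule asum_uminus[OF la])
  have "per_closure L laplacian u (fser L (\<lambda>k. - of_real (lam L k) *s a k))"
    by (rule per_closure_fser[OF L laplacian_fser[folded lam_def] a(1) la' u]) (use L in auto)
  moreover have "leray L (\<lambda>x. - fser L (\<lambda>k. - of_real (lam L k) *s a k) x)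
      (fser L (\<lambda>k. leray_symbol k (of_real (lam L k) *s a k)))"
    by (rule leray_fser[OF L la]) (simp add: eq_ae_def eq fser_uminus[OF la])
  moreover have "leray_symbol k (of_real (lam L k) *s a k) = of_real (lam L k) *s a k" for k
  proof (cases "k = 0")
    case True
    thus ?thesis using a(2) by (simp add: divfree_def)
  next
    case False
    thus ?thesis using a(2) by (intro leray_symbol_divfree) (auto simp: divfree_def kdot_smult)
  qed
  ultimately show ?thesis using HC_spaceI[OF L a u] by (auto simp: stokes_def)
qed

section \<open>Convolutions and the bilinear form\<close>

lemma convolution_has_sum:
  fixes f g :: "'a::ab_group_add \<Rightarrow> complex"
  assumes f: "(\<lambda>k. norm (f k)) summable_on UNIV" and g: "(\<lambda>k. norm (g k)) summable_on UNIV"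
  shows "(\<lambda>l. norm (f (k - l) * g l)) summable_on UNIV"
    and "(\<lambda>k. norm (\<Sum>\<^sub>\<infinity>l. f (k - l) * g l)) summable_on UNIV"
    and "((\<lambda>k. \<Sum>\<^sub>\<infinity>l. f (k - l) * g l) has_sum (\<Sum>\<^sub>\<infinity>k. f k) * (\<Sum>\<^sub>\<infinity>k. g k)) UNIV"
proof -
  have 1: "(\<lambda>p. norm (case p of (k, l) \<Rightarrow> f k * g l)) summable_on (UNIV \<times> UNIV)"
  proof (rule Infinite_Sum.abs_summable_on_Sigma_iff[THEN iffD2], intro conjI ballI)
    show "(\<lambda>l. norm (case (k, l) of (k, l) \<Rightarrow> f k * g l)) summable_on UNIV" for k
      using g by (auto simp: norm_mult intro!: summable_on_cmult_right)
    show "(\<lambda>k. norm (\<Sum>\<^sub>\<infinity>l. norm (case (k, l) of (k, l) \<Rightarrow> f k * g l))) summable_on UNIV"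
      using f by (auto simp: norm_mult infsum_cmult_right' abs_mult intro!: summable_on_cmult_left)
  qed
  \<comment> \<open>The shear of the index lattice turns the convolution sum into the sum of a plain
    product, so absolute summability and Fubini transfer from one to the other.\<close>
  have bij: "bij_betw (\<lambda>(k, l). (k - l, l)) (UNIV \<times> UNIV) (UNIV \<times> (UNIV :: 'a set))"
    by (rule bij_betwI[where g = "\<lambda>(k, l). (k + l, l)"]) auto
  have 2: "(\<lambda>p. norm (case p of (k, l) \<Rightarrow> f (k - l) * g l)) summable_on (UNIV \<times> UNIV)"
    using summable_on_reindex_bij_betw[OF bij, of "\<lambda>p. norm (case p of (k, l) \<Rightarrow> f k * g l)"] 1
    by (simp add: case_prod_unfold)
  note 3 = Infinite_Sum.abs_summable_on_Sigma_iff[THEN iffD1, OF 2]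
  show 4: "(\<lambda>l. norm (f (k - l) * g l)) summable_on UNIV" for k using 3 by simp
  have 5: "(\<lambda>k. \<Sum>\<^sub>\<infinity>l. norm (f (k - l) * g l)) summable_on UNIV" using 3 by (simp add: infsum_nonneg)
  show 6: "(\<lambda>k. norm (\<Sum>\<^sub>\<infinity>l. f (k - l) * g l)) summable_on UNIV"
    by (rule summable_on_comparison_test[OF 5]) (auto intro!: norm_infsum_bound 4)
  have "(\<Sum>\<^sub>\<infinity>k. \<Sum>\<^sub>\<infinity>l. f (k - l) * g l) = (\<Sum>\<^sub>\<infinity>(k, l)\<in>UNIV \<times> UNIV. f (k - l) * g l)"
    by (rule infsum_Sigma'_banach) (rule abs_summable_summable[OF 2])
  also have "\<dots> = (\<Sum>\<^sub>\<infinity>(k, l)\<in>UNIV \<times> UNIV. f k * g l)"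
    using infsum_reindex_bij_betw[OF bij, of "\<lambda>(k, l). f k * g l"] by (simp add: case_prod_unfold)
  also have "\<dots> = (\<Sum>\<^sub>\<infinity>k. \<Sum>\<^sub>\<infinity>l. f k * g l)"
    by (rule infsum_Sigma'_banach[symmetric]) (rule abs_summable_summable[OF 1])
  also have "\<dots> = (\<Sum>\<^sub>\<infinity>k. f k) * (\<Sum>\<^sub>\<infinity>k. g k)"
    by (simp add: infsum_cmult_right' infsum_cmult_left')
  finally show "((\<lambda>k. \<Sum>\<^sub>\<infinity>l. f (k - l) * g l) has_sum (\<Sum>\<^sub>\<infinity>k. f k) * (\<Sum>\<^sub>\<infinity>k. g k)) UNIV"
    using has_sum_infsum[OF abs_summable_summable[OF 6]] by simp
qed

text \<open>Coefficients of the unprojected term, the transport of the field with coefficients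
  \<open>c\<close> by the field with coefficients \<open>a\<close>: a convolution with the
  derivative on the second factor.\<close>

definition advection :: "real \<Rightarrow> (int^2 \<Rightarrow> complex^2) \<Rightarrow> (int^2 \<Rightarrow> complex^2) \<Rightarrow> int^2 \<Rightarrow> complex^2" where
  "advection L a c k = (\<chi> m. \<Sum>\<^sub>\<infinity>l. (\<Sum>j\<in>UNIV. a (k - l) $ j * dcoef L l j) * c l $ m)"

definition bhat :: "real \<Rightarrow> (int^2 \<Rightarrow> complex^2) \<Rightarrow> (int^2 \<Rightarrow> complex^2) \<Rightarrow> int^2 \<Rightarrow> complex^2" where
  "bhat L a c k = leray_symbol k (advection L a c k)"

lemma summable_on_sum:
  fixes f :: "'i \<Rightarrow> 'a \<Rightarrow> 'b::topological_comm_monoid_add"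
  assumes "\<And>i. i \<in> I \<Longrightarrow> f i summable_on A"
  shows "(\<lambda>x. \<Sum>i\<in>I. f i x) summable_on A"
  using assms by (induction I rule: infinite_finite_induct) (auto intro!: summable_on_add)

context
  fixes L :: real and a c :: "int^2 \<Rightarrow> complex^2"
  assumes a: "asum a" and dc: "\<And>j. asum (\<lambda>l. dcoef L l j *s c l)"
begin

lemma advection_term_summable: "(\<lambda>l. norm (a (k - l) $ j * (dcoef L l j * c l $ m))) summable_on UNIV"
  using convolution_has_sum(1)[OF asum_nth[OF a] asum_nth[OF dc]] by simp

lemma advection_nth: "advection L a c k $ m = (\<Sum>j\<in>UNIV. \<Sum>\<^sub>\<infinity>l. a (k - l) $ j * (dcoef L l j * c l $ m))"
proof -
  have "((\<lambda>l. \<Sum>j\<in>UNIV. a (k - l) $ j * (dcoef L l j * c l $ m)) has_sum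
      (\<Sum>j\<in>UNIV. \<Sum>\<^sub>\<infinity>l. a (k - l) $ j * (dcoef L l j * c l $ m))) UNIV"
    by (rule has_sum_sum, rule has_sum_infsum, rule abs_summable_summable, rule advection_term_summable)
  from infsumI[OF this] show ?thesis by (simp add: advection_def sum_distrib_right mult.assoc)
qed

lemma asum_advection: "asum (advection L a c)"
proof -
  have "(\<lambda>k. norm (advection L a c k $ m)) summable_on UNIV" for m
  proof (rule summable_on_comparison_test)
    show "(\<lambda>k. (\<Sum>j\<in>UNIV. norm (\<Sum>\<^sub>\<infinity>l. a (k - l) $ j * (dcoef L l j * c l $ m)))) summable_on UNIV"
      using convolution_has_sum(2)[OF asum_nth[OF a] asum_nth[OF dc]] by (intro summable_on_sum) auto
    show "norm (advection L a c k $ m) \<le> (\<Sum>j\<in>UNIV. norm (\<Sum>\<^sub>\<infinity>l. a (k - l) $ j * (dcoef L l j * c l $ m)))" for k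
      unfolding advection_nth by (rule norm_sum)
  qed auto
  hence "(\<lambda>k. \<Sum>m\<in>UNIV. norm (advection L a c k $ m)) summable_on UNIV" by (intro summable_on_sum) auto
  thus ?thesis by (rule summable_on_comparison_test) (auto simp: norm_vec_le_sum)
qed

lemma fser_advection:
  "(\<Sum>j\<in>UNIV. fser L a x $ j *s fser L (\<lambda>l. dcoef L l j *s c l) x) = fser L (advection L a c) x"
proof -
  have "(\<Sum>j\<in>UNIV. fser L a x $ j * fser L (\<lambda>l. dcoef L l j *s c l) x $ m) = fser L (advection L a c) x $ m" for m
  proof -
    have j: "((\<lambda>k. fmode L k x * (\<Sum>\<^sub>\<infinity>l. a (k - l) $ j * (dcoef L l j * c l $ m))) has_sum
        fser L a x $ j * fser L (\<lambda>l. dcoef L l j *s c l) x $ m) UNIV" for j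
    proof -
      define F where "F k = fmode L k x * a k $ j" for k
      define G where "G l = fmode L l x * (dcoef L l j *s c l) $ m" for l
      have F: "(\<lambda>k. norm (F k)) summable_on UNIV" and G: "(\<lambda>k. norm (G k)) summable_on UNIV"
        unfolding F_def G_def using asum_nth[OF a] asum_nth[OF dc] by (auto simp: norm_mult)
      have "infsum F UNIV = fser L a x $ j" "infsum G UNIV = fser L (\<lambda>l. dcoef L l j *s c l) x $ m"
        unfolding F_def G_def by (rule infsumI, rule fser_nth_has_sum, rule a dc)+
      moreover have "(\<Sum>\<^sub>\<infinity>l. F (k - l) * G l) = fmode L k x * (\<Sum>\<^sub>\<infinity>l. a (k - l) $ j * (dcoef L l j * c l $ m))" for k
      proof -
        have "F (k - l) * G l = fmode L k x * (a (k - l) $ j * (dcoef L l j * c l $ m))" for l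
          using fmode_add[of L "k - l" l x] by (simp add: F_def G_def)
        thus ?thesis by (simp add: infsum_cmult_right')
      qed
      ultimately show ?thesis using convolution_has_sum(3)[OF F G] by simp
    qed
    have "((\<lambda>k. \<Sum>j\<in>UNIV. fmode L k x * (\<Sum>\<^sub>\<infinity>l. a (k - l) $ j * (dcoef L l j * c l $ m))) has_sum
        (\<Sum>j\<in>UNIV. fser L a x $ j * fser L (\<lambda>l. dcoef L l j *s c l) x $ m)) UNIV"
      by (intro has_sum_sum j)
    hence "((\<lambda>k. fmode L k x * advection L a c k $ m) has_sum
        (\<Sum>j\<in>UNIV. fser L a x $ j * fser L (\<lambda>l. dcoef L l j *s c l) x $ m)) UNIV"
      by (simp add: advection_nth sum_distrib_left)
    thus ?thesis using fser_nth_has_sum[OF asum_advection] has_sum_unique by blast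
  qed
  thus ?thesis by (simp add: vec_eq_iff)
qed

lemma asum_bhat: "asum (bhat L a c)"
  unfolding bhat_def by (rule asum_leray_symbol[OF asum_advection])

lemma bilin_fser:
  assumes L: "L > 0" and "divfree a" "divfree c" and c: "asum c"
  shows "bilin L (fser L a) (fser L c) (fser L (bhat L a c))"
proof -
  have "per_closure L (pd j) (fser L c) (fser L (\<lambda>l. dcoef L l j *s c l))" for j
    by (rule per_closure_fser[OF L pd_fser c dc]) (use L in \<open>auto simp: eq_ae_def\<close>)
  moreover have "leray L (\<lambda>x. \<Sum>j\<in>UNIV. fser L a x $ j *s fser L (\<lambda>l. dcoef L l j *s c l) x) (fser L (bhat L a c))"
    unfolding bhat_def by (rule leray_fser[OF L asum_advection]) (simp add: eq_ae_def fser_advection)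
  moreover have "fser L a \<in> HC_space L" "fser L c \<in> HC_space L"
    by (rule HC_spaceI[OF L a assms(2)] HC_spaceI[OF L c assms(3)]; simp add: eq_ae_def)+
  ultimately show ?thesis unfolding bilin_def by (intro conjI exI[of _ "\<lambda>j. fser L (\<lambda>l. dcoef L l j *s c l)"]) auto
qed

end

text \<open>Here \<open>v\<close> is any field with weak derivatives in L2, its coefficients
  possibly not summable. Only \<open>u\<close> is expanded in its series, and the conjugate mode
  times a derivative of \<open>v\<close> serves as the integrable weight in
  \<open>fser_integral\<close>.\<close>

lemma bilin_fcoeff:
  assumes L: "L > 0" and b: "bilin L u v w" and a: "asum a" and u: "eq_ae L u (fser L a)"
  shows "fcoeff L w k = bhat L a (fcoeff L v) k"
proof -
  obtain d where d: "\<And>j. per_closure L (pd j) v (d j)"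
    and le: "leray L (\<lambda>x. \<Sum>j\<in>UNIV. (u x $ j) *s d j x) w"
    using b by (auto simp: bilin_def)
  define f where "f = (\<lambda>x. \<Sum>j\<in>UNIV. (u x $ j) *s d j x)"
  have fl2: "f \<in> l2_space L" using le by (simp add: leray_def f_def)
  have dl2: "d j \<in> l2_space L" for j using d by (simp add: per_closure_def)
  have dnth: "integrable (leb L) (\<lambda>x. d j x $ m)" for j m
    by (rule integrable_bounded_linear[OF bounded_linear_vec_nth l2_integrable[OF dl2]])
  have dco: "fcoeff L (d j) l = dcoef L l j *s fcoeff L v l" for j l
    by (rule per_closure_fcoeff[OF L pd_fser d]) (use L in auto)
  have ae: "eq_ae L f (\<lambda>x. \<Sum>j\<in>UNIV. (fser L a x $ j) *s d j x)"
    using u unfolding eq_ae_def f_def by eventually_elim simp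
  have "fcoeff L f k $ m = advection L a (fcoeff L v) k $ m" for m
  proof -
    have iw: "integrable (leb L) (\<lambda>x. cnj (fmode L k x) * d j x $ m)" for j
      by (rule Bochner_Integration.integrable_bound[OF dnth])
         (use borel_measurable_integrable[OF dnth] in \<open>auto simp: norm_mult cnj_fmode\<close>)
    have I: "(\<integral>x. fmode L l x * (cnj (fmode L k x) * d j x $ m) \<partial>leb L) =
        of_real (L\<^sup>2) * (dcoef L (k - l) j * fcoeff L v (k - l) $ m)" for j l
    proof -
      have "fmode L l x * (cnj (fmode L k x) * d j x $ m) = cnj (fmode L (k - l) x) * d j x $ m" for x
        using fmode_add[of L l "- k" x] by (simp add: cnj_fmode mult.assoc[symmetric])
      hence "(\<lambda>x. fmode L l x * (cnj (fmode L k x) * d j x $ m)) = (\<lambda>x. cnj (fmode L (k - l) x) * d j x $ m)" ..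
      hence "(\<integral>x. fmode L l x * (cnj (fmode L k x) * d j x $ m) \<partial>leb L) = of_real (L\<^sup>2) * fcoeff L (d j) (k - l) $ m"
        using L by (simp add: fcoeff_nth[OF l2_integrable[OF dl2]])
      thus ?thesis by (simp add: dco)
    qed
    have "((\<lambda>l. a l $ j * (of_real (L\<^sup>2) * (dcoef L (k - l) j * fcoeff L v (k - l) $ m))) has_sum
        (\<integral>x. fser L a x $ j * (cnj (fmode L k x) * d j x $ m) \<partial>leb L)) UNIV" for j
      using fser_integral[OF a iw, of j j] by (simp only: I)
    hence "((\<lambda>l. \<Sum>j\<in>UNIV. a l $ j * (of_real (L\<^sup>2) * (dcoef L (k - l) j * fcoeff L v (k - l) $ m))) has_sum
        (\<Sum>j\<in>UNIV. \<integral>x. fser L a x $ j * (cnj (fmode L k x) * d j x $ m) \<partial>leb L)) UNIV"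
      by (intro has_sum_sum)
    also have "(\<Sum>j\<in>UNIV. \<integral>x. fser L a x $ j * (cnj (fmode L k x) * d j x $ m) \<partial>leb L) =
        (\<integral>x. (\<Sum>j\<in>UNIV. fser L a x $ j * (cnj (fmode L k x) * d j x $ m)) \<partial>leb L)"
    proof (rule Bochner_Integration.integral_sum[symmetric])
      fix j
      show "integrable (leb L) (\<lambda>x. fser L a x $ j * (cnj (fmode L k x) * d j x $ m))"
      proof (rule Bochner_Integration.integrable_bound)
        show "integrable (leb L) (\<lambda>x. (\<Sum>\<^sub>\<infinity>k. norm (a k)) * cmod (cnj (fmode L k x) * d j x $ m))" using iw by auto
        show "(\<lambda>x. fser L a x $ j * (cnj (fmode L k x) * d j x $ m)) \<in> borel_measurable (leb L)"
          using borel_measurable_fser[OF a, of L] borel_measurable_integrable[OF iw] by measurable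
        have "cmod (fser L a x $ j) \<le> (\<Sum>\<^sub>\<infinity>k. norm (a k))" for x
          using norm_fser_le[OF a] Finite_Cartesian_Product.norm_nth_le order_trans by blast
        thus "AE x in leb L. norm (fser L a x $ j * (cnj (fmode L k x) * d j x $ m))
            \<le> norm ((\<Sum>\<^sub>\<infinity>k. norm (a k)) * cmod (cnj (fmode L k x) * d j x $ m))"
          by (intro AE_I2) (simp add: norm_mult abs_mult mult_right_mono infsum_nonneg)
      qed
    qed
    also have "\<dots> = (\<integral>x. cnj (fmode L k x) * f x $ m \<partial>leb L)"
    proof (rule integral_cong_AE)
      have "AE x in leb L. f x = (\<Sum>j\<in>UNIV. (fser L a x $ j) *s d j x)" using ae by (simp add: eq_ae_def)
      thus "AE x in leb L. (\<Sum>j\<in>UNIV. fser L a x $ j * (cnj (fmode L k x) * d j x $ m)) = cnj (fmode L k x) * f x $ m"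
        by eventually_elim (simp add: sum_distrib_left algebra_simps)
    qed (use borel_measurable_fser[OF a, of L] borel_measurable_integrable[OF iw] l2_measurable[OF fl2] in measurable)
    also have "\<dots> = of_real (L\<^sup>2) * fcoeff L f k $ m"
      using L by (simp add: fcoeff_nth[OF l2_integrable[OF fl2]])
    finally have "((\<lambda>l. \<Sum>j\<in>UNIV. a l $ j * (of_real (L\<^sup>2) * (dcoef L (k - l) j * fcoeff L v (k - l) $ m))) has_sum
        of_real (L\<^sup>2) * fcoeff L f k $ m) UNIV" .
    \<comment> \<open>Reindexing by \<open>k - l\<close> moves the shift from the derivative to
      \<open>a\<close>, the order used in \<open>advection\<close>.\<close>
    hence "((\<lambda>l. \<Sum>j\<in>UNIV. a (k - l) $ j * (of_real (L\<^sup>2) * (dcoef L (k - (k - l)) j * fcoeff L v (k - (k - l)) $ m))) has_sum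
        of_real (L\<^sup>2) * fcoeff L f k $ m) UNIV"
      by (subst has_sum_reindex_bij_betw[of "\<lambda>l. k - l" UNIV UNIV
          "\<lambda>l. \<Sum>j\<in>UNIV. a l $ j * (of_real (L\<^sup>2) * (dcoef L (k - l) j * fcoeff L v (k - l) $ m))"])
         (auto intro!: bij_betwI[where g = "\<lambda>l. k - l"])
    hence "((\<lambda>l. of_real (L\<^sup>2) * ((\<Sum>j\<in>UNIV. a (k - l) $ j * dcoef L l j) * fcoeff L v l $ m)) has_sum
        of_real (L\<^sup>2) * fcoeff L f k $ m) UNIV"
      by (simp add: sum_distrib_left sum_distrib_right algebra_simps)
    from infsumI[OF this] show ?thesis using L by (simp add: infsum_cmult_right' advection_def)
  qed
  hence "fcoeff L f k = advection L a (fcoeff L v) k" by (simp add: vec_eq_iff)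
  thus ?thesis using leray_fcoeff[OF L le, of k] by (simp add: f_def bhat_def)
qed

section \<open>Bounded power series\<close>

text \<open>The zeros of a nontrivial power series are isolated, so agreement on the real diameter
  determines all coefficients. This carries an equation known only at real times to the Taylor
  coefficients.\<close>

lemma powser_eq_real:
  fixes a c :: "nat \<Rightarrow> complex"
  assumes a: "\<And>T. norm T < 1 \<Longrightarrow> (\<lambda>n. a n * T ^ n) sums f T"
    and c: "\<And>T. norm T < 1 \<Longrightarrow> (\<lambda>n. c n * T ^ n) sums g T"
    and eq: "\<And>T::real. \<bar>T\<bar> < 1 \<Longrightarrow> f (of_real T) = g (of_real T)"
  shows "a n = c n"
proof -
  define d where "d n = a n - c n" for n
  define D where "D T = f T - g T" for T
  have D: "(\<lambda>n. d n * (T - 0) ^ n) sums D T" if "norm (T - 0) < 1" for T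
    using sums_diff[OF a c, of T] that by (simp add: d_def D_def algebra_simps)
  have D0: "D (of_real T) = 0" if "\<bar>T\<bar> < 1" for T :: real using eq[OF that] by (simp add: D_def)
  have z: "D 0 = 0" using D0[of 0] by simp
  have "d 0 = 0"
    using D[of 0] z powser_sums_zero_iff[of d "0::complex"] by simp
  have "d n = 0"
  proof (rule ccontr)
    assume "d n \<noteq> 0"
    hence "n > 0" using \<open>d 0 = 0\<close> by (cases n) auto
    obtain s where s: "0 < s" "\<And>z. z \<in> cball 0 s - {0} \<Longrightarrow> D z \<noteq> 0"
      by (rule powser_0_nonzero[of 1 0 d D n]) (use D z \<open>d n \<noteq> 0\<close> \<open>n > 0\<close> in auto)
    \<comment> \<open>A real point inside the zero-free punctured disc; the cap \<open>1/2\<close>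
      keeps it inside the unit disc.\<close>
    define t where "t = min s (1/2)"
    have t: "0 < t" "t \<le> s" "t < 1" using s(1) by (auto simp: t_def)
    have "complex_of_real t \<in> cball 0 s - {0}" using t by auto
    thus False using s(2) D0[of t] t by simp
  qed
  thus ?thesis by (simp add: d_def)
qed

text \<open>Cauchy's inequality on radius r leaves a factor r to the power -n, which disappears as r
  tends to 1 because the bound holds on the whole open disc. The result is uniform in
  \<open>n\<close>.\<close>

lemma powser_coeff_bound:
  assumes a: "\<And>T. norm T < 1 \<Longrightarrow> (\<lambda>n. a n * T ^ n) sums f T"
    and M: "\<And>T. norm T < 1 \<Longrightarrow> cmod (f T) \<le> M"
  shows "cmod (a n) \<le> M"
proof -
  have hol: "f holomorphic_on ball 0 1"
    by (rule power_series_holomorphic[where a = a]) (use a in auto)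
  have an: "a n = (deriv ^^ n) f 0 / fact n"
  proof (rule powser_eq_real[OF a])
    show "(\<lambda>n. (deriv ^^ n) f 0 / fact n * T ^ n) sums f T" if "norm T < 1" for T
      using holomorphic_power_series[OF hol, of T] that by simp
  qed auto
  have b: "cmod (a n) * r ^ n \<le> M" if r: "0 < r" "r < 1" for r
  proof -
    have "cmod ((deriv ^^ n) f 0) \<le> fact n * M / r ^ n"
    proof (rule Cauchy_inequality)
      show "f holomorphic_on ball 0 r" by (rule holomorphic_on_subset[OF hol]) (use r in auto)
      show "continuous_on (cball 0 r) f"
        by (rule continuous_on_subset[OF holomorphic_on_imp_continuous_on[OF hol]]) (use r in auto)
    qed (use r M in \<open>auto simp: norm_minus_commute\<close>)
    thus ?thesis using r by (simp add: an norm_divide field_simps)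
  qed
  have "((\<lambda>r. cmod (a n) * r ^ n) \<longlongrightarrow> cmod (a n) * 1 ^ n) (at_left (1::real))"
    by (intro tendsto_intros)
  moreover have "eventually (\<lambda>r. cmod (a n) * r ^ n \<le> M) (at_left (1::real))"
    using eventually_at_left_real[of 0 1] by (auto elim!: eventually_mono intro!: b)
  ultimately show ?thesis by (auto dest: tendsto_upperbound)
qed

text \<open>The uniform coefficient bound turns the tail into a geometric series.\<close>

lemma powser_remainder_bound:
  assumes a: "\<And>T. norm T < 1 \<Longrightarrow> (\<lambda>n. a n * T ^ n) sums f T"
    and M: "\<And>T. norm T < 1 \<Longrightarrow> cmod (f T) \<le> M" and T: "norm T < 1"
  shows "cmod (f T - (\<Sum>n<N. a n * T ^ n)) \<le> M * norm T ^ N / (1 - norm T)"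
proof -
  have "(\<lambda>n. a (n + N) * T ^ (n + N)) sums (f T - (\<Sum>n<N. a n * T ^ n))"
    using sums_split_initial_segment[OF a[OF T], of N] .
  moreover have g: "(\<lambda>n. M * norm T ^ N * norm T ^ n) sums (M * norm T ^ N * (1 / (1 - norm T)))"
    by (intro sums_mult geometric_sums) (use T in simp)
  moreover have "norm (a (n + N) * T ^ (n + N)) \<le> M * norm T ^ N * norm T ^ n" for n
    using mult_right_mono[OF powser_coeff_bound[OF a M, where n = "n + N"], of "norm T ^ N * norm T ^ n"]
    by (simp add: norm_mult norm_power power_add algebra_simps)
  ultimately have "norm (f T - (\<Sum>n<N. a n * T ^ n)) \<le> M * norm T ^ N * (1 / (1 - norm T))"
    by (metis (no_types, lifting) norm_suminf_le sums_iff)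
  thus ?thesis by simp
qed

text \<open>Testing against a fixed vector reduces bounds for vector-valued power series to scalar ones.\<close>

lemma l2_dual_bound:
  fixes v :: "'i \<Rightarrow> complex"
  assumes M: "M \<ge> 0" and fin: "finite K"
    and *: "cmod (\<Sum>i\<in>K. cnj (v i) * v i) \<le> M * L2_set (\<lambda>i. cmod (v i)) K"
  shows "(\<Sum>i\<in>K. (cmod (v i))\<^sup>2) \<le> M\<^sup>2"
proof -
  define n where "n = L2_set (\<lambda>i. cmod (v i)) K"
  have n0: "n \<ge> 0" by (simp add: n_def L2_set_nonneg)
  have n2: "n\<^sup>2 = (\<Sum>i\<in>K. (cmod (v i))\<^sup>2)" by (simp add: n_def L2_set_def sum_nonneg)
  have "(\<Sum>i\<in>K. cnj (v i) * v i) = complex_of_real (n\<^sup>2)"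
    unfolding n2 by (simp add: complex_norm_square mult.commute del: of_real_power)
  hence "n\<^sup>2 \<le> M * n" using * n0 by (simp add: n_def[symmetric] norm_power)
  hence "n \<le> M" using n0 M by (cases "n = 0") (auto simp: power2_eq_square)
  thus ?thesis unfolding n2[symmetric] using n0 by (intro power_mono)
qed

context
  fixes K :: "'i set" and a :: "'i \<Rightarrow> nat \<Rightarrow> complex" and f :: "'i \<Rightarrow> complex \<Rightarrow> complex" and M :: real
  assumes fin: "finite K" and M0: "M \<ge> 0"
    and a: "\<And>i T. i \<in> K \<Longrightarrow> norm T < 1 \<Longrightarrow> (\<lambda>n. a i n * T ^ n) sums f i T"
    and M: "\<And>T. norm T < 1 \<Longrightarrow> (\<Sum>i\<in>K. (cmod (f i T))\<^sup>2) \<le> M\<^sup>2"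
begin

lemma powser_l2_test:
  assumes T: "norm T < 1"
  shows "(\<lambda>n. (\<Sum>i\<in>K. c i * a i n) * T ^ n) sums (\<Sum>i\<in>K. c i * f i T)"
    and "cmod (\<Sum>i\<in>K. c i * f i T) \<le> M * L2_set (\<lambda>i. cmod (c i)) K"
proof -
  have "(\<lambda>n. \<Sum>i\<in>K. c i * (a i n * T ^ n)) sums (\<Sum>i\<in>K. c i * f i T)"
    by (intro sums_sum sums_mult a T)
  thus "(\<lambda>n. (\<Sum>i\<in>K. c i * a i n) * T ^ n) sums (\<Sum>i\<in>K. c i * f i T)"
    by (simp add: sum_distrib_right mult.assoc)
  have "cmod (\<Sum>i\<in>K. c i * f i T) \<le> (\<Sum>i\<in>K. \<bar>cmod (c i)\<bar> * \<bar>cmod (f i T)\<bar>)"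
    by (rule order_trans[OF norm_sum]) (simp add: norm_mult)
  also have "\<dots> \<le> L2_set (\<lambda>i. cmod (c i)) K * L2_set (\<lambda>i. cmod (f i T)) K"
    by (rule L2_set_mult_ineq)
  also have "\<dots> \<le> L2_set (\<lambda>i. cmod (c i)) K * M"
    unfolding L2_set_def[of "\<lambda>i. cmod (f i T)"]
    using real_sqrt_le_mono[OF M[OF T]] M0 by (intro mult_left_mono) (auto simp: L2_set_nonneg)
  finally show "cmod (\<Sum>i\<in>K. c i * f i T) \<le> M * L2_set (\<lambda>i. cmod (c i)) K" by (simp add: mult.commute)
qed

text \<open>The scalar bound is applied to the combination tested against the conjugate of the
  \<open>n\<close>-th coefficient vector itself. The constant does not depend on the size of
  \<open>K\<close>, so the bound later passes from finitely many modes to all of them.\<close>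

lemma powser_l2_coeff_bound: "(\<Sum>i\<in>K. (cmod (a i n))\<^sup>2) \<le> M\<^sup>2"
  by (rule l2_dual_bound[OF M0 fin], rule powser_coeff_bound[OF powser_l2_test(1)])
     (auto dest!: powser_l2_test(2)[where c = "\<lambda>i. cnj (a i n)"])

lemma powser_l2_remainder_bound:
  assumes T: "norm T < 1"
  shows "(\<Sum>i\<in>K. (cmod (f i T - (\<Sum>n<N. a i n * T ^ n)))\<^sup>2) \<le> (M * norm T ^ N / (1 - norm T))\<^sup>2"
proof (rule l2_dual_bound)
  \<comment> \<open>The remainder is tested against its own conjugate, so the duality estimate
    returns its norm.\<close>
  define v where "v i = f i T - (\<Sum>n<N. a i n * T ^ n)" for i
  define n where "n = L2_set (\<lambda>i. cmod (v i)) K"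
  have bd: "cmod (\<Sum>i\<in>K. cnj (v i) * f i S) \<le> M * n" if "norm S < 1" for S
    using powser_l2_test(2)[OF that, of "\<lambda>i. cnj (v i)"] by (simp add: n_def)
  have "cmod ((\<Sum>i\<in>K. cnj (v i) * f i T) - (\<Sum>m<N. (\<Sum>i\<in>K. cnj (v i) * a i m) * T ^ m)) \<le> M * n * norm T ^ N / (1 - norm T)"
    by (rule powser_remainder_bound[OF powser_l2_test(1) bd T])
  also have "(\<Sum>m<N. (\<Sum>i\<in>K. cnj (v i) * a i m) * T ^ m) = (\<Sum>i\<in>K. cnj (v i) * (\<Sum>m<N. a i m * T ^ m))"
    by (simp add: sum_distrib_left sum_distrib_right mult.assoc sum.swap[of _ K])
  also have "(\<Sum>i\<in>K. cnj (v i) * f i T) - \<dots> = (\<Sum>i\<in>K. cnj (v i) * v i)"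
    by (simp add: v_def right_diff_distrib sum_subtractf)
  finally show "cmod (\<Sum>i\<in>K. cnj (f i T - (\<Sum>n<N. a i n * T ^ n)) * (f i T - (\<Sum>n<N. a i n * T ^ n)))
      \<le> M * norm T ^ N / (1 - norm T) * L2_set (\<lambda>i. cmod (f i T - (\<Sum>n<N. a i n * T ^ n))) K"
    by (simp add: v_def n_def mult_ac)
qed (use M0 T fin in auto)

end

lemma summable_Suc_times_power:
  fixes r :: real
  assumes "0 \<le> r" "r < 1"
  shows "summable (\<lambda>n. real (Suc n) * r ^ n)"
  using geometric_deriv_sums[of r] assms by (auto simp: sums_iff)

text \<open>Interchanges the sum over modes \<open>l\<close> with the Cauchy product in
  \<open>n\<close>. The double family is dominated by \<open>cmod (q l) * (X l * Y l)\<close> times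
  \<open>(n + 1) * norm T ^ n\<close>, the factor \<open>n + 1\<close> counting the terms of the
  Cauchy product; both iterated sums of \<open>z\<close> are then evaluated.\<close>

lemma powser_convolution_sums:
  fixes x y :: "'l \<Rightarrow> nat \<Rightarrow> complex" and q :: "'l \<Rightarrow> complex"
  assumes X: "\<And>l n. cmod (x l n) \<le> X l" and Y: "\<And>l n. cmod (y l n) \<le> Y l"
    and S: "(\<lambda>l. cmod (q l) * (X l * Y l)) summable_on UNIV" and T: "norm T < 1"
    and f: "\<And>l. (\<lambda>n. x l n * T ^ n) sums f l" and g: "\<And>l. (\<lambda>n. y l n * T ^ n) sums g l"
  shows "(\<lambda>n. (\<Sum>h\<le>n. \<Sum>\<^sub>\<infinity>l. q l * (x l h * y l (n - h))) * T ^ n) sums (\<Sum>\<^sub>\<infinity>l. q l * (f l * g l))"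
proof -
  define z where "z l n = q l * ((\<Sum>h\<le>n. x l h * y l (n - h)) * T ^ n)" for l n
  have X0: "X l \<ge> 0" and Y0: "Y l \<ge> 0" for l
    using X[of l 0] Y[of l 0] norm_ge_zero order_trans by blast+
  have xy: "cmod (x l h * y l m) \<le> X l * Y l" for l h m
    unfolding norm_mult by (intro mult_mono X Y X0) auto
  have sxy: "(\<lambda>l. q l * (x l h * y l m)) summable_on UNIV" for h m
  proof (rule abs_summable_summable, rule summable_on_comparison_test[OF S])
    show "norm (q l * (x l h * y l m)) \<le> cmod (q l) * (X l * Y l)" for l
      unfolding norm_mult[of "q l"] by (intro mult_left_mono xy) auto
  qed auto
  have zb: "norm (z l n) \<le> cmod (q l) * (X l * Y l) * (real (Suc n) * norm T ^ n)" for l n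
  proof -
    have "cmod (\<Sum>h\<le>n. x l h * y l (n - h)) \<le> (\<Sum>h\<le>n. X l * Y l)"
      by (rule order_trans[OF norm_sum sum_mono]) (rule xy)
    hence "cmod (q l) * (cmod (\<Sum>h\<le>n. x l h * y l (n - h)) * norm T ^ n) \<le> cmod (q l) * (real (Suc n) * (X l * Y l) * norm T ^ n)"
      by (intro mult_left_mono mult_right_mono) auto
    thus ?thesis by (simp add: z_def norm_mult norm_power algebra_simps)
  qed
  have sT: "(\<lambda>n. real (Suc n) * norm T ^ n) summable_on UNIV"
    by (subst summable_on_UNIV_nonneg_real_iff) (use T summable_Suc_times_power[of "norm T"] in auto)
  have "(\<lambda>p. norm (case p of (l, n) \<Rightarrow> complex_of_real (cmod (q l) * (X l * Y l) * (real (Suc n) * norm T ^ n)))) summable_on (UNIV \<times> UNIV)"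
  proof (rule Infinite_Sum.abs_summable_on_Sigma_iff[THEN iffD2], intro conjI ballI)
    show "(\<lambda>n. norm (case (l, n) of (l, n) \<Rightarrow> complex_of_real (cmod (q l) * (X l * Y l) * (real (Suc n) * norm T ^ n)))) summable_on UNIV" for l
      using summable_on_cmult_right[OF sT, of "cmod (q l) * (X l * Y l)"] X0 Y0
      by (simp only: prod.case norm_of_real abs_mult abs_norm_cancel abs_of_nonneg of_nat_0_le_iff zero_le_power norm_ge_zero mult_nonneg_nonneg)
    show "(\<lambda>l. norm (\<Sum>\<^sub>\<infinity>n. norm (case (l, n) of (l, n) \<Rightarrow> complex_of_real (cmod (q l) * (X l * Y l) * (real (Suc n) * norm T ^ n))))) summable_on UNIV"
    proof -
      define R where "R = (\<Sum>\<^sub>\<infinity>n. real (Suc n) * norm T ^ n)"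
      have R0: "R \<ge> 0" unfolding R_def by (rule infsum_nonneg) auto
      have "(\<Sum>\<^sub>\<infinity>n. norm (case (l, n) of (l, n) \<Rightarrow> complex_of_real (cmod (q l) * (X l * Y l) * (real (Suc n) * norm T ^ n)))) = cmod (q l) * (X l * Y l) * R" for l
        unfolding R_def using X0 Y0
        by (simp only: prod.case norm_of_real abs_mult abs_norm_cancel abs_of_nonneg of_nat_0_le_iff zero_le_power norm_ge_zero mult_nonneg_nonneg infsum_cmult_right')
      thus ?thesis using summable_on_cmult_left[OF S, of R] X0 Y0 R0 by simp
    qed
  qed
  hence "(\<lambda>p. norm (case p of (l, n) \<Rightarrow> z l n)) summable_on (UNIV \<times> UNIV)"
  proof (rule Infinite_Sum.abs_summable_on_comparison_test)
    fix p :: "'l \<times> nat"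
    obtain l n where p: "p = (l, n)" by force
    show "norm (case p of (l, n) \<Rightarrow> z l n) \<le> norm (case p of (l, n) \<Rightarrow> complex_of_real (cmod (q l) * (X l * Y l) * (real (Suc n) * norm T ^ n)))"
      unfolding p prod.case norm_of_real by (rule order_trans[OF zb abs_ge_self])
  qed
  hence sz: "(\<lambda>(l, n). z l n) summable_on (UNIV \<times> UNIV)" by (rule abs_summable_summable)
  have zl: "(\<Sum>\<^sub>\<infinity>n. z l n) = q l * (f l * g l)" for l
  proof -
    have sx: "summable (\<lambda>n. norm (x l n * T ^ n))" and sy: "summable (\<lambda>n. norm (y l n * T ^ n))"
      by (rule summable_comparison_test'[OF summable_mult[OF summable_geometric[of "norm T"], of "X l"]],
          use T X Y in \<open>auto simp: norm_mult norm_power intro!: mult_right_mono\<close>)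
         (rule summable_comparison_test'[OF summable_mult[OF summable_geometric[of "norm T"], of "Y l"]],
          use T X Y in \<open>auto simp: norm_mult norm_power intro!: mult_right_mono\<close>)
    have "(\<lambda>n. \<Sum>h\<le>n. (x l h * T ^ h) * (y l (n - h) * T ^ (n - h))) sums (f l * g l)"
      using Cauchy_product_sums[OF sx sy] sums_unique[OF f[of l]] sums_unique[OF g[of l]] by simp
    also have "(\<lambda>n. \<Sum>h\<le>n. (x l h * T ^ h) * (y l (n - h) * T ^ (n - h))) = (\<lambda>n. (\<Sum>h\<le>n. x l h * y l (n - h)) * T ^ n)"
    proof
      fix n
      have "(x l h * T ^ h) * (y l (n - h) * T ^ (n - h)) = x l h * y l (n - h) * T ^ n" if "h \<le> n" for h
        using that by (simp add: algebra_simps power_add[symmetric])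
      thus "(\<Sum>h\<le>n. (x l h * T ^ h) * (y l (n - h) * T ^ (n - h))) = (\<Sum>h\<le>n. x l h * y l (n - h)) * T ^ n"
        unfolding sum_distrib_right by (intro sum.cong refl) simp
    qed
    finally have "(\<lambda>n. z l n) sums (q l * (f l * g l))" unfolding z_def by (rule sums_mult)
    moreover have "z l summable_on UNIV"
      using summable_on_SigmaD1[OF sz, of l] by simp
    hence "(\<lambda>n. z l n) sums (\<Sum>\<^sub>\<infinity>n. z l n)" by (intro has_sum_imp_sums has_sum_infsum)
    ultimately show ?thesis using sums_unique2 by blast
  qed
  have zn: "(\<Sum>\<^sub>\<infinity>l. z l n) = (\<Sum>h\<le>n. \<Sum>\<^sub>\<infinity>l. q l * (x l h * y l (n - h))) * T ^ n" for n
  proof -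
    have "((\<lambda>l. (\<Sum>h\<le>n. q l * (x l h * y l (n - h))) * T ^ n) has_sum (\<Sum>h\<le>n. \<Sum>\<^sub>\<infinity>l. q l * (x l h * y l (n - h))) * T ^ n) UNIV"
      by (intro has_sum_cmult_left has_sum_sum has_sum_infsum sxy)
    moreover have "(\<Sum>h\<le>n. q l * (x l h * y l (n - h))) * T ^ n = z l n" for l
      unfolding z_def mult.assoc[symmetric] sum_distrib_left ..
    ultimately show ?thesis by (intro infsumI) simp
  qed
  have "(\<lambda>(n, l). z l n) summable_on (UNIV \<times> UNIV)" using summable_on_swap[of "\<lambda>(l, n). z l n" UNIV UNIV] sz by simp
  hence "(\<lambda>n. \<Sum>\<^sub>\<infinity>l. z l n) summable_on UNIV" by (rule summable_on_Sigma_banach)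
  hence "(\<lambda>n. \<Sum>\<^sub>\<infinity>l. z l n) sums (\<Sum>\<^sub>\<infinity>n. \<Sum>\<^sub>\<infinity>l. z l n)" by (intro has_sum_imp_sums has_sum_infsum)
  also have "(\<Sum>\<^sub>\<infinity>n. \<Sum>\<^sub>\<infinity>l. z l n) = (\<Sum>\<^sub>\<infinity>l. \<Sum>\<^sub>\<infinity>n. z l n)" by (rule infsum_swap_banach[OF sz, symmetric])
  finally show ?thesis by (simp only: zl zn)
qed

section \<open>The weighted spaces\<close>

lemma Eb_weight_pos [simp]: "Eb_weight b k > 0"
  by (simp add: Eb_weight_def)

text \<open>Completing the square bounds \<open>p * s\<close> by
  \<open>p^2 / (4 * b) + b * s^2\<close>. With \<open>s\<close> the logarithm in the weight, this
  shows that the weight beats every power of the wave number.\<close>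

lemma Eb_weight_ge_power:
  assumes b: "b > 0"
  shows "(kabs k + 1) ^ p \<le> exp (real p ^ 2 / (4 * b)) * Eb_weight b k"
proof -
  define s where "s = ln (kabs k + exp 1)"
  have e1: "1 \<le> exp (1::real)" by simp
  have "(kabs k + 1) ^ p \<le> (kabs k + exp 1) ^ p" by (intro power_mono add_left_mono e1) auto
  also have "\<dots> = exp (real p * s)"
    unfolding s_def by (subst exp_of_nat_mult) (simp add: add_nonneg_pos)
  also have "real p * s \<le> real p ^ 2 / (4 * b) + b * s\<^sup>2"
  proof -
    have "0 \<le> (real p - 2 * b * s)\<^sup>2 / (4 * b)" using b by simp
    also have "\<dots> = real p ^ 2 / (4 * b) + b * s\<^sup>2 - real p * s"
      using b by (simp add: power2_diff field_simps power2_eq_square)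
    finally show ?thesis by simp
  qed
  hence "exp (real p * s) \<le> exp (real p ^ 2 / (4 * b) + b * s\<^sup>2)" by simp
  also have "\<dots> = exp (real p ^ 2 / (4 * b)) * Eb_weight b k" by (simp add: exp_add Eb_weight_def s_def)
  finally show ?thesis .
qed

section \<open>Lattice sums and decay of coefficients\<close>

lemma summable_on_int_inverse_square: "(\<lambda>n::int. 1 / (1 + \<bar>real_of_int n\<bar>)\<^sup>2) summable_on UNIV"
proof -
  have N: "(\<lambda>n::nat. 1 / (1 + real n)\<^sup>2) summable_on UNIV"
  proof (subst summable_on_UNIV_nonneg_real_iff)
    have "summable (\<lambda>n. inverse (real (Suc n) ^ 2))"
      using inverse_power_summable[of 2, where 'a = real] by (subst summable_Suc_iff) auto
    thus "summable (\<lambda>n::nat. 1 / (1 + real n)\<^sup>2)" by (simp add: inverse_eq_divide add.commute)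
  qed auto
  have 1: "(\<lambda>n::int. 1 / (1 + \<bar>real_of_int n\<bar>)\<^sup>2) summable_on range int"
    by (subst summable_on_reindex) (use N in \<open>auto simp: o_def\<close>)
  have 2: "(\<lambda>n::int. 1 / (1 + \<bar>real_of_int n\<bar>)\<^sup>2) summable_on range (\<lambda>n. - int n)"
    by (subst summable_on_reindex) (use N in \<open>auto simp: o_def inj_on_def\<close>)
  have "x \<in> range int \<union> range (\<lambda>n. - int n)" for x :: int
  proof (cases "x \<ge> 0")
    case True
    hence "x = int (nat x)" by simp
    thus ?thesis by blast
  next
    case False
    hence "x = - int (nat (- x))" by simp
    thus ?thesis by blast
  qed
  hence "range int \<union> range (\<lambda>n. - int n) = UNIV" by blast
  thus ?thesis using summable_on_union[OF 1 2] by simp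
qed

text \<open>The fourth power of \<open>kabs k + 1\<close> dominates the product of the squares of
  \<open>1 + |k_1|\<close> and \<open>1 + |k_2|\<close>, so the lattice sum is controlled by a
  product of one-dimensional sums.\<close>

lemma summable_on_inverse_kabs_power: "(\<lambda>k. 1 / (kabs k + 1) ^ 4) summable_on UNIV"
proof -
  define f where "f n = 1 / (1 + \<bar>real_of_int n\<bar>)\<^sup>2" for n
  have "(\<lambda>p. norm (case p of (m, n) \<Rightarrow> f m * f n)) summable_on (UNIV \<times> UNIV)"
  proof (rule Infinite_Sum.abs_summable_on_Sigma_iff[THEN iffD2], intro conjI ballI)
    have f: "f summable_on UNIV" using summable_on_int_inverse_square by (simp add: f_def[abs_def])
    have f0: "f n \<ge> 0" for n by (simp add: f_def)
    show "(\<lambda>n. norm (case (m, n) of (m, n) \<Rightarrow> f m * f n)) summable_on UNIV" for m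
      using summable_on_cmult_right[OF f] f0 by simp
    have "(\<Sum>\<^sub>\<infinity>n. norm (case (m, n) of (m, n) \<Rightarrow> f m * f n)) = f m * infsum f UNIV" for m
      using f0 by (simp add: infsum_cmult_right')
    thus "(\<lambda>m. norm (\<Sum>\<^sub>\<infinity>n. norm (case (m, n) of (m, n) \<Rightarrow> f m * f n))) summable_on UNIV"
      using summable_on_cmult_left[OF f] f0 infsum_nonneg[of UNIV f] by simp
  qed
  hence 1: "(\<lambda>(m, n). f m * f n) summable_on (UNIV \<times> UNIV)" by (rule abs_summable_summable)
  have bij: "bij_betw (\<lambda>k::int^2. (k $ 1, k $ 2)) UNIV (UNIV \<times> UNIV)"
    by (rule bij_betwI[where g = "\<lambda>(m, n). vector [m, n]"]) (auto simp: vec_eq_iff forall_2)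
  have 2: "(\<lambda>k::int^2. f (k $ 1) * f (k $ 2)) summable_on UNIV"
    using summable_on_reindex_bij_betw[OF bij, of "\<lambda>(m, n). f m * f n"] 1 by simp
  show ?thesis
  proof (rule summable_on_comparison_test[OF 2])
    fix k
    have "(1 + \<bar>real_of_int (k $ j)\<bar>)\<^sup>2 \<le> (kabs k + 1)\<^sup>2" for j
      using abs_nth_le_kabs[of k j] by (intro power_mono) auto
    hence "(1 + \<bar>real_of_int (k $ 1)\<bar>)\<^sup>2 * (1 + \<bar>real_of_int (k $ 2)\<bar>)\<^sup>2 \<le> (kabs k + 1)\<^sup>2 * (kabs k + 1)\<^sup>2"
      by (intro mult_mono) auto
    also have "\<dots> = (kabs k + 1) ^ 4" by (simp flip: power_add)
    finally have "1 / (kabs k + 1) ^ 4 \<le> 1 / ((1 + \<bar>real_of_int (k $ 1)\<bar>)\<^sup>2 * (1 + \<bar>real_of_int (k $ 2)\<bar>)\<^sup>2)"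
      by (intro divide_left_mono mult_pos_pos zero_less_power add_nonneg_pos add_pos_nonneg) auto
    thus "1 / (kabs k + 1) ^ 4 \<le> f (k $ 1) * f (k $ 2)" by (simp add: f_def)
  qed auto
qed

lemma summable_on_Eb_weight:
  assumes b: "b > 0"
  shows "(\<lambda>k. (kabs k + 1)\<^sup>2 / Eb_weight b k) summable_on UNIV"
proof (rule summable_on_comparison_test)
  \<comment> \<open>The exponent 6 is 2 + 4: two powers for the derivatives in A, four for
    summability over the lattice.\<close>
  define C where "C = exp (real 6 ^ 2 / (4 * b))"
  show "(\<lambda>k. C * (1 / (kabs k + 1) ^ 4)) summable_on UNIV"
    by (rule summable_on_cmult_right[OF summable_on_inverse_kabs_power])
  show "(kabs k + 1)\<^sup>2 / Eb_weight b k \<le> C * (1 / (kabs k + 1) ^ 4)" for k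
  proof -
    have p: "kabs k + 1 > 0" using kabs_nonneg[of k] by linarith
    have "(kabs k + 1)\<^sup>2 * (kabs k + 1) ^ 4 = (kabs k + 1) ^ 6" by (simp flip: power_add)
    also have "\<dots> \<le> C * Eb_weight b k" unfolding C_def by (rule Eb_weight_ge_power[OF b])
    finally show ?thesis using p by (simp add: field_simps)
  qed
qed (auto simp: less_imp_le)

text \<open>A pointwise substitute for a bound in E_b. Cauchy estimates act on single modes and
  yield exactly this form, with a constant shared by all Taylor coefficients.\<close>

definition decays :: "real \<Rightarrow> real \<Rightarrow> (int^2 \<Rightarrow> complex^2) \<Rightarrow> bool" where
  "decays b C a \<longleftrightarrow> (\<forall>k. norm (a k) \<le> C / Eb_weight b k)"

lemma decays_asum_mult:
  assumes b: "b > 0" and a: "decays b C a" and m: "\<And>k. cmod (m k) \<le> D * (kabs k + 1)\<^sup>2"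
  shows "asum (\<lambda>k. m k *s a k)"
proof (rule summable_on_comparison_test)
  show "(\<lambda>k. D * C * ((kabs k + 1)\<^sup>2 / Eb_weight b k)) summable_on UNIV"
    by (rule summable_on_cmult_right[OF summable_on_Eb_weight[OF b]])
  show "norm (m k *s a k) \<le> D * C * ((kabs k + 1)\<^sup>2 / Eb_weight b k)" for k
  proof -
    have "0 \<le> D * (kabs k + 1)\<^sup>2" using m[of k] norm_ge_zero order_trans by blast
    hence "cmod (m k) * norm (a k) \<le> D * (kabs k + 1)\<^sup>2 * (C / Eb_weight b k)"
      using a m by (intro mult_mono) (auto simp: decays_def)
    thus ?thesis by (simp add: norm_smult algebra_simps)
  qed
qed auto

lemma one_le_kabs_sq: "1 \<le> (kabs k + 1)\<^sup>2"
  by (simp add: power2_sum)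

lemma kabs_le_sq: "kabs k \<le> (kabs k + 1)\<^sup>2"
  by (simp add: power2_sum add_nonneg_nonneg)

context
  fixes b C :: real and a :: "int^2 \<Rightarrow> complex^2"
  assumes b: "b > 0" and dec: "decays b C a"
begin

lemma decays_asum: "asum a"
  using decays_asum_mult[OF b dec, of "\<lambda>k. 1" 1] one_le_kabs_sq by simp

lemma decays_asum_dcoef: "asum (\<lambda>k. dcoef L k j *s a k)"
proof (rule decays_asum_mult[OF b dec])
  show "cmod (dcoef L k j) \<le> \<bar>kappa0 L\<bar> * (kabs k + 1)\<^sup>2" for k
    using order_trans[OF abs_nth_le_kabs[of k j] kabs_le_sq[of k]]
    by (simp add: dcoef_def norm_mult mult_left_mono)
qed

lemma decays_asum_lam: "asum (\<lambda>k. of_real (lam L k) *s a k)"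
proof (rule decays_asum_mult[OF b dec])
  show "cmod (of_real (lam L k)) \<le> (kappa0 L)\<^sup>2 * (kabs k + 1)\<^sup>2" for k
    by (simp add: lam_def norm_power norm_mult power_mult_distrib mult_left_mono power_mono)
qed

end

section \<open>Weighted square summability and the norm of E_b\<close>

definition wsum :: "real \<Rightarrow> (int^2 \<Rightarrow> complex^2) \<Rightarrow> bool" where
  "wsum b a \<longleftrightarrow> (\<lambda>k. (norm (Eb_weight b k *\<^sub>R a k))\<^sup>2) summable_on UNIV"

lemma wsum_add:
  assumes "wsum b a" "wsum b c"
  shows "wsum b (\<lambda>k. a k + c k)"
  unfolding wsum_def
proof (rule summable_on_comparison_test)
  show "(\<lambda>k. 2 * (norm (Eb_weight b k *\<^sub>R a k))\<^sup>2 + 2 * (norm (Eb_weight b k *\<^sub>R c k))\<^sup>2) summable_on UNIV"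
    using assms by (intro summable_on_add summable_on_cmult_right) (auto simp: wsum_def)
  fix k
  define x where "x = Eb_weight b k *\<^sub>R a k"
  define y where "y = Eb_weight b k *\<^sub>R c k"
  have "(norm (x + y))\<^sup>2 \<le> (norm x + norm y)\<^sup>2" by (intro power_mono norm_triangle_ineq) auto
  also have "\<dots> \<le> 2 * (norm x)\<^sup>2 + 2 * (norm y)\<^sup>2"
    using sum_squares_bound[of "norm x" "norm y"] by (simp add: power2_sum)
  finally show "(norm (Eb_weight b k *\<^sub>R (a k + c k)))\<^sup>2 \<le> 2 * (norm (Eb_weight b k *\<^sub>R a k))\<^sup>2 + 2 * (norm (Eb_weight b k *\<^sub>R c k))\<^sup>2"
    by (simp add: x_def y_def scaleR_add_right)
qed auto

lemma wsum_smult: "wsum b a \<Longrightarrow> wsum b (\<lambda>k. z *s a k)"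
  unfolding wsum_def
  by (drule summable_on_cmult_right[where c = "(cmod z)\<^sup>2"]) (simp add: norm_smult power_mult_distrib mult_ac)

lemma wsum_diff: "wsum b a \<Longrightarrow> wsum b c \<Longrightarrow> wsum b (\<lambda>k. a k - c k)"
  using wsum_add[OF _ wsum_smult[where z = "-1"], of b a c] by simp

lemma Eb_norm_nonneg: "Eb_norm L b u \<ge> 0"
  by (simp add: Eb_norm_def infsum_nonneg)

lemma Eb_norm_eq: "L > 0 \<Longrightarrow> Eb_norm L b u = L * sqrt (\<Sum>\<^sub>\<infinity>k. (norm (Eb_weight b k *\<^sub>R fcoeff L u k))\<^sup>2)"
  by (simp add: Eb_norm_def real_sqrt_mult)

lemma Eb_norm_sum_le:
  assumes L: "L > 0" and w: "wsum b (fcoeff L u)" and "finite K"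
  shows "(\<Sum>k\<in>K. (norm (Eb_weight b k *\<^sub>R fcoeff L u k))\<^sup>2) \<le> (Eb_norm L b u / L)\<^sup>2"
proof -
  have "(\<Sum>k\<in>K. (norm (Eb_weight b k *\<^sub>R fcoeff L u k))\<^sup>2) \<le> (\<Sum>\<^sub>\<infinity>k. (norm (Eb_weight b k *\<^sub>R fcoeff L u k))\<^sup>2)"
    using w assms(3) by (intro finite_sum_le_infsum) (auto simp: wsum_def)
  thus ?thesis using L by (simp add: Eb_norm_eq infsum_nonneg)
qed

lemma norm_fcoeff_le_Eb_norm:
  assumes L: "L > 0" and w: "wsum b (fcoeff L u)"
  shows "norm (fcoeff L u k) \<le> Eb_norm L b u / L / Eb_weight b k"
proof -
  have "(norm (Eb_weight b k *\<^sub>R fcoeff L u k))\<^sup>2 \<le> (Eb_norm L b u / L)\<^sup>2"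
    using Eb_norm_sum_le[OF L w, of "{k}"] by simp
  hence "norm (Eb_weight b k *\<^sub>R fcoeff L u k) \<le> Eb_norm L b u / L"
    by (rule power2_le_imp_le) (use L Eb_norm_nonneg in simp)
  thus ?thesis using L by (simp add: field_simps less_imp_le)
qed

text \<open>Bounds on finite sets of modes suffice, the form in which the vector-valued power series
  estimates arrive.\<close>

lemma wsum_Eb_norm_le:
  assumes L: "L > 0" and M: "M \<ge> 0"
    and *: "\<And>K. finite K \<Longrightarrow> (\<Sum>k\<in>K. (norm (Eb_weight b k *\<^sub>R fcoeff L u k))\<^sup>2) \<le> M\<^sup>2"
  shows "wsum b (fcoeff L u)" "Eb_norm L b u \<le> L * M"
proof -
  show w: "wsum b (fcoeff L u)" unfolding wsum_def
    by (rule nonneg_bdd_above_summable_on) (auto intro!: bdd_aboveI[where M = "M\<^sup>2"] * simp del: norm_scaleR)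
  have "(\<Sum>\<^sub>\<infinity>k. (norm (Eb_weight b k *\<^sub>R fcoeff L u k))\<^sup>2) \<le> M\<^sup>2"
    by (rule infsum_le_finite_sums) (use w * in \<open>auto simp: wsum_def\<close>)
  hence "sqrt (\<Sum>\<^sub>\<infinity>k. (norm (Eb_weight b k *\<^sub>R fcoeff L u k))\<^sup>2) \<le> M"
    using M real_sqrt_le_mono by fastforce
  thus "Eb_norm L b u \<le> L * M" using L by (simp add: Eb_norm_eq)
qed

lemma Eb_space_props:
  assumes L: "L > 0" and b: "b > 0" and u: "u \<in> Eb_space L b"
  shows "u \<in> HC_space L" "wsum b (fcoeff L u)" "u \<in> l2_space L" "divfree (fcoeff L u)"
    and "decays b (Eb_norm L b u / L) (fcoeff L u)" "asum (fcoeff L u)" "eq_ae L u (fser L (fcoeff L u))"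
proof -
  show HC: "u \<in> HC_space L" and w: "wsum b (fcoeff L u)" using u by (auto simp: Eb_space_def wsum_def)
  show "u \<in> l2_space L" "divfree (fcoeff L u)" using HC_space_props[OF L HC] by auto
  show d: "decays b (Eb_norm L b u / L) (fcoeff L u)"
    unfolding decays_def using norm_fcoeff_le_Eb_norm[OF L w] by blast
  show as: "asum (fcoeff L u)" by (rule decays_asum[OF b d])
  show "eq_ae L u (fser L (fcoeff L u))" by (rule eq_ae_fser_fcoeff[OF L HC as])
qed

lemma Eb_spaceI:
  assumes L: "L > 0" and a: "asum a" "divfree a" "wsum b a"
  shows "fser L a \<in> Eb_space L b"
  using HC_spaceI[OF L a(1,2), of "fser L a"] a(3) fcoeff_fser[OF L a(1)]
  by (simp add: Eb_space_def eq_ae_def wsum_def)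

section \<open>The Taylor recursion for Fourier coefficients\<close>

text \<open>Sums each component of each mode separately, so it can be handled before convergence in
  \<open>Eb_norm\<close> is known.\<close>

definition psum :: "(nat \<Rightarrow> int^2 \<Rightarrow> complex^2) \<Rightarrow> complex \<Rightarrow> int^2 \<Rightarrow> complex^2" where
  "psum a T k = (\<chi> i. \<Sum>n. a n k $ i * T ^ n)"

lemma Eb_weight_ge_1: "b > 0 \<Longrightarrow> Eb_weight b k \<ge> 1"
  by (simp add: Eb_weight_def)

lemma decays_nonneg: "decays b C a \<Longrightarrow> C \<ge> 0"
proof -
  assume "decays b C a"
  hence "norm (a 0) \<le> C / Eb_weight b 0" by (simp add: decays_def)
  hence "0 \<le> C / Eb_weight b 0" using norm_ge_zero order_trans by blast
  hence "0 \<le> C / Eb_weight b 0 * Eb_weight b 0" by (intro mult_nonneg_nonneg) (auto simp: less_imp_le)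
  thus "C \<ge> 0" using Eb_weight_pos[of b 0] by (simp del: Eb_weight_pos)
qed

lemma decaysI_nth:
  assumes "\<And>k i. cmod (a k $ i) \<le> C / Eb_weight b k"
  shows "decays b (2 * C) a"
  unfolding decays_def
proof
  fix k
  have "norm (a k) \<le> (\<Sum>i\<in>UNIV. cmod (a k $ i))" by (rule norm_vec_le_sum)
  also have "\<dots> \<le> (\<Sum>i\<in>(UNIV::2 set). C / Eb_weight b k)" by (intro sum_mono assms)
  finally show "norm (a k) \<le> 2 * C / Eb_weight b k" by simp
qed

lemma bhat_nth: "bhat L a c k $ i = (of_int (k $ 1) * advection L a c k $ 2 - of_int (k $ 2) * advection L a c k $ 1)
    * (kperp k $ i / of_real ((kabs k)\<^sup>2))"
  by (simp add: bhat_def leray_symbol_def kcross_def)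

lemma bhat_0_left: "bhat L (\<lambda>k. 0) c k = 0"
  and bhat_0_right: "bhat L a (\<lambda>k. 0) k = 0"
  by (simp_all add: vec_eq_iff bhat_nth advection_def)

text \<open>Substituting \<open>-l\<close> for \<open>l\<close> in the convolution conjugates every
  factor, since \<open>dcoef\<close> is imaginary and odd; in the projection two odd factors in
  \<open>k\<close> multiply to an even one.\<close>

lemma herm_bhat:
  assumes a: "herm a" and c: "herm c"
  shows "herm (bhat L a c)"
proof -
  have adv: "advection L a c (- k) $ m = cnj (advection L a c k $ m)" for k m
  proof -
    define f where "f k l = (\<Sum>j\<in>UNIV. a (k - l) $ j * dcoef L l j) * c l $ m" for k l
    have "f (- k) (- l) = cnj (f k l)" for l
    proof -
      have "a (l - k) $ j = cnj (a (k - l) $ j)" for j using a unfolding herm_def by (metis minus_diff_eq)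
      moreover have "dcoef L (- l) j = cnj (dcoef L l j)" for j by (simp add: dcoef_def)
      ultimately show ?thesis using c by (simp add: f_def herm_def)
    qed
    hence "(\<Sum>\<^sub>\<infinity>l. f (- k) (- l)) = cnj (\<Sum>\<^sub>\<infinity>l. f k l)" by (simp add: infsum_cnj)
    moreover have "(\<Sum>\<^sub>\<infinity>l. f (- k) (- l)) = (\<Sum>\<^sub>\<infinity>l. f (- k) l)"
      by (rule infsum_reindex_bij_betw[OF bij_uminus])
    ultimately show ?thesis by (simp add: advection_def f_def)
  qed
  have "kperp (- k) $ i = - kperp k $ i" "cnj (kperp k $ i) = kperp k $ i" for k i
    using exhaust_2[of i] by (auto simp: kperp_def)
  moreover have "kabs (- k) = kabs k" for k by (simp add: kabs_def)
  ultimately show ?thesis by (simp add: herm_def bhat_nth adv algebra_simps)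
qed

context
  fixes L b C :: real and a :: "nat \<Rightarrow> int^2 \<Rightarrow> complex^2"
  assumes b: "b > 0" and dec: "\<And>n. decays b C (a n)"
begin

lemma coeff_le: "cmod (a n k $ i) \<le> C / Eb_weight b k"
  using dec[of n] Finite_Cartesian_Product.norm_nth_le[of "a n k" i] order_trans unfolding decays_def by blast

lemma psum_sums:
  assumes "norm T < 1"
  shows "(\<lambda>n. a n k $ i * T ^ n) sums psum a T k $ i"
proof -
  have "summable (\<lambda>n. a n k $ i * T ^ n)"
  proof (rule summable_comparison_test')
    show "summable (\<lambda>n. C / Eb_weight b k * norm T ^ n)"
      by (intro summable_mult summable_geometric) (use assms in simp)
    show "norm (a n k $ i * T ^ n) \<le> C / Eb_weight b k * norm T ^ n" for n
      unfolding norm_mult norm_power by (intro mult_right_mono coeff_le) auto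
  qed
  thus ?thesis by (simp add: psum_def summable_sums)
qed

lemma psum_decays:
  assumes "norm T < 1"
  shows "decays b (2 * (C / (1 - norm T))) (psum a T)"
proof (rule decaysI_nth)
  fix k i
  have "(\<lambda>n. C / Eb_weight b k * norm T ^ n) sums (C / Eb_weight b k * (1 / (1 - norm T)))"
    by (intro sums_mult geometric_sums) (use assms in simp)
  moreover have "norm (a n k $ i * T ^ n) \<le> C / Eb_weight b k * norm T ^ n" for n
    unfolding norm_mult norm_power by (intro mult_right_mono coeff_le) auto
  ultimately have "norm (psum a T k $ i) \<le> C / Eb_weight b k * (1 / (1 - norm T))"
    using psum_sums[OF assms, of k i] by (metis (no_types, lifting) norm_suminf_le sums_iff)
  thus "cmod (psum a T k $ i) \<le> C / (1 - norm T) / Eb_weight b k" by (simp add: mult.commute)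
qed

lemma psum_divfree:
  assumes T: "norm T < 1" and d: "\<And>n. divfree (a n)"
  shows "divfree (psum a T)"
proof -
  have "kdot k (psum a T k) = 0" for k
  proof -
    have "(\<lambda>n. of_int (k $ 1) * (a n k $ 1 * T ^ n) + of_int (k $ 2) * (a n k $ 2 * T ^ n)) sums kdot k (psum a T k)"
      unfolding kdot_def by (intro sums_add sums_mult psum_sums T)
    also have "(\<lambda>n. of_int (k $ 1) * (a n k $ 1 * T ^ n) + of_int (k $ 2) * (a n k $ 2 * T ^ n)) = (\<lambda>n. kdot k (a n k) * T ^ n)"
      by (simp add: kdot_def algebra_simps)
    finally have "(\<lambda>n. 0) sums kdot k (psum a T k)" using d by (simp add: divfree_def)
    thus ?thesis using sums_unique2 sums_zero by blast
  qed
  moreover have "psum a T 0 = 0" using d by (simp add: psum_def divfree_def vec_eq_iff)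
  ultimately show ?thesis by (simp add: divfree_def)
qed

lemma psum_herm:
  assumes T: "\<bar>T\<bar> < 1" and h: "\<And>n. herm (a n)"
  shows "herm (psum a (of_real T))"
  unfolding herm_def
proof (intro allI)
  fix k i
  have n: "norm (complex_of_real T) < 1" using T by simp
  have "(\<lambda>n. cnj (a n k $ i * of_real T ^ n)) sums cnj (psum a (of_real T) k $ i)"
    using psum_sums[OF n] by (simp only: sums_cnj)
  hence "(\<lambda>n. a n (- k) $ i * of_real T ^ n) sums cnj (psum a (of_real T) k $ i)"
    using h by (simp add: herm_def)
  thus "psum a (of_real T) (- k) $ i = cnj (psum a (of_real T) k $ i)"
    using psum_sums[OF n] sums_unique2 by blast
qed

text \<open>The interchange lemma with the derivative multiplier as weight \<open>q\<close> and the
  uniform decay of the Taylor coefficients as majorants.\<close>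

lemma advection_sums:
  assumes T: "norm T < 1"
  shows "(\<lambda>n. (\<Sum>h\<le>n. advection L (a h) (a (n - h)) k $ m) * T ^ n) sums advection L (psum a T) (psum a T) k $ m"
proof -
  have j: "(\<lambda>n. (\<Sum>h\<le>n. \<Sum>\<^sub>\<infinity>l. dcoef L l j * (a h (k - l) $ j * a (n - h) l $ m)) * T ^ n) sums
      (\<Sum>\<^sub>\<infinity>l. dcoef L l j * (psum a T (k - l) $ j * psum a T l $ m))" for j
  proof (rule powser_convolution_sums[where X = "\<lambda>l. C / Eb_weight b (k - l)" and Y = "\<lambda>l. C / Eb_weight b l"])
    have C: "C \<ge> 0" by (rule decays_nonneg[OF dec])
    show "(\<lambda>l. cmod (dcoef L l j) * (C / Eb_weight b (k - l) * (C / Eb_weight b l))) summable_on UNIV"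
    proof (rule summable_on_comparison_test)
      show "(\<lambda>l. \<bar>kappa0 L\<bar> * C * C * ((kabs l + 1)\<^sup>2 / Eb_weight b l)) summable_on UNIV"
        by (rule summable_on_cmult_right[OF summable_on_Eb_weight[OF b]])
      fix l
      have 1: "cmod (dcoef L l j) \<le> \<bar>kappa0 L\<bar> * (kabs l + 1)\<^sup>2"
        using order_trans[OF abs_nth_le_kabs[of l j] kabs_le_sq[of l]]
        by (simp add: dcoef_def norm_mult mult_left_mono)
      \<comment> \<open>The decay of the first factor is given up entirely; that of the second alone
        absorbs the derivative and makes the sum over \<open>l\<close> converge.\<close>
      have 2: "C / Eb_weight b (k - l) \<le> C"
        using C Eb_weight_ge_1[OF b, of "k - l"] by (simp add: pos_divide_le_eq mult_le_cancel_left1)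
      have "cmod (dcoef L l j) * (C / Eb_weight b (k - l) * (C / Eb_weight b l)) \<le> (\<bar>kappa0 L\<bar> * (kabs l + 1)\<^sup>2) * (C * (C / Eb_weight b l))"
        using C by (intro mult_mono[OF 1] mult_right_mono[OF 2]) (auto simp: less_imp_le)
      thus "cmod (dcoef L l j) * (C / Eb_weight b (k - l) * (C / Eb_weight b l)) \<le> \<bar>kappa0 L\<bar> * C * C * ((kabs l + 1)\<^sup>2 / Eb_weight b l)"
        by (simp add: mult_ac)
    qed (use C in \<open>auto simp: less_imp_le\<close>)
  qed (use T in \<open>auto intro!: coeff_le psum_sums\<close>)
  have e1: "advection L (a h) (a n) k $ m = (\<Sum>j\<in>UNIV. \<Sum>\<^sub>\<infinity>l. dcoef L l j * (a h (k - l) $ j * a n l $ m))" for h n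
    using advection_nth[OF decays_asum[OF b dec] decays_asum_dcoef[OF b dec], of L h n k m] by (simp add: mult_ac)
  have e2: "advection L (psum a T) (psum a T) k $ m = (\<Sum>j\<in>UNIV. \<Sum>\<^sub>\<infinity>l. dcoef L l j * (psum a T (k - l) $ j * psum a T l $ m))"
    using advection_nth[OF decays_asum[OF b psum_decays[OF T]] decays_asum_dcoef[OF b psum_decays[OF T]], of L k m] by (simp add: mult_ac)
  have "(\<lambda>n. \<Sum>j\<in>UNIV. (\<Sum>h\<le>n. \<Sum>\<^sub>\<infinity>l. dcoef L l j * (a h (k - l) $ j * a (n - h) l $ m)) * T ^ n) sums
      (\<Sum>j\<in>UNIV. \<Sum>\<^sub>\<infinity>l. dcoef L l j * (psum a T (k - l) $ j * psum a T l $ m))"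
    by (intro sums_sum j)
  moreover have "(\<Sum>j\<in>UNIV. (\<Sum>h\<le>n. \<Sum>\<^sub>\<infinity>l. dcoef L l j * (a h (k - l) $ j * a (n - h) l $ m)) * T ^ n)
      = (\<Sum>h\<le>n. advection L (a h) (a (n - h)) k $ m) * T ^ n" for n
    unfolding e1 sum_distrib_right[symmetric] by (subst sum.swap) simp
  ultimately show ?thesis unfolding e2 by simp
qed

lemma bhat_sums:
  assumes T: "norm T < 1"
  shows "(\<lambda>n. (\<Sum>h\<le>n. bhat L (a h) (a (n - h)) k $ i) * T ^ n) sums bhat L (psum a T) (psum a T) k $ i"
proof -
  define z where "z = kperp k $ i / of_real ((kabs k)\<^sup>2)"
  define A where "A m h n = advection L (a h) (a n) k $ m" for m h n
  have "(\<lambda>n. (of_int (k $ 1) * ((\<Sum>h\<le>n. A 2 h (n - h)) * T ^ n) - of_int (k $ 2) * ((\<Sum>h\<le>n. A 1 h (n - h)) * T ^ n)) * z) sums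
      ((of_int (k $ 1) * advection L (psum a T) (psum a T) k $ 2 - of_int (k $ 2) * advection L (psum a T) (psum a T) k $ 1) * z)"
    unfolding A_def by (intro sums_mult2 sums_diff sums_mult advection_sums T)
  moreover have "(of_int (k $ 1) * ((\<Sum>h\<le>n. A 2 h (n - h)) * T ^ n) - of_int (k $ 2) * ((\<Sum>h\<le>n. A 1 h (n - h)) * T ^ n)) * z
      = (\<Sum>h\<le>n. (of_int (k $ 1) * A 2 h (n - h) - of_int (k $ 2) * A 1 h (n - h)) * z) * T ^ n" for n
    by (simp add: sum_subtractf sum_distrib_left sum_distrib_right left_diff_distrib right_diff_distrib mult_ac)
  ultimately show ?thesis unfolding bhat_nth A_def z_def by simp
qed

text \<open>The index \<open>n - 1\<close> is truncated at \<open>n = 0\<close>; the term it produces vanishes because \<open>a 0 = 0\<close>.\<close>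

lemma powser_deriv_sums:
  assumes a0: "\<And>k. a 0 k = 0" and T: "norm T < 1"
    and D: "((\<lambda>T. psum a T k $ i) has_field_derivative D) (at T)"
  shows "(\<lambda>n. (of_nat (n + 1) * a (n + 1) k $ i - (of_nat n - 1) * a (n - 1) k $ i) * T ^ n) sums ((1 - T\<^sup>2) * D)"
proof -
  define c where "c n = a n k $ i" for n
  \<comment> \<open>The series of \<open>T^2\<close> times the derivative, obtained by shifting the
    differentiated series by two places. At \<open>n = 1\<close> the factor
    \<open>of_nat n - 1\<close> vanishes.\<close>
  define e where "e n = (of_nat n - 1) * c (n - 1) * T ^ n" for n
  have 1: "(\<lambda>n. diffs c n * T ^ n) sums D"
    by (rule termdiffs_sums_strong[OF _ D T]) (unfold c_def, rule psum_sums)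
  have "e (Suc (Suc n)) = T\<^sup>2 * (diffs c n * T ^ n)" for n
    by (simp add: e_def diffs_def power2_eq_square mult_ac)
  hence "(\<lambda>n. e (Suc (Suc n))) sums (T\<^sup>2 * D)" using sums_mult[OF 1, of "T\<^sup>2"] by simp
  hence "(\<lambda>n. e (Suc n)) sums (T\<^sup>2 * D + e (Suc 0))" by (subst (asm) sums_Suc_iff)
  hence "(\<lambda>n. e (Suc n)) sums (T\<^sup>2 * D)" by (simp add: e_def)
  hence "e sums (T\<^sup>2 * D + e 0)" by (subst (asm) sums_Suc_iff)
  hence 2: "e sums (T\<^sup>2 * D)" using a0 by (simp add: e_def c_def)
  have "(\<lambda>n. diffs c n * T ^ n - e n) sums (D - T\<^sup>2 * D)" by (rule sums_diff[OF 1 2])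
  thus ?thesis by (simp add: e_def diffs_def c_def algebra_simps)
qed

end

text \<open>The full right-hand side of the evolution equation in mode \<open>k\<close>; the
  convolution runs over all modes, so no Galerkin truncation takes place.\<close>

definition galerkin_rhs :: "real \<Rightarrow> real \<Rightarrow> (int^2 \<Rightarrow> complex^2) \<Rightarrow> (int^2 \<Rightarrow> complex^2) \<Rightarrow> int^2 \<Rightarrow> complex^2" where
  "galerkin_rhs L \<nu> g a k = g k - of_real (\<nu> * lam L k) *s a k - bhat L a a k"

text \<open>One formula, cleared of the denominator \<open>n + 1\<close>, for all three
  prescriptions of the recursion: \<open>n = 0\<close> gives \<open>U_1\<close>, where the constant
  force enters, and \<open>n = 1\<close> gives \<open>U_2\<close>. When \<open>a 0\<close> vanishes,
  so do the end terms of the sum over \<open>h\<close>, and it reduces to positive indices.\<close>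

definition coeff_recursion :: "real \<Rightarrow> real \<Rightarrow> real \<Rightarrow> (int^2 \<Rightarrow> complex^2) \<Rightarrow> (nat \<Rightarrow> int^2 \<Rightarrow> complex^2) \<Rightarrow> bool" where
  "coeff_recursion L \<nu> \<delta>0 g a \<longleftrightarrow> (\<forall>n k i.
     of_nat (n + 1) * a (n + 1) k $ i - (of_nat n - 1) * a (n - 1) k $ i =
     of_real \<delta>0 * ((if n = 0 then g k $ i else 0) - of_real (\<nu> * lam L k) * a n k $ i
       - (\<Sum>h\<le>n. bhat L (a h) (a (n - h)) k $ i)))"

context
  fixes L b C \<nu> \<delta>0 :: real and a :: "nat \<Rightarrow> int^2 \<Rightarrow> complex^2" and g :: "int^2 \<Rightarrow> complex^2"
  assumes b: "b > 0" and dec: "\<And>n. decays b C (a n)" and a0: "\<And>k. a 0 k = 0"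
begin

lemma galerkin_rhs_sums:
  assumes T: "norm T < 1"
  shows "(\<lambda>n. of_real \<delta>0 * ((if n = 0 then g k $ i else 0) - of_real (\<nu> * lam L k) * a n k $ i
       - (\<Sum>h\<le>n. bhat L (a h) (a (n - h)) k $ i)) * T ^ n) sums (of_real \<delta>0 * galerkin_rhs L \<nu> g (psum a T) k $ i)"
proof -
  have g: "(\<lambda>n. if n = 0 then g k $ i else 0) sums (g k $ i)"
    using sums_single[of 0 "\<lambda>_. g k $ i"] by simp
  have "(\<lambda>n. of_real \<delta>0 * ((if n = 0 then g k $ i else 0) - of_real (\<nu> * lam L k) * (a n k $ i * T ^ n)
       - (\<Sum>h\<le>n. bhat L (a h) (a (n - h)) k $ i) * T ^ n)) sums (of_real \<delta>0 * galerkin_rhs L \<nu> g (psum a T) k $ i)"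
    unfolding galerkin_rhs_def vector_minus_component vector_smult_component
    by (intro sums_mult sums_diff g psum_sums[OF b dec T] bhat_sums[OF b dec T])
  moreover have "of_real \<delta>0 * ((if n = 0 then g k $ i else 0) - of_real (\<nu> * lam L k) * (a n k $ i * T ^ n)
       - (\<Sum>h\<le>n. bhat L (a h) (a (n - h)) k $ i) * T ^ n) =
      of_real \<delta>0 * ((if n = 0 then g k $ i else 0) - of_real (\<nu> * lam L k) * a n k $ i
       - (\<Sum>h\<le>n. bhat L (a h) (a (n - h)) k $ i)) * T ^ n" for n
    by (cases "n = 0") (simp_all add: algebra_simps)
  ultimately show ?thesis by (simp only:)
qed

lemma coeff_recursion_imp_ode:
  assumes rec: "coeff_recursion L \<nu> \<delta>0 g a" and T: "norm T < 1"
    and D: "((\<lambda>T. psum a T k $ i) has_field_derivative D) (at T)"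
  shows "(1 - T\<^sup>2) * D = of_real \<delta>0 * galerkin_rhs L \<nu> g (psum a T) k $ i"
  using powser_deriv_sums[OF b dec a0 T D] galerkin_rhs_sums[OF T, of k i] rec sums_unique2
  unfolding coeff_recursion_def by simp

lemma psum_holomorphic: "(\<lambda>T. psum a T k $ i) holomorphic_on ball 0 1"
  by (rule power_series_holomorphic[where a = "\<lambda>n. a n k $ i"]) (use psum_sums[OF b dec] in auto)

lemma psum_has_deriv:
  "norm T < 1 \<Longrightarrow> ((\<lambda>T. psum a T k $ i) has_field_derivative deriv (\<lambda>T. psum a T k $ i) T) (at T)"
  by (rule holomorphic_derivI[OF psum_holomorphic]) auto

text \<open>Both sides are power series on the disc, so equality at real \<open>T\<close> already
  identifies their coefficients.\<close>

lemma ode_imp_coeff_recursion: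
  assumes ode: "\<And>T k i. \<bar>T\<bar> < 1 \<Longrightarrow>
    (1 - (of_real T)\<^sup>2) * deriv (\<lambda>T. psum a T k $ i) (of_real T) = of_real \<delta>0 * galerkin_rhs L \<nu> g (psum a (of_real T)) k $ i"
  shows "coeff_recursion L \<nu> \<delta>0 g a"
  unfolding coeff_recursion_def
  by (intro allI, rule powser_eq_real[OF powser_deriv_sums[OF b dec a0 _ psum_has_deriv] galerkin_rhs_sums ode]) auto

end

text \<open>Every scalar in the recursion is real and B preserves real fields. This places the
  reconstructed solution in H itself and not only in its complexification.\<close>

lemma coeff_recursion_herm:
  assumes a0: "\<And>k. a 0 k = 0" and g: "herm g" and rec: "coeff_recursion L \<nu> \<delta>0 g a"
  shows "herm (a n)"
proof (induction n rule: less_induct)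
  case (less n)
  show ?case
  proof (cases n)
    case 0
    thus ?thesis using a0 by (simp add: herm_def)
  next
    case (Suc m)
    have h: "herm (a j)" if "j \<le> m" for j using less Suc that by simp
    have eq: "of_nat (Suc m) * a (Suc m) k $ i = (of_nat m - 1) * a (m - 1) k $ i +
        of_real \<delta>0 * ((if m = 0 then g k $ i else 0) - of_real (\<nu> * lam L k) * a m k $ i
       - (\<Sum>h\<le>m. bhat L (a h) (a (m - h)) k $ i))" for k i
      using rec[unfolded coeff_recursion_def, rule_format, of m k i] by (simp add: algebra_simps)
    have l: "lam L (- k) = lam L k" for k by (simp add: lam_def kabs_def)
    have hb: "bhat L (a j) (a (m - j)) (- k) $ i = cnj (bhat L (a j) (a (m - j)) k $ i)" if "j \<le> m" for j k i
      using herm_bhat[OF h h, of j "m - j" L] that by (simp add: herm_def)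
    have "of_nat (Suc m) * a (Suc m) (- k) $ i = cnj (of_nat (Suc m) * a (Suc m) k $ i)" for k i
      unfolding eq using h[of "m - 1"] h[of m] g hb by (simp add: herm_def l cnj_sum)
    hence "a (Suc m) (- k) $ i = cnj (a (Suc m) k $ i)" for k i
      by (simp del: of_nat_Suc add: mult_cancel_left)
    thus ?thesis by (simp add: herm_def Suc)
  qed
qed

section \<open>The conformal map between strip and disc\<close>

definition tau :: "real \<Rightarrow> complex \<Rightarrow> complex" where
  "tau \<delta> z = (exp (of_real (pi / (2 * \<delta>)) * z) - 1) / (exp (of_real (pi / (2 * \<delta>)) * z) + 1)"

text \<open>The inverse of \<open>tau\<close>, by the principal branch. \<open>tau\<close> pulls a
  series on the disc back to the strip; \<open>zeta\<close> carries a solution on the strip to the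
  disc.\<close>

definition zeta :: "real \<Rightarrow> complex \<Rightarrow> complex" where
  "zeta \<delta> T = of_real (2 * \<delta> / pi) * Ln ((1 + T) / (1 - T))"

text \<open>The exponential maps the strip into the right half-plane, and the Moebius factor of
  \<open>tau\<close> maps that half-plane into the unit disc.\<close>

lemma Re_exp_strip:
  assumes \<delta>: "\<delta> > 0" and z: "z \<in> strip \<delta>"
  shows "Re (exp (of_real (pi / (2 * \<delta>)) * z)) > 0"
proof -
  have "\<bar>pi / (2 * \<delta>) * Im z\<bar> < pi / 2"
    using z \<delta> by (simp add: strip_def abs_mult field_simps)
  hence "- (pi / 2) < pi / (2 * \<delta>) * Im z" "pi / (2 * \<delta>) * Im z < pi / 2" by linarith+
  hence "cos (pi / (2 * \<delta>) * Im z) > 0" by (rule cos_gt_zero_pi)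
  thus ?thesis by (simp add: Re_exp)
qed

lemma norm_tau_less_1:
  assumes "\<delta> > 0" "z \<in> strip \<delta>"
  shows "norm (tau \<delta> z) < 1"
proof -
  define E where "E = exp (of_real (pi / (2 * \<delta>)) * z)"
  have R: "Re E > 0" unfolding E_def by (rule Re_exp_strip[OF assms])
  have "(cmod (E - 1))\<^sup>2 < (cmod (E + 1))\<^sup>2"
    unfolding cmod_power2 using R by (simp add: power2_eq_square algebra_simps)
  hence lt: "cmod (E - 1) < cmod (E + 1)" by (rule power2_less_imp_less) simp
  moreover have "cmod (E + 1) > 0" by (rule le_less_trans[OF norm_ge_zero lt])
  ultimately show ?thesis unfolding tau_def E_def[symmetric] by (simp add: norm_divide)
qed

text \<open>The derivative of the hyperbolic tangent is one minus its square. The remaining factor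
  is the reciprocal of \<open>4 * \<delta> / pi\<close>, which is where \<open>\<delta>0\<close>
  originates.\<close>

lemma tau_has_deriv:
  assumes "\<delta> > 0" "z \<in> strip \<delta>"
  shows "(tau \<delta> has_field_derivative (1 - (tau \<delta> z)\<^sup>2) * of_real (pi / (4 * \<delta>))) (at z)"
proof -
  define c where "c = complex_of_real (pi / (2 * \<delta>))"
  have "Re (exp (c * z)) > 0" unfolding c_def by (rule Re_exp_strip[OF assms])
  hence nz: "exp (c * z) + 1 \<noteq> 0" by (auto simp: complex_eq_iff)
  have "((\<lambda>z. (exp (c * z) - 1) / (exp (c * z) + 1)) has_field_derivative
      ((exp (c * z) * c) * (exp (c * z) + 1) - (exp (c * z) - 1) * (exp (c * z) * c)) / ((exp (c * z) + 1) * (exp (c * z) + 1))) (at z)"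
    using nz by (auto intro!: derivative_eq_intros)
  moreover have "((exp (c * z) * c) * (exp (c * z) + 1) - (exp (c * z) - 1) * (exp (c * z) * c)) / ((exp (c * z) + 1) * (exp (c * z) + 1))
      = (1 - ((exp (c * z) - 1) / (exp (c * z) + 1))\<^sup>2) * (c / 2)"
  proof -
    define e where "e = exp (c * z)"
    define q where "q = (e - 1) / (e + 1)"
    have e: "e + 1 \<noteq> 0" using nz by (simp add: e_def)
    hence q: "q * (e + 1) = e - 1" by (simp add: q_def)
    have "(1 - q\<^sup>2) * ((e + 1) * (e + 1)) = 4 * e" using q by algebra
    hence "(1 - q\<^sup>2) * (c / 2) * ((e + 1) * (e + 1)) = (e * c) * (e + 1) - (e - 1) * (e * c)" by algebra
    hence "((e * c) * (e + 1) - (e - 1) * (e * c)) / ((e + 1) * (e + 1)) = (1 - q\<^sup>2) * (c / 2)"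
      using e by (simp add: divide_eq_eq)
    thus ?thesis by (simp only: e_def q_def)
  qed
  moreover have "c / 2 = of_real (pi / (4 * \<delta>))" by (simp add: c_def)
  ultimately show ?thesis unfolding tau_def[abs_def] c_def by simp
qed

lemma tau_of_real: "\<exists>r. tau \<delta> (of_real t) = of_real r"
  by (intro exI[of _ "(exp (pi / (2 * \<delta>) * t) - 1) / (exp (pi / (2 * \<delta>) * t) + 1)"])
     (simp add: tau_def exp_of_real[symmetric])

lemma tau_0: "tau \<delta> 0 = 0"
  by (simp add: tau_def)

lemma Re_moebius_pos:
  assumes "norm T < 1"
  shows "Re ((1 + T) / (1 - T)) > 0"
proof -
  have ne: "T \<noteq> 1" using assms by auto
  have "(Re T)\<^sup>2 + (Im T)\<^sup>2 < 1" using assms by (simp add: cmod_power2[symmetric] power_less_one_iff)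
  hence "0 < Re (1 + T) * Re (1 - T) + Im (1 + T) * Im (1 - T)"
    by (simp add: power2_eq_square algebra_simps)
  moreover have "0 < (Re (1 - T))\<^sup>2 + (Im (1 - T))\<^sup>2"
    using ne by (auto simp: sum_power2_gt_zero_iff complex_eq_iff)
  ultimately show ?thesis unfolding Re_divide by (rule divide_pos_pos)
qed

lemma zeta_in_strip:
  assumes \<delta>: "\<delta> > 0" and T: "norm T < 1"
  shows "zeta \<delta> T \<in> strip \<delta>"
proof -
  define w where "w = (1 + T) / (1 - T)"
  have R: "Re w > 0" unfolding w_def by (rule Re_moebius_pos[OF T])
  hence "w \<noteq> 0" by auto
  hence "\<bar>Im (Ln w)\<bar> < pi / 2" using R Re_Ln_pos_lt[of w] by simp
  hence "2 * \<delta> / pi * \<bar>Im (Ln w)\<bar> < 2 * \<delta> / pi * (pi / 2)" using \<delta> by (intro mult_strict_left_mono) auto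
  thus ?thesis using \<delta> by (simp add: strip_def zeta_def w_def[symmetric] abs_mult)
qed

lemma zeta_has_deriv:
  assumes \<delta>: "\<delta> > 0" and T: "norm T < 1"
  shows "(zeta \<delta> has_field_derivative of_real (4 * \<delta> / pi) / (1 - T\<^sup>2)) (at T)"
proof -
  have R: "Re ((1 + T) / (1 - T)) > 0" by (rule Re_moebius_pos[OF T])
  hence np: "(1 + T) / (1 - T) \<notin> \<real>\<^sub>\<le>\<^sub>0" by (auto simp: complex_nonpos_Reals_iff)
  have ne: "1 - T \<noteq> 0" "1 + T \<noteq> 0" using T R by auto
  have "((\<lambda>T. Ln ((1 + T) / (1 - T))) has_field_derivative
     ((1 * (1 - T) - (1 + T) * (- 1)) / ((1 - T) * (1 - T))) / ((1 + T) / (1 - T))) (at T)"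
    using np ne by (auto intro!: derivative_eq_intros simp: mult_ac)
  moreover have "((1 * (1 - T) - (1 + T) * (- 1)) / ((1 - T) * (1 - T))) / ((1 + T) / (1 - T)) = 2 / (1 - T\<^sup>2)"
  proof -
    have "1 - T\<^sup>2 = (1 - T) * (1 + T)" by (simp add: algebra_simps power2_eq_square)
    moreover have "1 * (1 - T) - (1 + T) * (- 1) = 2" by simp
    ultimately show ?thesis using ne by (simp only:) (simp add: divide_simps)
  qed
  ultimately have "((\<lambda>T. Ln ((1 + T) / (1 - T))) has_field_derivative 2 / (1 - T\<^sup>2)) (at T)" by simp
  from DERIV_cmult[OF this, of "of_real (2 * \<delta> / pi)"] show ?thesis
    unfolding zeta_def[abs_def] by simp
qed

lemma zeta_of_real:
  assumes "\<bar>T\<bar> < 1"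
  shows "\<exists>r. zeta \<delta> (of_real T) = of_real r"
proof -
  have "(1 + T) / (1 - T) > 0" using assms by auto
  hence "Ln (of_real ((1 + T) / (1 - T))) = of_real (ln ((1 + T) / (1 - T)))" by (rule Ln_of_real)
  hence "zeta \<delta> (of_real T) = of_real (2 * \<delta> / pi * ln ((1 + T) / (1 - T)))"
    by (simp add: zeta_def)
  thus ?thesis by blast
qed

lemma zeta_0: "zeta \<delta> 0 = 0"
  by (simp add: zeta_def)

lemma open_strip: "open (strip \<delta>)"
  unfolding strip_def by (intro open_Collect_less continuous_intros)

lemma of_real_in_strip: "\<delta> > 0 \<Longrightarrow> of_real t \<in> strip \<delta>"
  by (simp add: strip_def)

text \<open>Both are instances of the bounds on the unit disc: the coefficient of order 1, and the
  remainder after two terms. For \<open>norm h\<close> at most \<open>r / 2\<close> the geometric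
  factor is at most 2.\<close>

lemma holomorphic_first_order_bounds:
  assumes hol: "f holomorphic_on ball z r" and r: "r > 0"
    and M: "\<And>w. w \<in> ball z r \<Longrightarrow> cmod (f w) \<le> M"
  shows "cmod (deriv f z) \<le> M / r"
    and "norm h \<le> r / 2 \<Longrightarrow> cmod (f (z + h) - f z - h * deriv f z) \<le> 2 * M * (norm h)\<^sup>2 / r\<^sup>2"
proof -
  \<comment> \<open>Taylor coefficients after rescaling the disc around \<open>z\<close> to the unit
    disc.\<close>
  define c where "c n = (deriv ^^ n) f z / fact n * of_real r ^ n" for n
  define F where "F T = f (z + of_real r * T)" for T
  have inb: "z + of_real r * T \<in> ball z r" if "norm T < 1" for T
    using that r by (simp add: dist_norm norm_mult)
  have c: "(\<lambda>n. c n * T ^ n) sums F T" if T: "norm T < 1" for T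
    using holomorphic_power_series[OF hol inb[OF T]] by (simp add: c_def F_def power_mult_distrib mult.assoc)
  have M': "cmod (F T) \<le> M" if "norm T < 1" for T unfolding F_def by (rule M[OF inb[OF that]])
  have "cmod (c 1) \<le> M" by (rule powser_coeff_bound[OF c M'])
  thus "cmod (deriv f z) \<le> M / r" using r by (simp add: c_def norm_mult field_simps)
  assume h: "norm h \<le> r / 2"
  define T where "T = h / of_real r"
  have nT: "norm T = norm h / r" using r by (simp add: T_def norm_divide)
  hence T2: "norm T \<le> 1 / 2" using divide_right_mono[OF h, of r] r by simp
  have M0: "M \<ge> 0" using order_trans[OF norm_ge_zero M[of z]] r by simp
  have "cmod (F T - (\<Sum>n<2. c n * T ^ n)) \<le> M * norm T ^ 2 / (1 - norm T)"
    by (rule powser_remainder_bound[OF c M']) (use T2 in auto)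
  also have "\<dots> \<le> M * norm T ^ 2 / (1 / 2)"
    using T2 M0 by (intro divide_left_mono) auto
  also have "\<dots> = 2 * M * (norm h)\<^sup>2 / r\<^sup>2" by (simp add: nT power_divide)
  also have "F T - (\<Sum>n<2. c n * T ^ n) = f (z + h) - f z - h * deriv f z"
    using r by (simp add: F_def T_def c_def numeral_2_eq_2)
  finally show "cmod (f (z + h) - f z - h * deriv f z) \<le> 2 * M * (norm h)\<^sup>2 / r\<^sup>2" .
qed

section \<open>Almost-everywhere equality and finite sums of fields\<close>

lemma eq_ae_trans: "eq_ae L u v \<Longrightarrow> eq_ae L v w \<Longrightarrow> eq_ae L u w"
  unfolding eq_ae_def by (elim AE_mp) auto

lemma eq_ae_sym: "eq_ae L u v \<Longrightarrow> eq_ae L v u"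
  by (simp add: eq_ae_def eq_commute)

lemma l2_zero: "(\<lambda>x. 0) \<in> l2_space L"
  by (simp add: l2_space_def)

lemma l2_sum: "(\<And>n. n \<in> I \<Longrightarrow> u n \<in> l2_space L) \<Longrightarrow> (\<lambda>x. \<Sum>n\<in>I. u n x) \<in> l2_space L"
proof (induction I rule: infinite_finite_induct)
  case (insert n I)
  thus ?case by (simp add: l2_add)
qed (auto simp: l2_zero)

lemma fcoeff_sum:
  "(\<And>n. n \<in> I \<Longrightarrow> u n \<in> l2_space L) \<Longrightarrow> fcoeff L (\<lambda>x. \<Sum>n\<in>I. u n x) k = (\<Sum>n\<in>I. fcoeff L (u n) k)"
proof (induction I rule: infinite_finite_induct)
  case (insert n I)
  thus ?case by (simp add: fcoeff_add l2_sum)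
qed (auto simp: fcoeff_zero)

lemma fcoeff_scaleR: "u \<in> l2_space L \<Longrightarrow> fcoeff L (\<lambda>x. r *\<^sub>R u x) k = r *\<^sub>R fcoeff L u k"
  unfolding scaleR_eq_smult by (rule fcoeff_smult)

lemma l2_scaleR: "u \<in> l2_space L \<Longrightarrow> (\<lambda>x. r *\<^sub>R u x) \<in> l2_space L"
  unfolding scaleR_eq_smult by (rule l2_smult)

section \<open>From the series to the solution\<close>

lemma kdot_diff: "kdot k (u - v) = kdot k u - kdot k v"
  by (simp add: kdot_def algebra_simps)

lemma strip_ball_subset: "ball (of_real t) \<delta> \<subseteq> strip \<delta>"
proof
  fix z assume "z \<in> ball (complex_of_real t) \<delta>"
  hence "cmod (of_real t - z) < \<delta>" by (simp add: dist_norm)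
  moreover have "\<bar>Im (of_real t - z)\<bar> \<le> cmod (of_real t - z)" by (rule abs_Im_le_cmod)
  ultimately show "z \<in> strip \<delta>" by (simp add: strip_def)
qed

text \<open>The pair sum of the recursion has \<open>U_k\<close> in the transporting slot, hence the
  witness \<open>(n - h, h)\<close>. The end terms added on the right vanish with
  \<open>a 0\<close>.\<close>

lemma sum_bhat_pairs:
  fixes a :: "nat \<Rightarrow> int^2 \<Rightarrow> complex^2"
  assumes a0: "\<And>k. a 0 k = 0"
  shows "(\<Sum>(h, m)\<in>{(h, m). h + m = n \<and> h \<ge> 1 \<and> m \<ge> 1}. bhat L (a m) (a h) k) = (\<Sum>h\<le>n. bhat L (a h) (a (n - h)) k)"
proof -
  have a0': "a 0 = (\<lambda>k. 0)" using a0 by auto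
  have "(\<Sum>h\<le>n. bhat L (a h) (a (n - h)) k) = (\<Sum>h\<in>{1..n-1}. bhat L (a h) (a (n - h)) k)"
  proof (rule sum.mono_neutral_right)
    show "\<forall>h\<in>{..n} - {1..n - 1}. bhat L (a h) (a (n - h)) k = 0"
    proof
      fix h assume "h \<in> {..n} - {1..n - 1}"
      hence "h = 0 \<or> n - h = 0" by auto
      thus "bhat L (a h) (a (n - h)) k = 0" by (auto simp: a0' bhat_0_left bhat_0_right)
    qed
  qed auto
  also have "\<dots> = (\<Sum>(h, m)\<in>{(h, m). h + m = n \<and> h \<ge> 1 \<and> m \<ge> 1}. bhat L (a m) (a h) k)"
    by (rule sum.reindex_bij_witness[where i = snd and j = "\<lambda>h. (n - h, h)"]) auto
  finally show ?thesis ..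
qed

text \<open>The values of A and B in the recursion are given only as witnesses of graph relations;
  their coefficients are nevertheless forced by \<open>stokes_fcoeff\<close> and
  \<open>bilin_fcoeff\<close>.\<close>

lemma taylor_recursion_imp_coeff_recursion:
  assumes L: "L > 0" and g: "g \<in> H_space L" and rec: "taylor_recursion L \<nu> \<delta>0 g U"
    and Ul2: "\<And>n. U n \<in> l2_space L" and Ua: "\<And>n. eq_ae L (U n) (fser L (fcoeff L (U n)))"
    and as: "\<And>n. asum (fcoeff L (U n))"
  shows "coeff_recursion L \<nu> \<delta>0 (fcoeff L g) (\<lambda>n. fcoeff L (U n))"
    and "fcoeff L (U 0) k = 0" and "fcoeff L (U 1) k = \<delta>0 *\<^sub>R fcoeff L g k"
proof -
  define a where "a n = fcoeff L (U n)" for n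
  have gl2: "g \<in> l2_space L" using g by (simp add: H_space_def)
  have a0: "a 0 k = 0" for k
    using rec fcoeff_cong_ae[OF l2_zero, of L "U 0" k] by (simp add: a_def taylor_recursion_def fcoeff_zero)
  have a1: "a 1 k = \<delta>0 *\<^sub>R fcoeff L g k" for k
    using rec fcoeff_cong_ae[OF l2_scaleR[OF gl2], of "U 1" \<delta>0 k] by (simp add: a_def taylor_recursion_def fcoeff_scaleR[OF gl2])
  have a0': "a 0 = (\<lambda>k. 0)" using a0 by auto
  have a2: "a 2 k = (- (\<nu> * \<delta>0\<^sup>2 / 2) * lam L k) *\<^sub>R fcoeff L g k" for k
  proof -
    obtain s where s: "stokes L g s" and U2: "eq_ae L (U 2) (\<lambda>x. (- (\<nu> * \<delta>0\<^sup>2 / 2)) *\<^sub>R s x)"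
      using rec by (auto simp: taylor_recursion_def)
    have sl2: "s \<in> l2_space L" using s HC_space_props(3)[OF L] by (auto simp: stokes_def leray_def)
    have "a 2 k = (- (\<nu> * \<delta>0\<^sup>2 / 2)) *\<^sub>R fcoeff L s k"
      unfolding a_def fcoeff_cong_ae[OF l2_scaleR[OF sl2] U2] by (rule fcoeff_scaleR[OF sl2])
    thus ?thesis by (simp add: stokes_fcoeff[OF L s] scaleR_eq_smult mult.assoc)
  qed
  have an: "a (n + 1) k = ((real n - 1) / (real n + 1)) *\<^sub>R a (n - 1) k - (\<nu> * \<delta>0 / (real n + 1) * lam L k) *\<^sub>R a n k
      - (\<delta>0 / (real n + 1)) *\<^sub>R (\<Sum>h\<le>n. bhat L (a h) (a (n - h)) k)" if n: "n \<ge> 2" for n k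
  proof -
    define P where "P = {(h, k). h + k = n \<and> h \<ge> 1 \<and> k \<ge> (1::nat)}"
    have "\<forall>n\<ge>2. \<exists>a c. stokes L (U n) a \<and>
        (\<forall>h k. h + k = n \<and> h \<ge> 1 \<and> k \<ge> 1 \<longrightarrow> bilin L (U k) (U h) (c h k)) \<and>
        eq_ae L (U (n + 1)) (\<lambda>x. ((real n - 1) / (real n + 1)) *\<^sub>R U (n - 1) x
          - (\<nu> * \<delta>0 / (real n + 1)) *\<^sub>R a x
          - (\<delta>0 / (real n + 1)) *\<^sub>R (\<Sum>(h, k) \<in> {(h, k). h + k = n \<and> h \<ge> 1 \<and> k \<ge> 1}. c h k x))"
      using rec unfolding taylor_recursion_def by (elim conjE)
    from this[rule_format, OF n] obtain s c where s: "stokes L (U n) s"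
      and c: "\<And>h k. h + k = n \<Longrightarrow> h \<ge> 1 \<Longrightarrow> k \<ge> 1 \<Longrightarrow> bilin L (U k) (U h) (c h k)"
      and U: "eq_ae L (U (n + 1)) (\<lambda>x. ((real n - 1) / (real n + 1)) *\<^sub>R U (n - 1) x
          - (\<nu> * \<delta>0 / (real n + 1)) *\<^sub>R s x - (\<delta>0 / (real n + 1)) *\<^sub>R (\<Sum>(h, k)\<in>P. c h k x))"
      unfolding P_def by (elim exE conjE) blast
    have sl2: "s \<in> l2_space L" using s HC_space_props(3)[OF L] by (auto simp: stokes_def leray_def)
    have cl2: "c h k \<in> l2_space L" if "(h, k) \<in> P" for h k
      using c[of h k] that HC_space_props(3)[OF L] by (auto simp: bilin_def leray_def P_def)
    have cs: "(\<lambda>x. \<Sum>(h, k)\<in>P. c h k x) \<in> l2_space L"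
      using l2_sum[of P "\<lambda>p. c (fst p) (snd p)" L] cl2 by (simp add: case_prod_unfold)
    have fc: "fcoeff L (\<lambda>x. \<Sum>(h, k)\<in>P. c h k x) k = (\<Sum>(h, m)\<in>P. bhat L (a m) (a h) k)"
    proof -
      have "fcoeff L (\<lambda>x. \<Sum>(h, k)\<in>P. c h k x) k = (\<Sum>p\<in>P. fcoeff L (c (fst p) (snd p)) k)"
        using fcoeff_sum[of P "\<lambda>p. c (fst p) (snd p)" L k] cl2 by (simp add: case_prod_unfold)
      also have "\<dots> = (\<Sum>(h, m)\<in>P. bhat L (a m) (a h) k)"
      proof (rule sum.cong)
        fix p assume "p \<in> P"
        then obtain h m where p: "p = (h, m)" and hm: "h + m = n" "h \<ge> 1" "m \<ge> 1" by (auto simp: P_def)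
        show "fcoeff L (c (fst p) (snd p)) k = (case p of (h, m) \<Rightarrow> bhat L (a m) (a h) k)"
          using bilin_fcoeff[OF L c[OF hm] as Ua] by (simp add: p a_def)
      qed simp
      finally show ?thesis .
    qed
    have sum: "(\<Sum>(h, m)\<in>P. bhat L (a m) (a h) k) = (\<Sum>h\<le>n. bhat L (a h) (a (n - h)) k)"
      unfolding P_def by (rule sum_bhat_pairs[where a = a, OF a0])
    define W where "W = (\<lambda>x. ((real n - 1) / (real n + 1)) *\<^sub>R U (n - 1) x
          - (\<nu> * \<delta>0 / (real n + 1)) *\<^sub>R s x - (\<delta>0 / (real n + 1)) *\<^sub>R (\<Sum>(h, k)\<in>P. c h k x))"
    have Wl2: "W \<in> l2_space L" unfolding W_def by (intro l2_diff l2_scaleR Ul2 sl2 cs)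
    have "a (n + 1) k = fcoeff L W k" unfolding a_def using fcoeff_cong_ae[OF Wl2] U by (simp add: W_def)
    also have "\<dots> = ((real n - 1) / (real n + 1)) *\<^sub>R a (n - 1) k - (\<nu> * \<delta>0 / (real n + 1)) *\<^sub>R fcoeff L s k
      - (\<delta>0 / (real n + 1)) *\<^sub>R fcoeff L (\<lambda>x. \<Sum>(h, k)\<in>P. c h k x) k"
      unfolding W_def a_def
      by (simp add: fcoeff_diff l2_diff l2_scaleR Ul2 sl2 cs fcoeff_scaleR)
    also have "(\<nu> * \<delta>0 / (real n + 1)) *\<^sub>R fcoeff L s k = (\<nu> * \<delta>0 / (real n + 1) * lam L k) *\<^sub>R a n k"
      by (simp add: stokes_fcoeff[OF L s] scaleR_eq_smult a_def)
    finally show ?thesis unfolding fc sum .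
  qed
  have "coeff_recursion L \<nu> \<delta>0 (fcoeff L g) a"
    unfolding coeff_recursion_def
  proof (intro allI)
    fix n :: nat and k i
    \<comment> \<open>The first two cases come from the prescribed \<open>U_1\<close> and
      \<open>U_2\<close>; only from \<open>n = 2\<close> on does the general step apply.\<close>
    consider "n = 0" | "n = 1" | "n \<ge> 2" by linarith
    thus "of_nat (n + 1) * a (n + 1) k $ i - (of_nat n - 1) * a (n - 1) k $ i =
     of_real \<delta>0 * ((if n = 0 then fcoeff L g k $ i else 0) - of_real (\<nu> * lam L k) * a n k $ i
       - (\<Sum>h\<le>n. bhat L (a h) (a (n - h)) k $ i))"
    proof cases
      case 1
      thus ?thesis using a1[of k] by (simp add: a0' bhat_0_left scaleR_eq_smult)
    next
      case 2
      have "a (Suc 0) k = \<delta>0 *\<^sub>R fcoeff L g k" "a (Suc (Suc 0)) k = (- (\<nu> * \<delta>0\<^sup>2 / 2) * lam L k) *\<^sub>R fcoeff L g k"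
        using a1[of k] a2[of k] by (simp_all add: numeral_2_eq_2)
      thus ?thesis using 2 by (simp add: a0' bhat_0_left bhat_0_right scaleR_eq_smult power2_eq_square)
    next
      case 3
      define B where "B = (\<Sum>h\<le>n. bhat L (a h) (a (n - h)) k) $ i"
      define N where "N = complex_of_real (real n + 1)"
      have N: "N \<noteq> 0" "of_nat (n + 1) = N" "complex_of_nat n - 1 = of_real (real n - 1)"
        unfolding N_def of_real_eq_0_iff by auto
      have "a (n + 1) k $ i = of_real ((real n - 1) / (real n + 1)) * a (n - 1) k $ i - of_real (\<nu> * \<delta>0 / (real n + 1) * lam L k) * a n k $ i
         - of_real (\<delta>0 / (real n + 1)) * B"
        unfolding an[OF 3] B_def by (simp only: scaleR_eq_smult vector_minus_component vector_smult_component)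
      hence "a (n + 1) k $ i = (of_real (real n - 1) * a (n - 1) k $ i - of_real (\<nu> * \<delta>0 * lam L k) * a n k $ i - of_real \<delta>0 * B) / N"
        using N(1) by (simp only: N_def[symmetric] of_real_divide of_real_mult) (simp add: field_simps)
      hence "N * a (n + 1) k $ i = of_real (real n - 1) * a (n - 1) k $ i - of_real (\<nu> * \<delta>0 * lam L k) * a n k $ i - of_real \<delta>0 * B"
        using N(1) by simp
      moreover have "B = (\<Sum>h\<le>n. bhat L (a h) (a (n - h)) k $ i)" by (simp add: B_def)
      ultimately show ?thesis unfolding N(2,3) using 3 by (simp add: algebra_simps)
    qed
  qed
  thus "coeff_recursion L \<nu> \<delta>0 (fcoeff L g) (\<lambda>n. fcoeff L (U n))" by (simp add: a_def[abs_def])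
  show "fcoeff L (U 0) k = 0" "fcoeff L (U 1) k = \<delta>0 *\<^sub>R fcoeff L g k" using a0 a1 by (auto simp: a_def)
qed

text \<open>The norm of E_b controls each coefficient, so convergence of the series of fields yields
  a scalar power series for every mode and component.\<close>

lemma Eb_sums_props:
  assumes L: "L > 0" and b: "b > 0"
    and S: "\<And>T. norm T < 1 \<Longrightarrow> Eb_sums L b (\<lambda>n x. T ^ n *s U n x) (S T)"
  shows "U n \<in> l2_space L" "divfree (fcoeff L (U n))" "asum (fcoeff L (U n))"
    and "eq_ae L (U n) (fser L (fcoeff L (U n)))"
    and "norm T < 1 \<Longrightarrow> (\<lambda>n. fcoeff L (U n) k $ i * T ^ n) sums fcoeff L (S T) k $ i"
proof -
  have all: "U n \<in> l2_space L \<and> divfree (fcoeff L (U n)) \<and> wsum b (fcoeff L (U n)) \<and> asum (fcoeff L (U n))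
     \<and> eq_ae L (U n) (fser L (fcoeff L (U n)))" for n
  proof -
    \<comment> \<open>Only the terms \<open>T ^ n *s U n\<close> are known to lie in E_b. Taking
      \<open>T = 1/2\<close> and multiplying back by \<open>2 ^ n\<close> recovers
      \<open>U n\<close>.\<close>
    define c where "c = (1 / 2 :: complex) ^ n"
    define d where "d = (2 :: complex) ^ n"
    have dc: "d * c = 1" by (simp add: c_def d_def power_mult_distrib[symmetric])
    define V where "V = (\<lambda>x. c *s U n x)"
    have VE: "V \<in> Eb_space L b" using S[of "1/2"] by (simp add: Eb_sums_def V_def c_def)
    note p = Eb_space_props[OF L b VE]
    have UV: "U n = (\<lambda>x. d *s V x)" by (simp add: V_def dc)
    have fU: "fcoeff L (U n) k = d *s fcoeff L V k" for k unfolding UV by (rule fcoeff_smult[OF p(3)])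
    have "U n \<in> l2_space L" unfolding UV by (rule l2_smult[OF p(3)])
    moreover have "divfree (fcoeff L (U n))" using p(4) by (simp add: divfree_def fU kdot_smult)
    moreover have "wsum b (fcoeff L (U n))" unfolding fU by (rule wsum_smult[OF p(2)])
    moreover have "asum (fcoeff L (U n))" unfolding fU by (rule asum_smult[OF p(6)])
    moreover have "eq_ae L (U n) (fser L (fcoeff L (U n)))"
    proof -
      have "fser L (fcoeff L (U n)) = (\<lambda>x. d *s fser L (fcoeff L V) x)"
        unfolding fU using fser_smult[OF p(6)] by (auto simp: fU[abs_def])
      thus ?thesis using p(7) unfolding UV eq_ae_def by (auto elim!: AE_mp)
    qed
    ultimately show ?thesis by blast
  qed
  thus "U n \<in> l2_space L" "divfree (fcoeff L (U n))" "asum (fcoeff L (U n))"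
    and "eq_ae L (U n) (fser L (fcoeff L (U n)))" by auto
  assume T: "norm T < 1"
  define D where "D N = (\<lambda>x. (\<Sum>n<N. T ^ n *s U n x) - S T x)" for N
  have ES: "Eb_sums L b (\<lambda>n x. T ^ n *s U n x) (S T)" by (rule S[OF T])
  hence lim: "(\<lambda>N. Eb_norm L b (D N)) \<longlonglongrightarrow> 0" and SE: "S T \<in> Eb_space L b"
    by (auto simp: Eb_sums_def D_def)
  note Sp = Eb_space_props[OF L b SE]
  have Ul2: "(\<lambda>x. T ^ n *s U n x) \<in> l2_space L" for n using all by (auto intro: l2_smult)
  have fD: "fcoeff L (D N) k = (\<Sum>n<N. T ^ n *s fcoeff L (U n) k) - fcoeff L (S T) k" for N k
    unfolding D_def using all by (subst fcoeff_diff) (auto intro!: l2_sum l2_smult Sp simp: fcoeff_sum l2_smult fcoeff_smult)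
  have wpart: "wsum b (\<lambda>k. \<Sum>n<N. T ^ n *s fcoeff L (U n) k)" for N
  proof (induction N)
    case 0
    show ?case by (simp add: wsum_def)
  next
    case (Suc N)
    thus ?case using all by (auto intro!: wsum_add wsum_smult)
  qed
  have wD: "wsum b (fcoeff L (D N))" for N
    using wsum_diff[OF wpart Sp(2)] by (simp add: fD[abs_def])
  have "(\<lambda>N. fcoeff L (D N) k) \<longlonglongrightarrow> 0"
  proof (rule Lim_null_comparison)
    show "\<forall>\<^sub>F N in sequentially. norm (fcoeff L (D N) k) \<le> Eb_norm L b (D N) / L / Eb_weight b k"
      using norm_fcoeff_le_Eb_norm[OF L wD] by simp
    have "(\<lambda>N. Eb_norm L b (D N) / L / Eb_weight b k) \<longlonglongrightarrow> 0 / L / Eb_weight b k"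
      using L less_imp_neq[OF Eb_weight_pos[of b k]] by (intro tendsto_divide lim tendsto_const) auto
    thus "(\<lambda>N. Eb_norm L b (D N) / L / Eb_weight b k) \<longlonglongrightarrow> 0" by simp
  qed
  hence "(\<lambda>N. (\<Sum>n<N. T ^ n *s fcoeff L (U n) k)) \<longlonglongrightarrow> fcoeff L (S T) k"
    unfolding fD by (rule LIM_zero_cancel)
  hence "(\<lambda>N. (\<Sum>n<N. T ^ n *s fcoeff L (U n) k) $ i) \<longlonglongrightarrow> fcoeff L (S T) k $ i"
    by (rule tendsto_vec_nth)
  thus "(\<lambda>n. fcoeff L (U n) k $ i * T ^ n) sums fcoeff L (S T) k $ i"
    by (simp add: sums_def mult.commute)
qed

lemma series_imp_zero_in_attractor:
  fixes L \<nu> b \<delta> \<delta>0 M :: real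
  assumes L: "L > 0" and g: "g \<in> H_space L" and b: "b > 0" and \<delta>: "\<delta> > 0" and \<delta>0: "\<delta>0 = 4 * \<delta> / pi"
    and rec: "taylor_recursion L \<nu> \<delta>0 g U"
    and S: "\<And>T. norm T < 1 \<Longrightarrow> Eb_sums L b (\<lambda>n x. T ^ n *s U n x) (S T)"
    and M: "\<And>T. norm T < 1 \<Longrightarrow> Eb_norm L b (S T) \<le> M"
  shows "(\<lambda>x. 0) \<in> attractor L \<nu> g"
proof -
  define a where "a n = fcoeff L (U n)" for n
  define gh where "gh = fcoeff L g"
  note Up = Eb_sums_props[where U = U and S = S, OF L b S]
  have \<delta>0': "\<delta>0 > 0" using \<delta> \<delta>0 by simp
  have crec: "coeff_recursion L \<nu> \<delta>0 gh a" and a0: "\<And>k. a 0 k = 0" and a1: "\<And>k. a 1 k = \<delta>0 *\<^sub>R gh k"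
    using taylor_recursion_imp_coeff_recursion[OF L g rec Up(1,4,3)]
    by (auto simp: a_def[abs_def] gh_def)
  have sums: "(\<lambda>n. a n k $ i * T ^ n) sums fcoeff L (S T) k $ i" if "norm T < 1" for T k i
    using Up(5)[OF _ that] by (simp add: a_def)
  have SE: "S T \<in> Eb_space L b" if "norm T < 1" for T using S[OF that] by (simp add: Eb_sums_def)
  have Sb: "cmod (fcoeff L (S T) k $ i) \<le> M / L / Eb_weight b k" if T: "norm T < 1" for T k i
  proof -
    have "cmod (fcoeff L (S T) k $ i) \<le> norm (fcoeff L (S T) k)" by (rule Finite_Cartesian_Product.norm_nth_le)
    also have "\<dots> \<le> Eb_norm L b (S T) / L / Eb_weight b k"
      by (rule norm_fcoeff_le_Eb_norm[OF L Eb_space_props(2)[OF L b SE[OF T]]])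
    also have "\<dots> \<le> M / L / Eb_weight b k"
      using M[OF T] L by (intro divide_right_mono) (auto simp: less_imp_le)
    finally show ?thesis .
  qed
  \<comment> \<open>The factor 2 comes from the two components of a coefficient vector.\<close>
  define C where "C = 2 * (M / L)"
  have "cmod (a n k $ i) \<le> M / L / Eb_weight b k" for n k i
    by (rule powser_coeff_bound[OF sums Sb])
  hence dec: "decays b C (a n)" for n unfolding C_def by (rule decaysI_nth)
  have ps: "psum a T k = fcoeff L (S T) k" if "norm T < 1" for T k
    using sums_unique2[OF psum_sums[OF b dec that] sums[OF that]] by (simp add: vec_eq_iff)
  have df: "divfree (a n)" for n using Up(2) by (simp add: a_def)
  have gp: "divfree gh" "herm gh" using H_space_props[OF L g] by (auto simp: gh_def)
  have hm: "herm (a n)" for n by (rule coeff_recursion_herm[where a = a, OF a0 gp(2) crec])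
  \<comment> \<open>The force is assumed only to lie in H; its summability is read off
    \<open>U_1\<close>, a nonzero multiple of it.\<close>
  have ag: "asum gh"
  proof -
    have "gh k = of_real (1 / \<delta>0) *s a 1 k" for k using a1[of k] \<delta>0' by (simp add: scaleR_eq_smult)
    thus ?thesis using asum_smult[OF decays_asum[OF b dec[of 1]], of "of_real (1 / \<delta>0)"] by simp
  qed
  have gfs: "eq_ae L g (fser L gh)"
    by (rule trig_approx_eq_fser[OF L H_space_props(1)[OF L g] ag]) (simp add: gh_def)

  define v where "v z = psum a (tau \<delta> z)" for z
  define u where "u t = fser L (v (of_real t))" for t :: real
  define Mk where "Mk k = M / L / Eb_weight b k" for k
  have tau: "norm (tau \<delta> z) < 1" if "z \<in> strip \<delta>" for z by (rule norm_tau_less_1[OF \<delta> that])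
  have vb: "cmod (v z k $ i) \<le> Mk k" if "z \<in> strip \<delta>" for z k i
    unfolding v_def ps[OF tau[OF that]] Mk_def by (rule Sb[OF tau[OF that]])
  have vdec: "decays b C (v z)" if "z \<in> strip \<delta>" for z
    unfolding C_def by (rule decaysI_nth) (use vb[OF that] in \<open>auto simp: Mk_def\<close>)
  have vdf: "divfree (v z)" if "z \<in> strip \<delta>" for z
    unfolding v_def by (rule psum_divfree[OF b dec tau[OF that] df])
  \<comment> \<open>\<open>tau\<close> maps real times to real \<open>T\<close>, where a series with
    Hermitian coefficients sums to a Hermitian value; hence \<open>u t\<close> is real.\<close>
  have vhm: "herm (v (of_real t))" for t
  proof -
    obtain r where r: "tau \<delta> (of_real t) = of_real r" using tau_of_real by blast
    have "norm (tau \<delta> (of_real t)) < 1" by (rule tau[OF of_real_in_strip[OF \<delta>]])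
    hence "\<bar>r\<bar> < 1" by (simp add: r)
    thus ?thesis unfolding v_def r by (rule psum_herm[OF b dec _ hm])
  qed
  \<comment> \<open>The factor \<open>1 - T^2\<close> from the chain rule is exactly the one in the
    equation for \<open>T\<close>, and \<open>pi / (4 * \<delta>)\<close> cancels
    \<open>\<delta>0\<close>.\<close>
  have vder: "((\<lambda>z. v z k $ i) has_field_derivative galerkin_rhs L \<nu> gh (v z) k $ i) (at z)" if z: "z \<in> strip \<delta>" for z k i
  proof -
    define D where "D = deriv (\<lambda>T. psum a T k $ i) (tau \<delta> z)"
    have psd: "((\<lambda>T. psum a T k $ i) has_field_derivative D) (at (tau \<delta> z))"
      unfolding D_def by (rule psum_has_deriv[where a = a, OF b dec a0 tau[OF z]])
    have "((\<lambda>z. psum a (tau \<delta> z) k $ i) has_field_derivative D * ((1 - (tau \<delta> z)\<^sup>2) * of_real (pi / (4 * \<delta>)))) (at z)"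
      by (rule DERIV_chain2[OF psd tau_has_deriv[OF \<delta> z]])
    moreover have "D * ((1 - (tau \<delta> z)\<^sup>2) * of_real (pi / (4 * \<delta>))) = ((1 - (tau \<delta> z)\<^sup>2) * D) * of_real (1 / \<delta>0)"
      by (simp add: \<delta>0)
    also have "\<dots> = galerkin_rhs L \<nu> gh (psum a (tau \<delta> z)) k $ i"
      unfolding coeff_recursion_imp_ode[where a = a, OF b dec a0 crec tau[OF z] psd] using \<delta>0' by simp
    ultimately show ?thesis by (simp add: v_def)
  qed
  \<comment> \<open>A disc of the same radius \<open>\<delta>\<close> fits in the strip around every
    real time, so the derivative bounds do not depend on \<open>t\<close>.\<close>
  have hol: "(\<lambda>z. v z k $ i) holomorphic_on ball (of_real t) \<delta>" for t k i
    unfolding holomorphic_on_def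
    using vder strip_ball_subset[of t \<delta>] by (meson field_differentiable_at_within field_differentiable_def subsetD)
  define w where "w t = galerkin_rhs L \<nu> gh (v (of_real t))" for t :: real
  have dw: "deriv (\<lambda>z. v z k $ i) (of_real t) = w t k $ i" for t k i
    unfolding w_def by (rule DERIV_imp_deriv[OF vder[OF of_real_in_strip[OF \<delta>]]])
  have vbb: "cmod (v z k $ i) \<le> Mk k" if "z \<in> ball (of_real t) \<delta>" for z k i t
    by (rule vb) (use that strip_ball_subset in blast)
  have wb: "cmod (w t k $ i) \<le> M / L / \<delta> / Eb_weight b k" for t k i
    using holomorphic_first_order_bounds(1)[OF hol[of k i t] \<delta> vbb[where t = t and k = k and i = i]] by (simp add: dw Mk_def mult_ac)
  have wdec: "decays b (2 * (M / L / \<delta>)) (w t)" for t by (rule decaysI_nth[OF wb])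
  have rem: "cmod (v (of_real t + of_real h) k $ i - v (of_real t) k $ i - of_real h * w t k $ i) \<le> 2 * Mk k * \<bar>h\<bar>\<^sup>2 / \<delta>\<^sup>2"
    if "\<bar>h\<bar> \<le> \<delta> / 2" for t h k i
    using holomorphic_first_order_bounds(2)[OF hol[of k i t] \<delta> vbb[where t = t and k = k and i = i], of "of_real h"] that by (simp add: dw)
  have vas: "asum (v (of_real t))" for t by (rule decays_asum[OF b vdec[OF of_real_in_strip[OF \<delta>]]])
  have was: "asum (w t)" for t by (rule decays_asum[OF b wdec])
  have whm: "herm (w t)" for t
    unfolding w_def galerkin_rhs_def herm_def
    using herm_bhat[OF vhm vhm, of L t t] vhm[of t] gp(2) by (simp add: herm_def lam_def kabs_def)
  have wdf: "divfree (w t)" for t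
    unfolding w_def galerkin_rhs_def divfree_def
    using gp(1) vdf[OF of_real_in_strip[OF \<delta>], of t]
    by (simp add: divfree_def kdot_diff kdot_smult bhat_def kdot_leray_symbol)
  have uH: "u t \<in> H_space L" for t
    unfolding u_def by (rule H_spaceI[OF L vas[of t] vdf[OF of_real_in_strip[OF \<delta>]] vhm]) (simp add: eq_ae_def)
  have ns: "ns_solution L \<nu> g u"
    unfolding ns_solution_def
  proof (intro allI conjI)
    fix t
    show "u t \<in> H_space L" by (rule uH)
    have in_s: "of_real t \<in> strip \<delta>" by (rule of_real_in_strip[OF \<delta>])
    note vd = vdec[OF in_s]
    \<comment> \<open>In each mode the difference quotient errs by a multiple of \<open>|h|\<close>
      over the weight. Summing over modes gives a uniform bound on the error field, hence an L2
      bound of order \<open>|h|\<close>.\<close>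
    have lim: "((\<lambda>h. l2_norm L (\<lambda>x. (1 / h) *\<^sub>R (u (t + h) x - u t x) - fser L (w t) x)) \<longlongrightarrow> 0) (at 0)"
    proof (rule Lim_null_comparison)
      \<comment> \<open>Twice the constant 2 of the second-order remainder, once for each
        component.\<close>
      define Q where "Q = 4 * (M / L) / \<delta>\<^sup>2"
      define s where "s = (\<Sum>\<^sub>\<infinity>k. 1 / Eb_weight b k)"
      have sw: "(\<lambda>k. 1 / Eb_weight b k) summable_on UNIV"
        by (rule summable_on_comparison_test[OF summable_on_Eb_weight[OF b]])
           (auto intro!: divide_right_mono one_le_kabs_sq simp: less_imp_le)
      have ev: "eventually (\<lambda>h::real. h \<noteq> 0 \<and> \<bar>h\<bar> \<le> \<delta> / 2) (at 0)"
        unfolding eventually_at by (rule exI[of _ "\<delta> / 2"]) (use \<delta> in auto)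
      show "\<forall>\<^sub>F h in at 0. norm (l2_norm L (\<lambda>x. (1 / h) *\<^sub>R (u (t + h) x - u t x) - fser L (w t) x)) \<le> L * (Q * \<bar>h\<bar> * s)"
        using ev
      proof eventually_elim
        case (elim h)
        define e where "e k = (1 / h) *\<^sub>R (v (of_real (t + h)) k - v (of_real t) k) - w t k" for k
        have aes: "asum e" unfolding e_def scaleR_eq_smult by (intro asum_diff asum_smult vas was)
        have ef: "(\<lambda>x. (1 / h) *\<^sub>R (u (t + h) x - u t x) - fser L (w t) x) = fser L e"
          unfolding e_def u_def scaleR_eq_smult
          by (rule ext) (simp only: fser_diff fser_smult asum_diff asum_smult vas was)
        have eb: "norm (e k) \<le> Q * \<bar>h\<bar> * (1 / Eb_weight b k)" for k
        proof -
          have "cmod (e k $ i) \<le> 2 * Mk k * \<bar>h\<bar> / \<delta>\<^sup>2" for i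
          proof -
            have "e k $ i = (v (of_real t + of_real h) k $ i - v (of_real t) k $ i - of_real h * w t k $ i) / of_real h"
              using elim by (simp add: e_def scaleR_eq_smult field_simps)
            hence "cmod (e k $ i) \<le> (2 * Mk k * \<bar>h\<bar>\<^sup>2 / \<delta>\<^sup>2) / \<bar>h\<bar>"
              using divide_right_mono[OF rem[of h t k i], of "\<bar>h\<bar>"] elim
              by (simp only: norm_divide norm_of_real abs_ge_zero)
            moreover have "x * H\<^sup>2 / y / H = x * H / y" if "H \<noteq> 0" for x y H :: real
              using that by (simp add: power2_eq_square)
            ultimately show ?thesis using elim by (metis abs_eq_0_iff)
          qed
          hence "norm (e k) \<le> (\<Sum>i\<in>(UNIV::2 set). 2 * Mk k * \<bar>h\<bar> / \<delta>\<^sup>2)"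
            by (intro order_trans[OF norm_vec_le_sum] sum_mono)
          thus ?thesis by (simp add: Q_def Mk_def mult_ac)
        qed
        have "l2_norm L (fser L e) \<le> L * (\<Sum>\<^sub>\<infinity>k. norm (e k))" by (rule fser_l2(2)[OF L aes])
        also have "(\<Sum>\<^sub>\<infinity>k. norm (e k)) \<le> (\<Sum>\<^sub>\<infinity>k. Q * \<bar>h\<bar> * (1 / Eb_weight b k))"
          by (rule infsum_mono[OF aes summable_on_cmult_right[OF sw] eb])
        also have "\<dots> = Q * \<bar>h\<bar> * s" unfolding s_def by (rule infsum_cmult_right')
        finally show ?case using L by (simp add: ef)
      qed
      have "((\<lambda>h. L * (Q * \<bar>h\<bar> * s)) \<longlongrightarrow> L * (Q * \<bar>0\<bar> * s)) (at 0)" by (intro tendsto_intros)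
      thus "((\<lambda>h. L * (Q * \<bar>h\<bar> * s)) \<longlongrightarrow> 0) (at 0)" by simp
    qed
    have st: "stokes L (u t) (fser L (\<lambda>k. of_real (lam L k) *s v (of_real t) k))"
      by (rule stokes_fser[OF L vas vdf[OF in_s] decays_asum_lam[OF b vd]]) (simp add: u_def eq_ae_def)
    have bl: "bilin L (u t) (u t) (fser L (bhat L (v (of_real t)) (v (of_real t))))"
      unfolding u_def by (rule bilin_fser[OF vas decays_asum_dcoef[OF b vd] L vdf[OF in_s] vdf[OF in_s] vas])
    have eq: "fser L (w t) x + \<nu> *\<^sub>R fser L (\<lambda>k. of_real (lam L k) *s v (of_real t) k) x
        + fser L (bhat L (v (of_real t)) (v (of_real t))) x = fser L gh x" for x
    proof -
      have "w t = (\<lambda>k. gh k - \<nu> *\<^sub>R (of_real (lam L k) *s v (of_real t) k) - bhat L (v (of_real t)) (v (of_real t)) k)"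
        by (auto simp: w_def galerkin_rhs_def scaleR_eq_smult)
      hence "fser L (w t) x = fser L gh x - \<nu> *\<^sub>R fser L (\<lambda>k. of_real (lam L k) *s v (of_real t) k) x
          - fser L (bhat L (v (of_real t)) (v (of_real t))) x"
        unfolding scaleR_eq_smult
        by (simp only: fser_diff fser_smult asum_diff asum_smult ag decays_asum_lam[OF b vd]
            asum_bhat[OF vas decays_asum_dcoef[OF b vd]])
      thus ?thesis by simp
    qed
    have wH: "fser L (w t) \<in> H_space L" by (rule H_spaceI[OF L was[of t] wdf whm]) (simp add: eq_ae_def)
    show "\<exists>u'\<in>H_space L. \<exists>a c.
           ((\<lambda>h. l2_norm L (\<lambda>x. (1 / h) *\<^sub>R (u (t + h) x - u t x) - u' x)) \<longlongrightarrow> 0) (at 0) \<and>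
           stokes L (u t) a \<and> bilin L (u t) (u t) c \<and>
           eq_ae L (\<lambda>x. u' x + \<nu> *\<^sub>R a x + c x) g"
      using wH lim st bl eq_ae_sym[OF gfs]
      by (intro bexI[of _ "fser L (w t)"] exI[of _ "fser L (\<lambda>k. of_real (lam L k) *s v (of_real t) k)"]
          exI[of _ "fser L (bhat L (v (of_real t)) (v (of_real t)))"] conjI) (simp_all only: eq)
  qed
  have u0: "eq_ae L (u 0) (\<lambda>x. 0)"
  proof -
    have "psum a 0 k = 0" for k
    proof -
      have "psum a 0 k $ i = a 0 k $ i" for i unfolding psum_def by (simp add: powser_zero)
      thus ?thesis by (simp add: a0 vec_eq_iff)
    qed
    hence "u 0 x = 0" for x by (simp add: u_def v_def tau_0 fser_def)
    thus ?thesis by (simp add: eq_ae_def)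
  qed
  have "bdd_above (range (\<lambda>t. l2_norm L (u t)))"
  proof (rule bdd_aboveI)
    fix r assume "r \<in> range (\<lambda>t. l2_norm L (u t))"
    then obtain t where r: "r = l2_norm L (u t)" by blast
    have "r \<le> L * (\<Sum>\<^sub>\<infinity>k. norm (v (of_real t) k))" unfolding r u_def by (rule fser_l2(2)[OF L vas])
    also have "\<dots> \<le> L * (\<Sum>\<^sub>\<infinity>k. C * ((kabs k + 1)\<^sup>2 / Eb_weight b k))"
    proof (intro mult_left_mono infsum_mono vas summable_on_cmult_right summable_on_Eb_weight b)
      fix k
      have "norm (v (of_real t) k) \<le> C * (1 / Eb_weight b k)"
        using vdec[OF of_real_in_strip[OF \<delta>]] by (simp add: decays_def)
      also have "\<dots> \<le> C * ((kabs k + 1)\<^sup>2 / Eb_weight b k)"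
        using decays_nonneg[OF dec] one_le_kabs_sq
        by (intro mult_left_mono divide_right_mono) (auto simp: less_imp_le)
      finally show "norm (v (of_real t) k) \<le> C * ((kabs k + 1)\<^sup>2 / Eb_weight b k)" .
    qed (use L in simp)
    finally show "r \<le> L * (\<Sum>\<^sub>\<infinity>k. C * ((kabs k + 1)\<^sup>2 / Eb_weight b k))" .
  qed
  moreover have "(\<lambda>x. 0) \<in> H_space L"
    by (rule H_spaceI[OF L, of "\<lambda>k. 0"]) (auto simp: divfree_def herm_def kdot_0 eq_ae_def fser_def)
  ultimately show ?thesis using ns u0 by (auto simp: attractor_def)
qed

section \<open>From the solution to the series\<close>

lemma norm_sq_vec: "(norm (v::complex^'n))\<^sup>2 = (\<Sum>i\<in>UNIV. (cmod (v $ i))\<^sup>2)"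
  by (simp add: norm_vec_def L2_set_def sum_nonneg)

lemma asum_sum: "(\<And>n. n \<in> I \<Longrightarrow> asum (a n)) \<Longrightarrow> asum (\<lambda>k. \<Sum>n\<in>I. a n k)"
proof (induction I rule: infinite_finite_induct)
  case (insert n I)
  thus ?case by (simp add: asum_add)
qed auto

lemma fser_zero: "fser L (\<lambda>k. 0) x = 0"
  by (simp add: fser_def)

lemma fser_sum: "(\<And>n. n \<in> I \<Longrightarrow> asum (a n)) \<Longrightarrow> fser L (\<lambda>k. \<Sum>n\<in>I. a n k) x = (\<Sum>n\<in>I. fser L (a n) x)"
proof (induction I rule: infinite_finite_induct)
  case (insert n I)
  thus ?case by (simp add: fser_add asum_sum)
qed (auto simp: fser_zero)

text \<open>Uniform decay puts every \<open>fser L (a n)\<close> into the domains of A and B, so the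
  multiplier and convolution series serve as witnesses for the values of the operators.\<close>

lemma coeff_recursion_imp_taylor_recursion:
  assumes L: "L > 0" and b: "b > 0" and \<delta>: "\<delta>0 > 0" and g: "g \<in> H_space L"
    and dec: "\<And>n. decays b C (a n)" and df: "\<And>n. divfree (a n)" and a0: "\<And>k. a 0 k = 0"
    and rec: "coeff_recursion L \<nu> \<delta>0 (fcoeff L g) a"
  shows "taylor_recursion L \<nu> \<delta>0 g (\<lambda>n. fser L (a n))"
proof -
  define gh where "gh = fcoeff L g"
  note r = rec[unfolded coeff_recursion_def, rule_format, folded gh_def]
  have a0': "a 0 = (\<lambda>k. 0)" using a0 by auto
  have a1: "a 1 k = \<delta>0 *\<^sub>R gh k" for k
    using r[of 0 k] by (simp add: vec_eq_iff a0' bhat_0_left scaleR_eq_smult)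
  have a2: "a 2 k = (- (\<nu> * \<delta>0\<^sup>2 / 2)) *\<^sub>R (of_real (lam L k) *s gh k)" for k
  proof -
    have "2 * a 2 k $ i = of_real \<delta>0 * (- (of_real (\<nu> * lam L k) * a 1 k $ i))" for i
      using r[of 1 k i] by (simp add: a0' bhat_0_left bhat_0_right numeral_2_eq_2)
    hence "a 2 k $ i = of_real \<delta>0 * (- (of_real (\<nu> * lam L k) * a 1 k $ i)) / 2" for i
      by (metis nonzero_mult_div_cancel_left zero_neq_numeral)
    thus ?thesis using a1[of k] by (simp add: vec_eq_iff scaleR_eq_smult power2_eq_square)
  qed
  have an: "a (n + 1) k = ((real n - 1) / (real n + 1)) *\<^sub>R a (n - 1) k - (\<nu> * \<delta>0 / (real n + 1)) *\<^sub>R (of_real (lam L k) *s a n k)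
      - (\<delta>0 / (real n + 1)) *\<^sub>R (\<Sum>(h, m)\<in>{(h, m). h + m = n \<and> h \<ge> 1 \<and> m \<ge> 1}. bhat L (a m) (a h) k)" if n: "n \<ge> 2" for n k
  proof -
    define B where "B = (\<Sum>h\<le>n. bhat L (a h) (a (n - h)) k)"
    define N where "N = complex_of_real (real n + 1)"
    have N: "N \<noteq> 0" "of_nat (n + 1) = N" "complex_of_nat n - 1 = of_real (real n - 1)"
      unfolding N_def of_real_eq_0_iff by auto
    have "a (n + 1) k $ i = of_real ((real n - 1) / (real n + 1)) * a (n - 1) k $ i - of_real (\<nu> * \<delta>0 / (real n + 1)) * (of_real (lam L k) * a n k $ i)
         - of_real (\<delta>0 / (real n + 1)) * B $ i" for i
    proof -
      have "N * a (n + 1) k $ i = of_real (real n - 1) * a (n - 1) k $ i - of_real (\<nu> * \<delta>0 * lam L k) * a n k $ i - of_real \<delta>0 * B $ i"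
        using r[of n k i] n unfolding N(2,3) by (simp add: B_def algebra_simps)
      hence "a (n + 1) k $ i = (of_real (real n - 1) * a (n - 1) k $ i - of_real (\<nu> * \<delta>0 * lam L k) * a n k $ i - of_real \<delta>0 * B $ i) / N"
        using N(1) by (metis nonzero_mult_div_cancel_left)
      thus ?thesis using N(1) by (simp only: N_def[symmetric] of_real_divide of_real_mult) (simp add: field_simps)
    qed
    thus ?thesis unfolding sum_bhat_pairs[where a = a, OF a0] B_def[symmetric] by (simp add: vec_eq_iff scaleR_eq_smult)
  qed
  have as: "asum (a n)" for n by (rule decays_asum[OF b dec])
  have asl: "asum (\<lambda>k. of_real (lam L k) *s a n k)" for n by (rule decays_asum_lam[OF b dec])
  have asb: "asum (bhat L (a m) (a n))" for m n by (rule asum_bhat[OF as decays_asum_dcoef[OF b dec]])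
  \<comment> \<open>Regularity of the force is inherited from the first Taylor coefficient, which
    decays like all the others.\<close>
  have gh: "gh k = of_real (1 / \<delta>0) *s a 1 k" for k using \<delta> unfolding a1 by (simp add: scaleR_eq_smult)
  have ag: "asum gh" using asum_smult[OF as[of 1], of "of_real (1 / \<delta>0)"] by (simp only: gh)
  have agl: "asum (\<lambda>k. of_real (lam L k) *s gh k)"
    using asum_smult[OF asl[of 1], of "of_real (1 / \<delta>0)"] by (simp add: gh mult.commute)
  have gfs: "eq_ae L g (fser L gh)"
    by (rule trig_approx_eq_fser[OF L H_space_props(1)[OF L g] ag]) (simp add: gh_def)
  have gdf: "divfree gh" using H_space_props[OF L g] by (simp add: gh_def)
  show ?thesis
    unfolding taylor_recursion_def
  proof (intro conjI allI impI)
    show "eq_ae L (fser L (a 0)) (\<lambda>x. 0)" by (simp add: a0' fser_zero eq_ae_def)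
    have "fser L (a 1) x = \<delta>0 *\<^sub>R fser L gh x" for x
    proof -
      have "a 1 = (\<lambda>k. \<delta>0 *\<^sub>R gh k)" using a1 by auto
      thus ?thesis by (simp add: fser_scaleR[OF ag])
    qed
    thus "eq_ae L (fser L (a 1)) (\<lambda>x. \<delta>0 *\<^sub>R g x)"
      using gfs unfolding eq_ae_def by (auto elim!: AE_mp)
    have "stokes L g (fser L (\<lambda>k. of_real (lam L k) *s gh k))"
      by (rule stokes_fser[OF L ag gdf agl gfs])
    moreover have "fser L (a 2) x = (- (\<nu> * \<delta>0\<^sup>2 / 2)) *\<^sub>R fser L (\<lambda>k. of_real (lam L k) *s gh k) x" for x
    proof -
      have "a 2 = (\<lambda>k. (- (\<nu> * \<delta>0\<^sup>2 / 2)) *\<^sub>R (of_real (lam L k) *s gh k))" using a2 by auto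
      thus ?thesis by (simp only: fser_scaleR[OF agl])
    qed
    ultimately show "\<exists>a'. stokes L g a' \<and> eq_ae L (fser L (a 2)) (\<lambda>x. (- (\<nu> * \<delta>0\<^sup>2 / 2)) *\<^sub>R a' x)"
      by (intro exI[of _ "fser L (\<lambda>k. of_real (lam L k) *s gh k)"]) (simp add: eq_ae_def)
  next
    fix n :: nat assume n: "n \<ge> 2"
    define P where "P = {(h, m). h + m = n \<and> h \<ge> 1 \<and> m \<ge> (1::nat)}"
    have "fser L (a (n + 1)) x = ((real n - 1) / (real n + 1)) *\<^sub>R fser L (a (n - 1)) x
          - (\<nu> * \<delta>0 / (real n + 1)) *\<^sub>R fser L (\<lambda>k. of_real (lam L k) *s a n k) x
          - (\<delta>0 / (real n + 1)) *\<^sub>R (\<Sum>(h, m)\<in>P. fser L (bhat L (a m) (a h)) x)" for x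
    proof -
      have ap: "asum (\<lambda>k. \<Sum>p\<in>P. bhat L (a (snd p)) (a (fst p)) k)" by (intro asum_sum asb)
      have "a (n + 1) = (\<lambda>k. ((real n - 1) / (real n + 1)) *\<^sub>R a (n - 1) k - (\<nu> * \<delta>0 / (real n + 1)) *\<^sub>R (of_real (lam L k) *s a n k)
      - (\<delta>0 / (real n + 1)) *\<^sub>R (\<Sum>p\<in>P. bhat L (a (snd p)) (a (fst p)) k))"
        using an[OF n] by (auto simp: P_def case_prod_unfold)
      hence "fser L (a (n + 1)) x = ((real n - 1) / (real n + 1)) *\<^sub>R fser L (a (n - 1)) x
          - (\<nu> * \<delta>0 / (real n + 1)) *\<^sub>R fser L (\<lambda>k. of_real (lam L k) *s a n k) x
          - (\<delta>0 / (real n + 1)) *\<^sub>R fser L (\<lambda>k. \<Sum>p\<in>P. bhat L (a (snd p)) (a (fst p)) k) x"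
        unfolding scaleR_eq_smult
        by (simp only: fser_diff fser_smult asum_diff asum_smult as asl ap)
      also have "fser L (\<lambda>k. \<Sum>p\<in>P. bhat L (a (snd p)) (a (fst p)) k) x = (\<Sum>(h, m)\<in>P. fser L (bhat L (a m) (a h)) x)"
        by (subst fser_sum) (auto simp: asb case_prod_unfold)
      finally show ?thesis .
    qed
    moreover have "stokes L (fser L (a n)) (fser L (\<lambda>k. of_real (lam L k) *s a n k))"
      by (rule stokes_fser[OF L as df asl]) (simp add: eq_ae_def)
    moreover have "bilin L (fser L (a m)) (fser L (a h)) (fser L (bhat L (a m) (a h)))" for h m
      by (rule bilin_fser[OF as decays_asum_dcoef[OF b dec] L df df as])
    ultimately show "\<exists>a' c. stokes L (fser L (a n)) a' \<and>
        (\<forall>h k. h + k = n \<and> h \<ge> 1 \<and> k \<ge> 1 \<longrightarrow> bilin L (fser L (a k)) (fser L (a h)) (c h k)) \<and>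
        eq_ae L (fser L (a (n + 1))) (\<lambda>x. ((real n - 1) / (real n + 1)) *\<^sub>R fser L (a (n - 1)) x
          - (\<nu> * \<delta>0 / (real n + 1)) *\<^sub>R a' x
          - (\<delta>0 / (real n + 1)) *\<^sub>R (\<Sum>(h, k) \<in> {(h, k). h + k = n \<and> h \<ge> 1 \<and> k \<ge> 1}. c h k x))"
      by (intro exI[of _ "fser L (\<lambda>k. of_real (lam L k) *s a n k)"] exI[of _ "\<lambda>h m. fser L (bhat L (a m) (a h))"])
         (simp add: eq_ae_def P_def)
  qed
qed

text \<open>Taking a coefficient is a functional bounded by \<open>Eb_norm\<close>, so difference
  quotients converging in that norm converge in each component.\<close>

lemma Eb_holomorphic_fcoeff:
  assumes L: "L > 0" and b: "b > 0" and f: "Eb_holomorphic_on L b f S"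
  shows "(\<lambda>z. fcoeff L (f z) k $ i) holomorphic_on S"
  unfolding holomorphic_on_def
proof
  fix z assume z: "z \<in> S"
  have S: "open S" and fE: "\<And>z. z \<in> S \<Longrightarrow> f z \<in> Eb_space L b" using f by (auto simp: Eb_holomorphic_on_def)
  obtain w where w: "w \<in> Eb_space L b"
    and lim: "((\<lambda>h. Eb_norm L b (\<lambda>x. (1 / h) *s (f (z + h) x - f z x) - w x)) \<longlongrightarrow> 0) (at 0)"
    using f z by (auto simp: Eb_holomorphic_on_def)
  note wp = Eb_space_props[OF L b w] and zp = Eb_space_props[OF L b fE[OF z]]
  obtain e where e: "e > 0" "ball z e \<subseteq> S" using S z by (meson open_contains_ball)
  define q where "q h = (1 / h) *s (fcoeff L (f (z + h)) k - fcoeff L (f z) k) - fcoeff L w k" for h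
  have "(q \<longlongrightarrow> 0) (at 0)"
  proof (rule Lim_null_comparison)
    have "\<forall>\<^sub>F h in at 0. norm (h::complex) < e"
      unfolding eventually_at by (rule exI[of _ e]) (use e in auto)
    thus "\<forall>\<^sub>F h in at 0. norm (q h) \<le> Eb_norm L b (\<lambda>x. (1 / h) *s (f (z + h) x - f z x) - w x) / L / Eb_weight b k"
    proof eventually_elim
      case (elim h)
      hence "z + h \<in> S" using e by (auto simp: dist_norm subset_iff)
      note hp = Eb_space_props[OF L b fE[OF this]]
      have fc: "fcoeff L (\<lambda>x. (1 / h) *s (f (z + h) x - f z x) - w x) k
          = (1 / h) *s (fcoeff L (f (z + h)) k - fcoeff L (f z) k) - fcoeff L w k" for k
        using hp(3) zp(3) wp(3) by (simp add: fcoeff_diff fcoeff_smult l2_diff l2_smult del: vector_ssub_ldistrib)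
      have "wsum b (fcoeff L (\<lambda>x. (1 / h) *s (f (z + h) x - f z x) - w x))"
        unfolding fc[abs_def] by (intro wsum_diff wsum_smult hp zp wp)
      from norm_fcoeff_le_Eb_norm[OF L this, of k] show ?case unfolding fc q_def .
    qed
    have "((\<lambda>h. Eb_norm L b (\<lambda>x. (1 / h) *s (f (z + h) x - f z x) - w x) / L / Eb_weight b k) \<longlongrightarrow> 0 / L / Eb_weight b k) (at 0)"
      using L less_imp_neq[OF Eb_weight_pos[of b k]] by (intro tendsto_divide lim tendsto_const) auto
    thus "((\<lambda>h. Eb_norm L b (\<lambda>x. (1 / h) *s (f (z + h) x - f z x) - w x) / L / Eb_weight b k) \<longlongrightarrow> 0) (at 0)" by simp
  qed
  hence "((\<lambda>h. q h $ i) \<longlongrightarrow> 0 $ i) (at 0)" by (rule tendsto_vec_nth)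
  hence "((\<lambda>h. (fcoeff L (f (z + h)) k $ i - fcoeff L (f z) k $ i) / h - fcoeff L w k $ i) \<longlongrightarrow> 0) (at 0)"
    by (simp add: q_def diff_divide_distrib)
  hence "((\<lambda>h. (fcoeff L (f (z + h)) k $ i - fcoeff L (f z) k $ i) / h) \<longlongrightarrow> fcoeff L w k $ i) (at 0)"
    by (rule LIM_zero_cancel)
  hence "((\<lambda>z. fcoeff L (f z) k $ i) has_field_derivative fcoeff L w k $ i) (at z)"
    by (simp add: DERIV_def)
  thus "(\<lambda>z. fcoeff L (f z) k $ i) field_differentiable at z within S"
    by (auto simp: field_differentiable_def intro: has_field_derivative_at_within)
qed

text \<open>The L2 time derivative passes to coefficients by continuity, and the equation identifies
  its limit. Convergence is along real increments only.\<close>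

lemma ns_solution_fcoeff_tendsto:
  assumes L: "L > 0" and ns: "ns_solution L \<nu> g u" and g: "g \<in> H_space L"
    and c: "asum c" and u: "eq_ae L (u t) (fser L c)"
  shows "((\<lambda>h. (fcoeff L (u (t + h)) k $ i - fcoeff L (u t) k $ i) / of_real h) \<longlongrightarrow> galerkin_rhs L \<nu> (fcoeff L g) c k $ i) (at 0)"
proof -
  obtain u' s n where u': "u' \<in> H_space L"
    and lim: "((\<lambda>h. l2_norm L (\<lambda>x. (1 / h) *\<^sub>R (u (t + h) x - u t x) - u' x)) \<longlongrightarrow> 0) (at 0)"
    and s: "stokes L (u t) s" and n: "bilin L (u t) (u t) n"
    and eq: "eq_ae L (\<lambda>x. u' x + \<nu> *\<^sub>R s x + n x) g"
    using ns unfolding ns_solution_def by blast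
  have ul2: "u r \<in> l2_space L" for r using ns by (auto simp: ns_solution_def H_space_def)
  have u'l2: "u' \<in> l2_space L" and gl2: "g \<in> l2_space L" using u' g by (auto simp: H_space_def)
  have sl2: "s \<in> l2_space L" using s HC_space_props(3)[OF L] by (auto simp: stokes_def leray_def)
  have nl2: "n \<in> l2_space L" using n HC_space_props(3)[OF L] by (auto simp: bilin_def leray_def)
  have uc: "fcoeff L (u t) = c"
    using fcoeff_cong_ae[OF fser_l2(1)[OF L c] u] fcoeff_fser[OF L c] by auto
  have "fcoeff L u' k + \<nu> *\<^sub>R fcoeff L s k + fcoeff L n k = fcoeff L g k"
    using fcoeff_cong_ae[OF gl2 eq, of k] u'l2 sl2 nl2 by (simp add: fcoeff_add fcoeff_scaleR l2_add l2_scaleR)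
  moreover have "fcoeff L s k = of_real (lam L k) *s c k" using stokes_fcoeff[OF L s] by (simp add: uc)
  moreover have "fcoeff L n k = bhat L c c k" using bilin_fcoeff[OF L n c u] by (simp add: uc)
  ultimately have u'c: "fcoeff L u' k = galerkin_rhs L \<nu> (fcoeff L g) c k"
    by (simp add: galerkin_rhs_def scaleR_eq_smult algebra_simps)
  define q where "q h = (1 / h) *\<^sub>R (fcoeff L (u (t + h)) k - fcoeff L (u t) k) - fcoeff L u' k" for h
  have "(q \<longlongrightarrow> 0) (at 0)"
  proof (rule Lim_null_comparison)
    have "norm (q h) \<le> l2_norm L (\<lambda>x. (1 / h) *\<^sub>R (u (t + h) x - u t x) - u' x) / L" for h
    proof -
      have "fcoeff L (\<lambda>x. (1 / h) *\<^sub>R (u (t + h) x - u t x) - u' x) k = q h"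
        unfolding q_def using ul2 u'l2
        by (simp add: fcoeff_diff fcoeff_scaleR l2_diff l2_scaleR del: scaleR_diff_right)
      thus ?thesis using norm_fcoeff_le[OF L, of "\<lambda>x. (1 / h) *\<^sub>R (u (t + h) x - u t x) - u' x" k] ul2 u'l2
        by (simp add: l2_diff l2_scaleR del: scaleR_diff_right)
    qed
    thus "\<forall>\<^sub>F h in at 0. norm (q h) \<le> l2_norm L (\<lambda>x. (1 / h) *\<^sub>R (u (t + h) x - u t x) - u' x) / L" by simp
    have "((\<lambda>h. l2_norm L (\<lambda>x. (1 / h) *\<^sub>R (u (t + h) x - u t x) - u' x) / L) \<longlongrightarrow> 0 / L) (at 0)"
      using L by (intro tendsto_divide lim tendsto_const) auto
    thus "((\<lambda>h. l2_norm L (\<lambda>x. (1 / h) *\<^sub>R (u (t + h) x - u t x) - u' x) / L) \<longlongrightarrow> 0) (at 0)" by simp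
  qed
  hence "((\<lambda>h. q h $ i) \<longlongrightarrow> 0 $ i) (at 0)" by (rule tendsto_vec_nth)
  hence "((\<lambda>h. (fcoeff L (u (t + h)) k $ i - fcoeff L (u t) k $ i) / of_real h - fcoeff L u' k $ i) \<longlongrightarrow> 0) (at 0)"
    by (simp add: q_def scaleR_eq_smult diff_divide_distrib)
  hence "((\<lambda>h. (fcoeff L (u (t + h)) k $ i - fcoeff L (u t) k $ i) / of_real h) \<longlongrightarrow> fcoeff L u' k $ i) (at 0)"
    by (rule LIM_zero_cancel)
  thus ?thesis by (simp add: u'c)
qed

text \<open>The equation is autonomous. The shift puts every point of the bounded orbit through zero
  into the attractor, as the extension property requires.\<close>

lemma ns_solution_shift:
  assumes ns: "ns_solution L \<nu> g u"
  shows "ns_solution L \<nu> g (\<lambda>s. u (t + s))"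
  unfolding ns_solution_def
  by (rule allI) (rule ns[unfolded ns_solution_def, THEN spec, of "t + _", unfolded add.assoc[of t]])

lemma zero_in_attractor_imp_series:
  fixes L \<nu> b \<delta> \<delta>0 :: real
  assumes L: "L > 0" and g: "g \<in> H_space L" and adm: "admissible_constants L \<nu> g b \<delta>"
    and \<delta>0: "\<delta>0 = 4 * \<delta> / pi" and att: "(\<lambda>x. 0) \<in> attractor L \<nu> g"
  shows "\<exists>U. taylor_recursion L \<nu> \<delta>0 g U \<and>
      (\<exists>S. (\<forall>T::complex. norm T < 1 \<longrightarrow> Eb_sums L b (\<lambda>n x. T ^ n *s U n x) (S T)) \<and>
           (\<exists>M>0. \<forall>T::complex. norm T < 1 \<longrightarrow> Eb_norm L b (S T) \<le> M))"
proof -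
  have b: "b > 0" and \<delta>: "\<delta> > 0" using adm by (auto simp: admissible_constants_def)
  have \<delta>0': "\<delta>0 > 0" using \<delta> \<delta>0 by simp
  obtain u where ns: "ns_solution L \<nu> g u" and u0: "eq_ae L (u 0) (\<lambda>x. 0)"
    and bdd: "bdd_above (range (\<lambda>t. l2_norm L (u t)))"
    using att by (auto simp: attractor_def)
  have uatt: "u t \<in> attractor L \<nu> g" for t
  proof -
    have "bdd_above (range (\<lambda>s. l2_norm L (u (t + s))))"
      by (rule bdd_above_mono[OF bdd]) auto
    thus ?thesis unfolding attractor_def using ns ns_solution_shift[OF ns, of t]
      by (auto intro!: exI[of _ "\<lambda>s. u (t + s)"] simp: eq_ae_def ns_solution_def)
  qed
  have "\<exists>C. \<forall>u. ns_solution L \<nu> g u \<and> (\<forall>t. u t \<in> attractor L \<nu> g) \<longrightarrow>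
          (\<exists>f. Eb_holomorphic_on L b f (strip \<delta>) \<and>
             (\<forall>t::real. eq_ae L (f (of_real t)) (u t)) \<and>
             (\<forall>\<zeta>\<in>strip \<delta>. Eb_norm L b (f \<zeta>) \<le> C))"
    using adm att unfolding admissible_constants_def by (elim conjE) (drule mp)
  then obtain C where extn: "\<forall>u. ns_solution L \<nu> g u \<and> (\<forall>t. u t \<in> attractor L \<nu> g) \<longrightarrow>
          (\<exists>f. Eb_holomorphic_on L b f (strip \<delta>) \<and>
             (\<forall>t::real. eq_ae L (f (of_real t)) (u t)) \<and>
             (\<forall>\<zeta>\<in>strip \<delta>. Eb_norm L b (f \<zeta>) \<le> C))" ..
  from extn[THEN spec, THEN mp, OF conjI[OF ns allI[OF uatt]]] obtain f
    where f: "Eb_holomorphic_on L b f (strip \<delta>) \<and> (\<forall>t::real. eq_ae L (f (of_real t)) (u t)) \<and>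
      (\<forall>\<zeta>\<in>strip \<delta>. Eb_norm L b (f \<zeta>) \<le> C)" ..
  have hol: "Eb_holomorphic_on L b f (strip \<delta>)" using f ..
  have fu: "eq_ae L (f (of_real t)) (u t)" for t :: real
    using f[THEN conjunct2, THEN conjunct1] ..
  have C: "Eb_norm L b (f z) \<le> C" if "z \<in> strip \<delta>" for z
    using f[THEN conjunct2, THEN conjunct2] that ..
  have fE: "f z \<in> Eb_space L b" if "z \<in> strip \<delta>" for z using hol that by (simp add: Eb_holomorphic_on_def)
  have "0 \<in> strip \<delta>" using of_real_in_strip[OF \<delta>, of 0] by simp
  hence C0: "C \<ge> 0" by (rule order_trans[OF Eb_norm_nonneg C])
  define \<phi> where "\<phi> k i z = fcoeff L (f z) k $ i" for k i z
  have \<phi>hol: "\<phi> k i holomorphic_on strip \<delta>" for k i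
    unfolding \<phi>_def by (rule Eb_holomorphic_fcoeff[OF L b hol])
  have \<phi>der: "(\<phi> k i has_field_derivative deriv (\<phi> k i) z) (at z)" if "z \<in> strip \<delta>" for k i z
    by (rule holomorphic_derivI[OF \<phi>hol open_strip that])
  have uE: "u t \<in> l2_space L" for t using ns by (auto simp: ns_solution_def H_space_def)
  have fcu: "fcoeff L (f (of_real t)) k = fcoeff L (u t) k" for t k
    by (rule fcoeff_cong_ae[OF uE fu])
  \<comment> \<open>Along real increments the same difference quotient has two limits: the complex
    derivative of the extension and, from the L2 equation, the right-hand side.\<close>
  have \<phi>ode: "deriv (\<phi> k i) (of_real t) = galerkin_rhs L \<nu> (fcoeff L g) (fcoeff L (f (of_real t))) k $ i" for k i t
  proof -
    have ts: "of_real t \<in> strip \<delta>" by (rule of_real_in_strip[OF \<delta>])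
    note fp = Eb_space_props[OF L b fE[OF ts]]
    have 1: "((\<lambda>h. (fcoeff L (u (t + h)) k $ i - fcoeff L (u t) k $ i) / of_real h) \<longlongrightarrow>
        galerkin_rhs L \<nu> (fcoeff L g) (fcoeff L (f (of_real t))) k $ i) (at 0)"
      by (rule ns_solution_fcoeff_tendsto[OF L ns g fp(6) eq_ae_trans[OF eq_ae_sym[OF fu] fp(7)]])
    have "((\<lambda>h. (\<phi> k i (of_real t + h) - \<phi> k i (of_real t)) / h) \<longlongrightarrow> deriv (\<phi> k i) (of_real t)) (at 0)"
      using \<phi>der[OF ts] by (simp add: DERIV_def)
    moreover have "filterlim complex_of_real (at 0) (at 0)"
      unfolding filterlim_at by (auto simp: eventually_at_filter intro!: tendsto_eq_intros)
    ultimately have "((\<lambda>h::real. (\<phi> k i (of_real t + of_real h) - \<phi> k i (of_real t)) / of_real h) \<longlongrightarrow> deriv (\<phi> k i) (of_real t)) (at 0)"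
      by (rule filterlim_compose)
    hence 2: "((\<lambda>h. (fcoeff L (u (t + h)) k $ i - fcoeff L (u t) k $ i) / of_real h) \<longlongrightarrow> deriv (\<phi> k i) (of_real t)) (at 0)"
      by (simp add: \<phi>_def of_real_add[symmetric] fcu del: of_real_add)
    show ?thesis by (rule tendsto_unique[OF _ 2 1]) simp
  qed
  define F where "F k i T = \<phi> k i (zeta \<delta> T)" for k i T
  have zs: "zeta \<delta> T \<in> strip \<delta>" if "norm T < 1" for T by (rule zeta_in_strip[OF \<delta> that])
  have Fder: "(F k i has_field_derivative deriv (\<phi> k i) (zeta \<delta> T) * (of_real \<delta>0 / (1 - T\<^sup>2))) (at T)" if T: "norm T < 1" for k i T
    unfolding F_def \<delta>0 by (rule DERIV_chain2[OF \<phi>der[OF zs[OF T]] zeta_has_deriv[OF \<delta> T]])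
  have Fhol: "F k i holomorphic_on ball 0 1" for k i
    unfolding holomorphic_on_def
    using Fder by (meson field_differentiable_at_within field_differentiable_def mem_ball_0)
  define a :: "nat \<Rightarrow> int^2 \<Rightarrow> complex^2" where "a n k = (\<chi> i. (deriv ^^ n) (F k i) 0 / fact n)" for n k
  have sums: "(\<lambda>n. a n k $ i * T ^ n) sums F k i T" if "norm T < 1" for k i T
    using holomorphic_power_series[OF Fhol, of T k i] that by (simp add: a_def)
  have FE: "F k i T = fcoeff L (f (zeta \<delta> T)) k $ i" for k i T by (simp add: F_def \<phi>_def)

  \<comment> \<open>Mode and component are merged into one index and the weight is built in, so
    finite sums of squares are partial sums of the E_b norm and the vector-valued power series
    bounds apply.\<close>
  define x where "x p n = of_real (Eb_weight b (fst p)) * a n (fst p) $ snd p" for p :: "(int^2) \<times> 2" and n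
  define y where "y p T = of_real (Eb_weight b (fst p)) * F (fst p) (snd p) T" for p :: "(int^2) \<times> 2" and T
  have xy: "(\<lambda>n. x p n * T ^ n) sums y p T" if "norm T < 1" for p T
    unfolding x_def y_def using sums_mult[OF sums[OF that]] by (simp add: mult.assoc)
  have nsum: "(\<Sum>p\<in>K \<times> UNIV. (cmod (of_real (Eb_weight b (fst p)) * c (fst p) $ snd p))\<^sup>2) = (\<Sum>k\<in>K. (norm (Eb_weight b k *\<^sub>R c k))\<^sup>2)"
    for K and c :: "int^2 \<Rightarrow> complex^2"
  proof -
    have "(\<Sum>p\<in>K \<times> UNIV. (cmod (of_real (Eb_weight b (fst p)) * c (fst p) $ snd p))\<^sup>2)
        = (\<Sum>(k, j)\<in>K \<times> UNIV. (cmod (of_real (Eb_weight b k) * c k $ j))\<^sup>2)"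
      by (simp add: case_prod_unfold)
    also have "\<dots> = (\<Sum>k\<in>K. \<Sum>j\<in>UNIV. (cmod (of_real (Eb_weight b k) * c k $ j))\<^sup>2)"
      by (rule sum.cartesian_product[symmetric])
    also have "\<dots> = (\<Sum>k\<in>K. (norm (Eb_weight b k *\<^sub>R c k))\<^sup>2)"
      unfolding norm_sq_vec scaleR_eq_smult by simp
    finally show ?thesis .
  qed
  have yb: "(\<Sum>p\<in>K \<times> UNIV. (cmod (y p T))\<^sup>2) \<le> (C / L)\<^sup>2" if K: "finite K" and T: "norm T < 1" for K T
  proof -
    have "(\<Sum>p\<in>K \<times> UNIV. (cmod (y p T))\<^sup>2) = (\<Sum>k\<in>K. (norm (Eb_weight b k *\<^sub>R fcoeff L (f (zeta \<delta> T)) k))\<^sup>2)"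
      unfolding y_def FE by (rule nsum)
    also have "\<dots> \<le> (Eb_norm L b (f (zeta \<delta> T)) / L)\<^sup>2"
      by (rule Eb_norm_sum_le[OF L Eb_space_props(2)[OF L b fE[OF zs[OF T]]] K])
    also have "\<dots> \<le> (C / L)\<^sup>2" using C[OF zs[OF T]] L Eb_norm_nonneg
      by (intro power_mono divide_right_mono) auto
    finally show ?thesis .
  qed
  have CL: "C / L \<ge> 0" using C0 L by simp
  have ab: "(\<Sum>k\<in>K. (norm (Eb_weight b k *\<^sub>R a n k))\<^sup>2) \<le> (C / L)\<^sup>2" if K: "finite K" for K n
  proof -
    have "(\<Sum>p\<in>K \<times> UNIV. (cmod (x p n))\<^sup>2) \<le> (C / L)\<^sup>2"
      by (rule powser_l2_coeff_bound[OF _ CL xy yb[OF K]]) (use K in auto)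
    thus ?thesis unfolding x_def nsum .
  qed
  have rb: "(\<Sum>k\<in>K. (norm (Eb_weight b k *\<^sub>R ((\<Sum>n<N. T ^ n *s a n k) - fcoeff L (f (zeta \<delta> T)) k)))\<^sup>2)
      \<le> (C / L * norm T ^ N / (1 - norm T))\<^sup>2" if K: "finite K" and T: "norm T < 1" for K N T
  proof -
    have "(\<Sum>p\<in>K \<times> UNIV. (cmod (y p T - (\<Sum>n<N. x p n * T ^ n)))\<^sup>2) \<le> (C / L * norm T ^ N / (1 - norm T))\<^sup>2"
      by (rule powser_l2_remainder_bound[OF _ CL xy yb[OF K] T]) (use K in auto)
    moreover have "cmod (y p T - (\<Sum>n<N. x p n * T ^ n)) =
        cmod (of_real (Eb_weight b (fst p)) * ((\<Sum>n<N. T ^ n *s a n (fst p)) - fcoeff L (f (zeta \<delta> T)) (fst p)) $ snd p)" for p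
    proof -
      have "y p T - (\<Sum>n<N. x p n * T ^ n) = - (of_real (Eb_weight b (fst p)) * ((\<Sum>n<N. T ^ n *s a n (fst p)) - fcoeff L (f (zeta \<delta> T)) (fst p)) $ snd p)"
        by (simp add: x_def y_def FE sum_distrib_left algebra_simps)
      thus ?thesis by (simp only: norm_minus_cancel)
    qed
    ultimately show ?thesis
      unfolding nsum[where K = K and c = "\<lambda>k. (\<Sum>n<N. T ^ n *s a n k) - fcoeff L (f (zeta \<delta> T)) k", symmetric]
      by (simp only:)
  qed
  have dec: "decays b (C / L) (a n)" for n
    unfolding decays_def
  proof
    fix k
    have "(norm (Eb_weight b k *\<^sub>R a n k))\<^sup>2 \<le> (C / L)\<^sup>2" using ab[of "{k}" n] by simp
    hence "norm (Eb_weight b k *\<^sub>R a n k) \<le> C / L" by (rule power2_le_imp_le) (rule CL)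
    thus "norm (a n k) \<le> C / L / Eb_weight b k" using L by (simp add: field_simps less_imp_le)
  qed
  have wa: "wsum b (a n)" for n unfolding wsum_def
    by (rule nonneg_bdd_above_summable_on) (auto intro!: bdd_aboveI[where M = "(C / L)\<^sup>2"] ab simp del: norm_scaleR)
  have ps: "psum a T k = fcoeff L (f (zeta \<delta> T)) k" if "norm T < 1" for T k
    using sums_unique2[OF psum_sums[OF b dec that] sums[OF that]] by (simp add: vec_eq_iff FE)
  \<comment> \<open>The divergence condition holds for the sum at every \<open>T\<close>, so
    uniqueness of power series coefficients passes it to each Taylor coefficient.\<close>
  have df: "divfree (a n)" for n
  proof -
    have fd: "divfree (fcoeff L (f (zeta \<delta> T)))" if "norm T < 1" for T
      by (rule Eb_space_props(4)[OF L b fE[OF zs[OF that]]])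
    have "kdot k (a n k) = 0" for k
    proof (rule powser_eq_real[where f = "\<lambda>T. 0" and g = "\<lambda>T. 0" and c = "\<lambda>n. 0"])
      fix T :: complex assume T: "norm T < 1"
      have "(\<lambda>n. of_int (k $ 1) * (a n k $ 1 * T ^ n) + of_int (k $ 2) * (a n k $ 2 * T ^ n)) sums kdot k (fcoeff L (f (zeta \<delta> T)) k)"
        unfolding kdot_def FE[symmetric] by (intro sums_add sums_mult sums T)
      moreover have "(\<lambda>n. of_int (k $ 1) * (a n k $ 1 * T ^ n) + of_int (k $ 2) * (a n k $ 2 * T ^ n)) = (\<lambda>n. kdot k (a n k) * T ^ n)"
        by (simp add: kdot_def algebra_simps)
      ultimately show "(\<lambda>n. kdot k (a n k) * T ^ n) sums 0" using fd[OF T] by (simp add: divfree_def)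
    qed auto
    moreover have "a n 0 $ i = 0" for i
    proof (rule powser_eq_real[where f = "\<lambda>T. 0" and g = "\<lambda>T. 0" and c = "\<lambda>n. 0"])
      fix T :: complex assume T: "norm T < 1"
      show "(\<lambda>n. a n 0 $ i * T ^ n) sums 0" using sums[OF T, of 0 i] fd[OF T] by (simp add: FE divfree_def)
    qed auto
    ultimately show ?thesis by (simp add: divfree_def vec_eq_iff)
  qed
  have a0: "a 0 k = 0" for k
  proof -
    have "fcoeff L (f 0) k = 0"
      using fcu[of 0 k] fcoeff_cong_ae[OF l2_zero u0, of k] by (simp add: fcoeff_zero)
    thus ?thesis by (simp add: a_def FE zeta_0 vec_eq_iff)
  qed
  \<comment> \<open>Real \<open>T\<close> has real \<open>zeta\<close>, the only points where the
    differential equation has been established.\<close>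
  have rec: "coeff_recursion L \<nu> \<delta>0 (fcoeff L g) a"
  proof (rule ode_imp_coeff_recursion[where a = a, OF b dec a0])
    fix T :: real and k i assume T: "\<bar>T\<bar> < 1"
    define z where "z = complex_of_real T"
    have nz: "norm z < 1" using T by (simp add: z_def)
    obtain r where r: "zeta \<delta> z = of_real r" using zeta_of_real[OF T] unfolding z_def by blast
    have "((\<lambda>T. psum a T k $ i) has_field_derivative deriv (\<phi> k i) (zeta \<delta> z) * (of_real \<delta>0 / (1 - z\<^sup>2))) (at z)"
    proof (rule has_field_derivative_transform_within_open[OF Fder[OF nz]])
      show "F k i w = psum a w k $ i" if "w \<in> ball 0 1" for w using that by (simp add: ps FE)
    qed (use nz in auto)
    hence "deriv (\<lambda>T. psum a T k $ i) z = deriv (\<phi> k i) (of_real r) * (of_real \<delta>0 / (1 - z\<^sup>2))"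
      unfolding r by (rule DERIV_imp_deriv)
    also have "\<dots> = galerkin_rhs L \<nu> (fcoeff L g) (psum a z) k $ i * (of_real \<delta>0 / (1 - z\<^sup>2))"
    proof -
      have "psum a z = fcoeff L (f (of_real r))" using ps[OF nz] by (auto simp: r)
      thus ?thesis by (simp add: \<phi>ode)
    qed
    finally have d: "deriv (\<lambda>T. psum a T k $ i) z = galerkin_rhs L \<nu> (fcoeff L g) (psum a z) k $ i * (of_real \<delta>0 / (1 - z\<^sup>2))" .
    have "1 - z\<^sup>2 \<noteq> 0"
    proof
      assume "1 - z\<^sup>2 = 0"
      hence "z\<^sup>2 = 1" by simp
      hence "norm z ^ 2 = 1" by (metis norm_one norm_power)
      thus False using power_strict_mono[OF nz norm_ge_zero, of 2] by simp
    qed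
    thus "(1 - (complex_of_real T)\<^sup>2) * deriv (\<lambda>T. psum a T k $ i) (of_real T) = of_real \<delta>0 * galerkin_rhs L \<nu> (fcoeff L g) (psum a (of_real T)) k $ i"
      using d by (simp add: z_def)
  qed
  have as: "asum (a n)" for n by (rule decays_asum[OF b dec])
  have tr: "taylor_recursion L \<nu> \<delta>0 g (\<lambda>n. fser L (a n))"
    by (rule coeff_recursion_imp_taylor_recursion[where a = a, OF L b \<delta>0' g dec df a0 rec])
  have Es: "Eb_sums L b (\<lambda>n x. T ^ n *s fser L (a n) x) (f (zeta \<delta> T))" if T: "norm T < 1" for T
    unfolding Eb_sums_def
  proof (intro conjI allI)
    show "f (zeta \<delta> T) \<in> Eb_space L b" by (rule fE[OF zs[OF T]])
    show "(\<lambda>x. T ^ n *s fser L (a n) x) \<in> Eb_space L b" for n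
    proof -
      have "fser L (\<lambda>k. T ^ n *s a n k) \<in> Eb_space L b"
        using df[of n] by (intro Eb_spaceI L asum_smult as wsum_smult wa) (simp add: divfree_def kdot_smult)
      moreover have "fser L (\<lambda>k. T ^ n *s a n k) = (\<lambda>x. T ^ n *s fser L (a n) x)"
        by (rule ext) (rule fser_smult[OF as])
      ultimately show ?thesis by simp
    qed
    define D where "D N = (\<lambda>x. (\<Sum>n<N. T ^ n *s fser L (a n) x) - f (zeta \<delta> T) x)" for N
    have fl2: "f (zeta \<delta> T) \<in> l2_space L" by (rule Eb_space_props(3)[OF L b fE[OF zs[OF T]]])
    have al2: "(\<lambda>x. T ^ n *s fser L (a n) x) \<in> l2_space L" for n by (intro l2_smult fser_l2(1) L as)
    have fD: "fcoeff L (D N) k = (\<Sum>n<N. T ^ n *s a n k) - fcoeff L (f (zeta \<delta> T)) k" for N k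
      unfolding D_def
      by (simp add: fcoeff_diff l2_sum al2 fl2 fcoeff_sum fcoeff_smult fser_l2(1)[OF L as] fcoeff_fser[OF L as])
    have DN: "Eb_norm L b (D N) \<le> L * (C / L * norm T ^ N / (1 - norm T))" for N
    proof (rule wsum_Eb_norm_le(2)[OF L])
      show "0 \<le> C / L * norm T ^ N / (1 - norm T)"
        using C0 L T by (intro divide_nonneg_nonneg mult_nonneg_nonneg) auto
    qed (unfold fD, rule rb[OF _ T])
    show "(\<lambda>N. Eb_norm L b (\<lambda>x. (\<Sum>n<N. T ^ n *s fser L (a n) x) - f (zeta \<delta> T) x)) \<longlonglongrightarrow> 0"
    proof (rule Lim_null_comparison)
      show "\<forall>\<^sub>F N in sequentially. norm (Eb_norm L b (\<lambda>x. (\<Sum>n<N. T ^ n *s fser L (a n) x) - f (zeta \<delta> T) x)) \<le> L * (C / L * norm T ^ N / (1 - norm T))"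
        using DN Eb_norm_nonneg by (simp add: D_def)
      have "(\<lambda>N. L * (C / L * norm T ^ N / (1 - norm T))) \<longlonglongrightarrow> L * (C / L * 0 / (1 - norm T))"
        by (intro tendsto_intros LIMSEQ_power_zero) (use T in auto)
      thus "(\<lambda>N. L * (C / L * norm T ^ N / (1 - norm T))) \<longlonglongrightarrow> 0" by simp
    qed
  qed
  \<comment> \<open>Adding 1 makes the bound strictly positive, since \<open>C\<close> may be
    zero.\<close>
  have "Eb_norm L b (f (zeta \<delta> T)) \<le> C + 1" if "norm T < 1" for T
    using C[OF zs[OF that]] by simp
  thus ?thesis using tr Es C0
    by (intro exI[of _ "\<lambda>n. fser L (a n)"] conjI exI[of _ "\<lambda>T. f (zeta \<delta> T)"] exI[of _ "C + 1"]) auto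
qed


theorem theorem8p1:
  fixes L \<nu> b \<delta> \<delta>0 :: real and g :: vfield
  assumes "L > 0" and "\<nu> > 0"
    and "g \<in> H_space L"
    and "admissible_constants L \<nu> g b \<delta>"
    and "\<delta>0 = 4 * \<delta> / pi"
  shows "(\<lambda>x. 0) \<in> attractor L \<nu> g \<longleftrightarrow>
    (\<exists>U. taylor_recursion L \<nu> \<delta>0 g U \<and>
      (\<exists>S. (\<forall>T::complex. norm T < 1 \<longrightarrow> Eb_sums L b (\<lambda>n x. T ^ n *s U n x) (S T)) \<and>
           (\<exists>M>0. \<forall>T::complex. norm T < 1 \<longrightarrow> Eb_norm L b (S T) \<le> M)))"
proof -
  have "b > 0" "\<delta> > 0" using assms(4) by (auto simp: admissible_constants_def)
  thus ?thesis
    using zero_in_attractor_imp_series[OF assms(1,3,4,5)]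
      series_imp_zero_in_attractor[OF assms(1,3) _ _ assms(5)] by blast
qed

end
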